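(* Let $p$ be an odd prime, $m\ge1$, $q$ a prime power with $p\nmid q$, and $K=\overline{\mathbb{F}}_q$. (i) If $\mathrm{PGU}_n(q)$ contains an elementary abelian subgroup $E$ of order $p^{2m}$, not contained in any maximal torus of $\mathrm{PGL}_n(K)$, with $C_{\mathrm{PGU}_n(q)}(E)\cong E\times\mathrm{PGU}_k(q)$ for some $1\le k<n$ and $N_{\mathrm{PGU}_n(q)}(E)/C_{\mathrm{PGU}_n(q)}(E)\cong\mathrm{Sp}_{2m}(p)$, then $p^m\mid n$ and $q\equiv-1\pmod p$. (ii) Conversely, if $p^m\mid n$ and $q\equiv-1\pmod p$, such a subgroup $E$ of $\mathrm{PGU}_n(q)$ exists.
   Context: $\mathrm{PGU}_n(q)$ is viewed as the fixed-point group $\mathrm{PGL}_n(K)^F$ of a Steinberg endomorphism $F$ of $\mathrm{PGL}_n(K)$ (Frobenius composed with transpose-inverse). *)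

theory Defs
  imports "HOL-Algebra.Algebraic_Closure_Type" "HOL-Algebra.Group_Action"
    "Jordan_Normal_Form.Determinant" "HOL-Number_Theory.Cong"
begin

definition GL :: "nat \<Rightarrow> ('a::field) mat monoid" where
  "GL n = \<lparr>carrier = {A \<in> carrier_mat n n. det A \<noteq> 0}, monoid.mult = (\<lambda>A B. A * B), one = 1\<^sub>m n\<rparr>"

definition scalars :: "nat \<Rightarrow> ('a::field) mat set" where
  "scalars n = {c \<cdot>\<^sub>m 1\<^sub>m n | c. c \<noteq> 0}"

definition PGL :: "nat \<Rightarrow> ('a::field) mat set monoid" where
  "PGL n = GL n Mod scalars n"

definition frob_mat :: "nat \<Rightarrow> ('a::field) mat \<Rightarrow> 'a mat" where
  "frob_mat q A = map_mat (\<lambda>x. x ^ q) A"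

definition steinbergF :: "nat \<Rightarrow> nat \<Rightarrow> ('a::field) mat \<Rightarrow> 'a mat" where
  "steinbergF q n A = transpose_mat (inv\<^bsub>GL n\<^esub> (frob_mat q A))"

definition PGU :: "nat \<Rightarrow> nat \<Rightarrow> ('a::field) mat set monoid" where
  "PGU q n = (PGL n)\<lparr>carrier := {C \<in> carrier (PGL n). steinbergF q n ` C = C}\<rparr>"

definition maximal_torus_PGL :: "nat \<Rightarrow> ('a::field) mat set set \<Rightarrow> bool" where
  "maximal_torus_PGL n T \<longleftrightarrow>
     (\<exists>g \<in> carrier (GL n).
        T = (\<lambda>D. scalars n #>\<^bsub>GL n\<^esub> (g * D * inv\<^bsub>GL n\<^esub> g)) `
              {D \<in> carrier (GL n). diagonal_mat D})"

definition centralizer :: "('a, 'b) monoid_scheme \<Rightarrow> 'a set \<Rightarrow> 'a set" where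
  "centralizer G E = {g \<in> carrier G. \<forall>x \<in> E. g \<otimes>\<^bsub>G\<^esub> x = x \<otimes>\<^bsub>G\<^esub> g}"

definition elem_abelian_subgroup :: "('a, 'b) monoid_scheme \<Rightarrow> 'a set \<Rightarrow> nat \<Rightarrow> nat \<Rightarrow> bool" where
  "elem_abelian_subgroup G E p r \<longleftrightarrow>
     subgroup E G \<and> (\<forall>x \<in> E. \<forall>y \<in> E. x \<otimes>\<^bsub>G\<^esub> y = y \<otimes>\<^bsub>G\<^esub> x)
     \<and> (\<forall>x \<in> E. x [^]\<^bsub>G\<^esub> p = \<one>\<^bsub>G\<^esub>) \<and> finite E \<and> card E = p ^ r"

definition sympl_J :: "nat \<Rightarrow> ('a::field) mat" where
  "sympl_J m = four_block_mat (0\<^sub>m m m) (1\<^sub>m m) (- 1\<^sub>m m) (0\<^sub>m m m)"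

definition Sp :: "nat \<Rightarrow> ('a::field) mat monoid" where
  "Sp m = \<lparr>carrier = {A \<in> carrier_mat (2*m) (2*m). transpose_mat A * sympl_J m * A = sympl_J m},
           monoid.mult = (\<lambda>A B. A * B), one = 1\<^sub>m (2*m)\<rparr>"

definition good_subgroup :: "nat \<Rightarrow> nat \<Rightarrow> nat \<Rightarrow> nat \<Rightarrow> ('a::field) mat set set
     \<Rightarrow> ('g::field) itself \<Rightarrow> bool" where
  "good_subgroup q n p m E (_::'g itself) \<longleftrightarrow>
     elem_abelian_subgroup (PGU q n) E p (2*m)
     \<and> \<not> (\<exists>T. maximal_torus_PGL n T \<and> E \<subseteq> T)
     \<and> (\<exists>k. 1 \<le> k \<and> k < n \<and>
           (PGU q n)\<lparr>carrier := centralizer (PGU q n) E\<rparr>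
             \<cong> DirProd ((PGU q n)\<lparr>carrier := E\<rparr>) (PGU q k :: 'a mat set monoid))
     \<and> ((PGU q n)\<lparr>carrier := normalizer (PGU q n) E\<rparr>) Mod (centralizer (PGU q n) E)
             \<cong> (Sp m :: 'g mat monoid)"

end

theory Submission
  imports Defs "HOL-Combinatorics.Permutations" "HOL-Number_Theory.Residues"
    "HOL-Algebra.Multiplicative_Group" "HOL-Algebra.Sylow"
begin

text \<open>
  A coset of \<open>A\<close> is fixed by the Steinberg endomorphism iff \<open>A\<close> is a unitary similitude,
  \<open>A\<^sup>T F(A) = d\<close>, where \<open>F\<close> is the entrywise \<open>q\<close>-th power.

  Necessity. Lifts of elements of \<open>E\<close> commute up to \<open>p\<close>-th roots of unity; this defines an
  alternating pairing on \<open>E\<close> that is invariant under the normaliser, and its values \<open>\<omega>\<close> satisfy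
  \<open>\<omega>\<^bsup>q+1\<^esup> = 1\<close> by the similitude equation. If the pairing is trivial, the lifts are simultaneously
  diagonalisable and \<open>E\<close> is toral. A faithful action of \<open>Sp\<^sub>2\<^sub>m(p)\<close> on \<open>E\<close> has no proper nontrivial
  invariant subgroup, so the radical of the pairing is trivial. Then the representation
  \<open>M \<otimes> M\<^sup>-\<^sup>T\<close> of \<open>E\<close> on the \<open>n\<^sup>2\<close>-dimensional space splits into \<open>|E|\<close> eigenspaces which are permuted
  transitively by invertible maps, so \<open>p\<^bsup>2m\<^esup>\<close> divides \<open>n\<^sup>2\<close>.

  Irreducibility of the symplectic action: decompose \<open>E\<close> under the \<open>2\<^sup>m\<close> commuting involutions \<open>z\<^sub>S\<close>
  acting as \<open>-1\<close> on a set \<open>S\<close> of hyperbolic planes. Each \<open>z\<^bsub>{i}\<^esub>\<close> is a product of transvections, which have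
  order \<open>p\<close> and hence act trivially on groups of order \<open>p\<close>, so a nontrivial eigenspace has order at least \<open>p\<^sup>2\<close>.
  Faithfulness requires \<open>m\<close> eigenspaces, so there are exactly \<open>m\<close>, each of order \<open>p\<^sup>2\<close>, and permuting the
  hyperbolic planes shows that they cannot be divided between an invariant subgroup and its complement.

  Sufficiency. \<open>E\<close> is the image of the Weyl operators \<open>W\<^sub>u \<otimes> 1\<^sub>k\<close>, \<open>u \<in> F\<^sub>p\<^bsup>2m\<^esup>\<close>, which are unitary because
  \<open>q \<equiv> -1\<close> modulo \<open>p\<close>. Their commutant is \<open>1 \<otimes> M\<^sub>k\<close>. For symplectic \<open>s\<close> there is an intertwiner between
  \<open>u \<mapsto> W\<^sub>u\<close> and \<open>u \<mapsto> W\<^bsub>s u\<^esub>\<close>, and by Schur's lemma it is a similitude, so no further adjustment is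
  needed to realise \<open>s\<close> inside PGU.
\<close>


section \<open>Matrices: block sums and Kronecker products\<close>

text \<open>The isomorphism of N/C with Sp is abstract: it does not say that \<open>E\<close> is the
  natural module or that the commutator pairing is the standard form. Irreducibility can only come
  from a faithful action on a group of order p^(2m), hence the count of eigenspaces instead of
  transitivity on vectors. Lifts of \<open>E\<close> are defined only up to scalars and form a
  projective representation. In \<open>M\<close> tensor its inverse transpose the scalars cancel, so
  \<open>E\<close> acts honestly and has spectral projections; the price is a divisibility for n^2,
  and p^(2m) dividing n^2 gives p^m dividing n. For the converse, the phases of the Weyl operators
  make their cocycle exactly \<chi> of the symplectic form; commutators are its squares, nontrivial
  because p is odd. A symplectic s preserves this multiplication rule itself, so u -> W(s u) solves
  the same relations, and uniqueness of such solutions in dimension p^m produces the conjugating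
  matrix. Ranks are handled throughout by one-sided inverses of rectangular matrices.\<close>

lemma index_mult_mat_sum:
  assumes "A \<in> carrier_mat a b" "B \<in> carrier_mat b c" "i < a" "j < c"
  shows "(A * B) $$ (i, j) = (\<Sum>t<b. A $$ (i, t) * B $$ (t, j))"
  using assms by (auto simp: scalar_prod_def lessThan_atLeast0 intro!: sum.cong)

lemma sum_lessThan_mult:
  fixes f :: "nat \<Rightarrow> 'a::comm_monoid_add"
  shows "(\<Sum>i<a * b. f i) = (\<Sum>i<a. \<Sum>j<b. f (i * b + j))"
proof -
  have "(\<Sum>i<a * b. f i) = (\<Sum>i<a. sum f {i * b..<i * b + b})"
    by (rule sum.nat_group[symmetric])
  also have "\<dots> = (\<Sum>i<a. \<Sum>j<b. f (i * b + j))"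
  proof (rule sum.cong)
    fix i
    show "sum f {i * b..<i * b + b} = (\<Sum>j<b. f (i * b + j))"
      by (rule sum.reindex_bij_witness[of _ "\<lambda>j. i * b + j" "\<lambda>j. j - i * b"]) auto
  qed simp
  finally show ?thesis .
qed

lemma lessThan_mult_cases:
  assumes "(x::nat) < a * b"
  obtains i j where "i < a" "j < b" "x = i * b + j"
proof
  show "x div b < a" using assms by (simp add: less_mult_imp_div_less)
  show "x mod b < b" using assms by (cases "b = 0") auto
  show "x = x div b * b + x mod b" by simp
qed

lemma pair_index_less: "i < a \<Longrightarrow> j < b \<Longrightarrow> i * b + j < a * (b::nat)"
proof -
  assume "i < a" "j < b"
  then have "i * b + j < Suc i * b" by simp
  also have "\<dots> \<le> a * b" using \<open>i < a\<close> by (intro mult_right_mono) auto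
  finally show ?thesis .
qed

text \<open>Padding both factors with zeros to a by a matrices makes them one-sided, hence
  two-sided, inverses, but in the other order the product has a zero row once b < a. This inequality
  replaces rank arguments later on.\<close>

lemma left_inverse_dim_le:
  fixes A :: "'a::field mat"
  assumes A: "A \<in> carrier_mat a b" and B: "B \<in> carrier_mat b a" and AB: "A * B = 1\<^sub>m a"
  shows "a \<le> b"
proof (rule ccontr)
  assume "\<not> a \<le> b"
  then have ba: "b < a" by simp
  define A' where "A' = mat a a (\<lambda>(i, j). if j < b then A $$ (i, j) else 0)"
  define B' where "B' = mat a a (\<lambda>(i, j). if i < b then B $$ (i, j) else 0)"
  have A': "A' \<in> carrier_mat a a" and B': "B' \<in> carrier_mat a a"
    by (auto simp: A'_def B'_def)
  have "A' * B' = 1\<^sub>m a"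
  proof (rule eq_matI)
    fix i j assume ij: "i < dim_row (1\<^sub>m a)" "j < dim_col (1\<^sub>m a)"
    have "(A' * B') $$ (i, j) = (\<Sum>t<a. A' $$ (i, t) * B' $$ (t, j))"
      using ij by (intro index_mult_mat_sum[OF A' B']) auto
    also have "\<dots> = (\<Sum>t<a. if t < b then A $$ (i, t) * B $$ (t, j) else 0)"
      using ij by (intro sum.cong) (auto simp: A'_def B'_def)
    also have "\<dots> = (\<Sum>t<b. A $$ (i, t) * B $$ (t, j))"
      using ba by (intro sum.mono_neutral_cong_right) auto
    also have "\<dots> = (A * B) $$ (i, j)"
      using ij by (intro index_mult_mat_sum[OF A B, symmetric]) auto
    finally show "(A' * B') $$ (i, j) = 1\<^sub>m a $$ (i, j)" by (simp add: AB)
  qed (use A' B' in auto)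
  then have "B' * A' = 1\<^sub>m a"
    by (rule mat_mult_left_right_inverse[OF A' B'])
  moreover have "(B' * A') $$ (b, b) = 0"
    using ba by (subst index_mult_mat_sum[OF B' A']) (auto simp: B'_def)
  ultimately show False using ba by simp
qed

text \<open>\<open>n\<close> is an argument because matrices of all sizes share one type: the empty
  sum must still be the n by n zero matrix.\<close>

definition msum :: "nat \<Rightarrow> 'i set \<Rightarrow> ('i \<Rightarrow> 'a::comm_monoid_add mat) \<Rightarrow> 'a mat" where
  "msum n I A = mat n n (\<lambda>(i, j). \<Sum>x\<in>I. A x $$ (i, j))"

lemma msum_carrier [simp]: "msum n I A \<in> carrier_mat n n"
  by (simp add: msum_def)

lemma msum_dim [simp]: "dim_row (msum n I A) = n" "dim_col (msum n I A) = n"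
  by (simp_all add: msum_def)

lemma msum_index: "i < n \<Longrightarrow> j < n \<Longrightarrow> msum n I A $$ (i, j) = (\<Sum>x\<in>I. A x $$ (i, j))"
  by (simp add: msum_def)

lemma msum_cong: "(\<And>x. x \<in> I \<Longrightarrow> A x = B x) \<Longrightarrow> msum n I A = msum n I B"
  by (rule eq_matI) (auto simp: msum_index intro!: sum.cong)

lemma mult_msum:
  fixes B :: "'a::comm_semiring_1 mat"
  assumes "B \<in> carrier_mat n n" "\<And>x. x \<in> I \<Longrightarrow> A x \<in> carrier_mat n n"
  shows "B * msum n I A = msum n I (\<lambda>x. B * A x)"
proof (rule eq_matI)
  fix i j assume ij: "i < dim_row (msum n I (\<lambda>x. B * A x))" "j < dim_col (msum n I (\<lambda>x. B * A x))"
  have "(B * msum n I A) $$ (i, j) = (\<Sum>t<n. \<Sum>x\<in>I. B $$ (i, t) * A x $$ (t, j))"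
    using ij by (subst index_mult_mat_sum[OF assms(1) msum_carrier])
      (auto simp: msum_index sum_distrib_left)
  also have "\<dots> = (\<Sum>x\<in>I. \<Sum>t<n. B $$ (i, t) * A x $$ (t, j))" by (rule sum.swap)
  also have "\<dots> = (\<Sum>x\<in>I. (B * A x) $$ (i, j))"
    using ij assms(2) by (intro sum.cong refl index_mult_mat_sum[OF assms(1), symmetric]) auto
  finally show "(B * msum n I A) $$ (i, j) = msum n I (\<lambda>x. B * A x) $$ (i, j)"
    using ij by (simp add: msum_index)
qed (use assms in auto)

lemma msum_mult:
  fixes B :: "'a::comm_semiring_1 mat"
  assumes "B \<in> carrier_mat n n" "\<And>x. x \<in> I \<Longrightarrow> A x \<in> carrier_mat n n"
  shows "msum n I A * B = msum n I (\<lambda>x. A x * B)"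
proof (rule eq_matI)
  fix i j assume ij: "i < dim_row (msum n I (\<lambda>x. A x * B))" "j < dim_col (msum n I (\<lambda>x. A x * B))"
  have "(msum n I A * B) $$ (i, j) = (\<Sum>t<n. \<Sum>x\<in>I. A x $$ (i, t) * B $$ (t, j))"
    using ij by (subst index_mult_mat_sum[OF msum_carrier assms(1)])
      (auto simp: msum_index sum_distrib_right)
  also have "\<dots> = (\<Sum>x\<in>I. \<Sum>t<n. A x $$ (i, t) * B $$ (t, j))" by (rule sum.swap)
  also have "\<dots> = (\<Sum>x\<in>I. (A x * B) $$ (i, j))"
    using ij assms by (intro sum.cong refl index_mult_mat_sum[symmetric]) auto
  finally show "(msum n I A * B) $$ (i, j) = msum n I (\<lambda>x. A x * B) $$ (i, j)"
    using ij by (simp add: msum_index)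
qed (use assms in auto)

lemma smult_msum:
  fixes c :: "'a::comm_semiring_1"
  assumes "\<And>x. x \<in> I \<Longrightarrow> A x \<in> carrier_mat n n"
  shows "c \<cdot>\<^sub>m msum n I A = msum n I (\<lambda>x. c \<cdot>\<^sub>m A x)"
  using assms by (intro eq_matI) (fastforce simp: msum_index sum_distrib_left intro!: sum.cong)+

lemma msum_smult_const:
  fixes B :: "'a::comm_semiring_1 mat"
  assumes "B \<in> carrier_mat n n"
  shows "msum n I (\<lambda>x. c x \<cdot>\<^sub>m B) = sum c I \<cdot>\<^sub>m B"
  using assms by (intro eq_matI) (auto simp: msum_index sum_distrib_right)

lemma msum_swap: "msum n I (\<lambda>x. msum n J (A x)) = msum n J (\<lambda>y. msum n I (\<lambda>x. A x y))"
  by (rule eq_matI) (auto simp: msum_index intro: sum.swap)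

lemma msum_reindex: "bij_betw h I J \<Longrightarrow> msum n J A = msum n I (\<lambda>x. A (h x))"
  by (rule eq_matI) (auto simp: msum_index sum.reindex_bij_betw[symmetric])

lemma msum_single:
  assumes "finite I" "y \<in> I" "A y \<in> carrier_mat n n"
    "\<And>x. x \<in> I \<Longrightarrow> x \<noteq> y \<Longrightarrow> A x = 0\<^sub>m n n"
  shows "msum n I A = A y"
proof (rule eq_matI)
  fix i j assume ij: "i < dim_row (A y)" "j < dim_col (A y)"
  have "(\<Sum>x\<in>I. A x $$ (i, j)) = (\<Sum>x\<in>{y}. A x $$ (i, j))"
    using assms ij by (intro sum.mono_neutral_right) auto
  then show "msum n I A $$ (i, j) = A y $$ (i, j)"
    using ij assms by (simp add: msum_index)
qed (use assms in auto)

section \<open>Kronecker products, with the index pair (i, s) coded as i * c + s\<close>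

definition kron :: "'a::semiring_1 mat \<Rightarrow> 'a mat \<Rightarrow> 'a mat" where
  "kron A B = mat (dim_row A * dim_row B) (dim_col A * dim_col B)
     (\<lambda>(i, j). A $$ (i div dim_row B, j div dim_col B) * B $$ (i mod dim_row B, j mod dim_col B))"

lemma kron_carrier [simp]:
  "A \<in> carrier_mat a b \<Longrightarrow> B \<in> carrier_mat c d \<Longrightarrow> kron A B \<in> carrier_mat (a * c) (b * d)"
  by (auto simp: kron_def)

lemma kron_dim [simp]:
  "dim_row (kron A B) = dim_row A * dim_row B" "dim_col (kron A B) = dim_col A * dim_col B"
  by (simp_all add: kron_def)

lemma kron_index:
  assumes "A \<in> carrier_mat a b" "B \<in> carrier_mat c d" "i < a" "j < b" "s < c" "t < d"
  shows "kron A B $$ (i * c + s, j * d + t) = A $$ (i, j) * B $$ (s, t)"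
  using assms by (auto simp: kron_def pair_index_less)

lemma eq_mat_pairI:
  assumes "A \<in> carrier_mat (a * c) (b * d)" "B \<in> carrier_mat (a * c) (b * d)"
    "\<And>i j s t. i < a \<Longrightarrow> j < b \<Longrightarrow> s < c \<Longrightarrow> t < d \<Longrightarrow>
        A $$ (i * c + s, j * d + t) = B $$ (i * c + s, j * d + t)"
  shows "A = B"
proof (rule eq_matI)
  fix x y assume "x < dim_row B" "y < dim_col B"
  then have "x < a * c" "y < b * d" using assms(2) by auto
  then obtain i j s t where "i < a" "j < b" "s < c" "t < d" "x = i * c + s" "y = j * d + t"
    by (metis lessThan_mult_cases)
  then show "A $$ (x, y) = B $$ (x, y)" using assms(3) by simp
qed (use assms in auto)

lemma kron_mult:
  fixes A :: "'a::comm_semiring_1 mat"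
  assumes "A \<in> carrier_mat a b" "A' \<in> carrier_mat b e" "B \<in> carrier_mat c d" "B' \<in> carrier_mat d f"
  shows "kron A B * kron A' B' = kron (A * A') (B * B')"
proof (rule eq_mat_pairI[of _ a c e f])
  fix i j s t assume *: "i < a" "j < e" "s < c" "t < f"
  have "(kron A B * kron A' B') $$ (i * c + s, j * f + t) =
     (\<Sum>u<b. \<Sum>v<d. kron A B $$ (i * c + s, u * d + v) * kron A' B' $$ (u * d + v, j * f + t))"
    using * assms by (subst index_mult_mat_sum[where b = "b * d"])
      (auto simp: pair_index_less sum_lessThan_mult)
  also have "\<dots> = (\<Sum>u<b. \<Sum>v<d. (A $$ (i, u) * A' $$ (u, j)) * (B $$ (s, v) * B' $$ (v, t)))"
    using * by (intro sum.cong refl, subst kron_index[OF assms(1,3)])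
      (auto simp: kron_index[OF assms(2,4)] mult.assoc mult.left_commute)
  also have "\<dots> = (A * A') $$ (i, j) * (B * B') $$ (s, t)"
    using * by (simp add: index_mult_mat_sum[OF assms(1,2)] index_mult_mat_sum[OF assms(3,4)] sum_product)
  also have "\<dots> = kron (A * A') (B * B') $$ (i * c + s, j * f + t)"
    using * assms by (intro kron_index[symmetric]) auto
  finally show "(kron A B * kron A' B') $$ (i * c + s, j * f + t) = \<dots>" .
qed (use assms in auto)

lemma kron_smult_left:
  fixes A :: "'a::comm_semiring_1 mat"
  shows "kron (x \<cdot>\<^sub>m A) B = x \<cdot>\<^sub>m kron A B"
  by (rule eq_mat_pairI[of _ "dim_row A" "dim_row B" "dim_col A" "dim_col B"])
     (auto simp: kron_def pair_index_less mult_ac)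

lemma kron_smult_right:
  fixes A :: "'a::comm_semiring_1 mat"
  shows "kron A (x \<cdot>\<^sub>m B) = x \<cdot>\<^sub>m kron A B"
  by (rule eq_mat_pairI[of _ "dim_row A" "dim_row B" "dim_col A" "dim_col B"])
     (auto simp: kron_def pair_index_less mult_ac)

lemma kron_one: "kron (1\<^sub>m a) (1\<^sub>m b) = (1\<^sub>m (a * b) :: 'a::comm_semiring_1 mat)"
proof (rule eq_mat_pairI[of _ a b a b])
  fix i j s t assume *: "i < a" "j < a" "s < b" "t < b"
  then have "i * b + s = j * b + t \<longleftrightarrow> i = j \<and> s = t"
    by (metis div_mult_self3 div_less mod_less mod_mult_self3 add_0_right less_nat_zero_code)
  then show "kron (1\<^sub>m a) (1\<^sub>m b) $$ (i * b + s, j * b + t) = (1\<^sub>m (a * b) :: 'a mat) $$ (i * b + s, j * b + t)"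
    using * by (subst kron_index[of _ a a _ b b]) (auto simp: pair_index_less)
qed auto

lemma kron_transpose:
  "transpose_mat (kron A B) = kron (transpose_mat A) (transpose_mat B)"
  by (rule eq_mat_pairI[of _ "dim_col A" "dim_col B" "dim_row A" "dim_row B"])
     (auto simp: kron_def pair_index_less)

section \<open>Simultaneous diagonalisation\<close>

lemma commute_pow_mat:
  fixes A :: "'a::comm_ring_1 mat"
  assumes "A \<in> carrier_mat n n" "B \<in> carrier_mat n n" "A * B = B * A"
  shows "A * B ^\<^sub>m j = B ^\<^sub>m j * A"
proof (induction j)
  case 0
  then show ?case using assms by simp
next
  case (Suc j)
  have "A * (B ^\<^sub>m j * B) = B ^\<^sub>m j * A * B"
    using assms Suc by (metis assoc_mult_mat pow_carrier_mat)
  also have "\<dots> = B ^\<^sub>m j * B * A"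
    using assms by (metis assoc_mult_mat pow_carrier_mat)
  finally show ?case by simp
qed

lemma pow_mat_smult:
  fixes A :: "'a::comm_ring_1 mat"
  assumes "A \<in> carrier_mat n n"
  shows "(c \<cdot>\<^sub>m A) ^\<^sub>m j = c ^ j \<cdot>\<^sub>m A ^\<^sub>m j"
proof (induction j)
  case 0
  then show ?case using assms by (intro eq_matI) auto
next
  case (Suc j)
  have "c ^ j \<cdot>\<^sub>m A ^\<^sub>m j * (c \<cdot>\<^sub>m A) = c \<cdot>\<^sub>m (c ^ j \<cdot>\<^sub>m (A ^\<^sub>m j * A))"
    using assms by (simp add: mult_smult_distrib[of _ n n _ n] mult_smult_assoc_mat[of _ n n _ n])
  also have "\<dots> = (c * c ^ j) \<cdot>\<^sub>m (A ^\<^sub>m j * A)"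
    by (intro eq_matI) (auto simp: mult.assoc)
  finally show ?case using Suc by (simp add: mult.commute)
qed

lemma smult_smult_mat: "a \<cdot>\<^sub>m (b \<cdot>\<^sub>m A) = (a * b :: 'a::semigroup_mult) \<cdot>\<^sub>m A"
  by (intro eq_matI) (auto simp: mult.assoc)

lemma one_smult_mat [simp]: "(1::'a::monoid_mult) \<cdot>\<^sub>m A = A"
  by (intro eq_matI) auto

lemma zero_smult_mat: "A \<in> carrier_mat n n \<Longrightarrow> (0::'a::mult_zero) \<cdot>\<^sub>m A = 0\<^sub>m n n"
  by (intro eq_matI) auto

lemma minus_zero_mat: "A \<in> carrier_mat a b \<Longrightarrow> A - 0\<^sub>m a b = (A :: 'a::group_add mat)"
  by (intro eq_matI) auto

lemma smult_mat_cancel: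
  fixes A :: "'a::field mat"
  assumes "c \<cdot>\<^sub>m A = c \<cdot>\<^sub>m B" "c \<noteq> 0"
  shows "A = B"
proof -
  have "inverse c \<cdot>\<^sub>m (c \<cdot>\<^sub>m A) = inverse c \<cdot>\<^sub>m (c \<cdot>\<^sub>m B)" using assms by simp
  then show ?thesis using assms(2) by (simp add: smult_smult_mat)
qed

lemma msum_commute:
  fixes B :: "'a::comm_ring_1 mat"
  assumes "B \<in> carrier_mat n n" "\<And>x. x \<in> I \<Longrightarrow> A x \<in> carrier_mat n n"
    "\<And>x. x \<in> I \<Longrightarrow> B * A x = A x * B"
  shows "B * msum n I A = msum n I A * B"
proof -
  have "B * msum n I A = msum n I (\<lambda>x. B * A x)" by (rule mult_msum) (use assms in auto)
  also have "\<dots> = msum n I (\<lambda>x. A x * B)" by (rule msum_cong) (use assms in auto)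
  also have "\<dots> = msum n I A * B" by (rule msum_mult[symmetric]) (use assms in auto)
  finally show ?thesis .
qed

text \<open>Discrete Fourier inversion: when the p-th power of N is 1, this is the projection onto
  the eigenspace of N for the i-th power of \<omega>.\<close>

definition spec_proj :: "nat \<Rightarrow> nat \<Rightarrow> 'a::field \<Rightarrow> 'a mat \<Rightarrow> nat \<Rightarrow> 'a mat" where
  "spec_proj n p \<omega> N i = msum n {..<p} (\<lambda>j. (inverse (of_nat p) * inverse \<omega> ^ (i * j)) \<cdot>\<^sub>m N ^\<^sub>m j)"

locale finite_order_mat =
  fixes n p :: nat and \<omega> :: "'a::field" and N :: "'a mat"
  assumes N: "N \<in> carrier_mat n n" and Np: "N ^\<^sub>m p = 1\<^sub>m n"
    and p0: "of_nat p \<noteq> (0::'a)" and wp: "\<omega> ^ p = 1" and w1: "\<And>j. 0 < j \<Longrightarrow> j < p \<Longrightarrow> \<omega> ^ j \<noteq> 1"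
begin

abbreviation "P \<equiv> spec_proj n p \<omega> N"

lemma p_pos: "p > 0" using p0 by (cases p) auto

lemma w0: "\<omega> \<noteq> 0" using wp p_pos by (auto simp: power_0_left)

lemma P_carrier [simp]: "P i \<in> carrier_mat n n" by (simp add: spec_proj_def)

lemma mult_P: "N * P i = \<omega> ^ i \<cdot>\<^sub>m P i"
proof -
  define h where "h j = (inverse (of_nat p) * inverse \<omega> ^ (i * j)) \<cdot>\<^sub>m N ^\<^sub>m j" for j
  have hc [simp]: "h j \<in> carrier_mat n n" for j using N by (simp add: h_def)
  have "N * h j = \<omega> ^ i \<cdot>\<^sub>m h (Suc j)" for j
  proof -
    have "N * h j = (inverse (of_nat p) * inverse \<omega> ^ (i * j)) \<cdot>\<^sub>m (N * N ^\<^sub>m j)"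
      unfolding h_def using N by (simp add: mult_smult_distrib[of _ n n _ n])
    also have "N * N ^\<^sub>m j = N ^\<^sub>m Suc j" using commute_pow_mat[OF N N] by simp
    also have "inverse (of_nat p) * inverse \<omega> ^ (i * j) =
      \<omega> ^ i * (inverse (of_nat p) * inverse \<omega> ^ (i * Suc j))"
      using w0 by (simp add: power_add power_inverse field_simps)
    finally show ?thesis unfolding h_def by (simp add: smult_smult_mat)
  qed
  then have "N * msum n {..<p} h = msum n {..<p} (\<lambda>j. \<omega> ^ i \<cdot>\<^sub>m h (Suc j))"
    using N by (subst mult_msum) auto
  also have "\<dots> = \<omega> ^ i \<cdot>\<^sub>m msum n {..<p} (\<lambda>j. h (Suc j))"
    by (subst smult_msum) auto
  \<comment> \<open>The shift of the summation index is cyclic because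
    \<open>h p = h 0\<close>.\<close>
  also have "msum n {..<p} (\<lambda>j. h (Suc j)) = msum n {..<p} h"
  proof (rule eq_matI)
    fix r s assume rs: "r < dim_row (msum n {..<p} h)" "s < dim_col (msum n {..<p} h)"
    have hp: "h p = h 0"
      using N Np wp by (simp add: h_def mult.commute[of i] power_mult power_inverse)
    have "(\<Sum>j<p. h j $$ (r, s)) + h p $$ (r, s) = h 0 $$ (r, s) + (\<Sum>j<p. h (Suc j) $$ (r, s))"
      using sum.lessThan_Suc_shift[of "\<lambda>j. h j $$ (r, s)" p] by simp
    then show "msum n {..<p} (\<lambda>j. h (Suc j)) $$ (r, s) = msum n {..<p} h $$ (r, s)"
      using rs by (simp add: msum_index hp)
  qed auto
  finally show ?thesis unfolding spec_proj_def h_def .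
qed

lemma pow_mult_P: "N ^\<^sub>m j * P i = \<omega> ^ (i * j) \<cdot>\<^sub>m P i"
proof (induction j)
  case (Suc j)
  have "N ^\<^sub>m Suc j * P i = N ^\<^sub>m j * (N * P i)"
    using N by (simp add: assoc_mult_mat[of _ n n _ n _ n])
  also have "\<dots> = \<omega> ^ i \<cdot>\<^sub>m (N ^\<^sub>m j * P i)"
    using N by (simp add: mult_P mult_smult_distrib[of _ n n _ n])
  finally show ?case by (simp add: Suc smult_smult_mat power_add)
qed (use N in \<open>simp add: left_mult_one_mat[of _ n n]\<close>)

lemma P_idem: "P i * P i = P i"
proof -
  have "P i * P i = msum n {..<p} (\<lambda>j. (inverse (of_nat p) * inverse \<omega> ^ (i * j)) \<cdot>\<^sub>m N ^\<^sub>m j * P i)"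
    unfolding spec_proj_def[of _ _ _ _ i] using N by (subst msum_mult) auto
  also have "\<dots> = msum n {..<p} (\<lambda>j. inverse (of_nat p) \<cdot>\<^sub>m P i)"
    using w0 N by (intro msum_cong)
      (simp add: pow_mult_P smult_smult_mat mult_smult_assoc_mat[of _ n n _ n] power_inverse mult.assoc)
  also have "\<dots> = (\<Sum>j<p. inverse (of_nat p)) \<cdot>\<^sub>m P i" by (rule msum_smult_const) simp
  also have "(\<Sum>j<p. inverse (of_nat p)) = (1::'a)" using p0 by simp
  finally show ?thesis by simp
qed

lemma sum_P: "msum n {..<p} P = 1\<^sub>m n"
proof -
  have "msum n {..<p} P = msum n {..<p} (\<lambda>j. msum n {..<p} (\<lambda>i. (inverse (of_nat p) * inverse \<omega> ^ (i * j)) \<cdot>\<^sub>m N ^\<^sub>m j))"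
    unfolding spec_proj_def by (rule msum_swap)
  also have "\<dots> = msum n {..<p} (\<lambda>j. (\<Sum>i<p. inverse (of_nat p) * inverse \<omega> ^ (i * j)) \<cdot>\<^sub>m N ^\<^sub>m j)"
    using N by (intro msum_cong msum_smult_const) auto
  also have "\<dots> = (\<lambda>j. (\<Sum>i<p. inverse (of_nat p) * inverse \<omega> ^ (i * j)) \<cdot>\<^sub>m N ^\<^sub>m j) 0"
  proof (rule msum_single)
    fix j assume j: "j \<in> {..<p}" "j \<noteq> 0"
    define z where "z = inverse \<omega> ^ j"
    have "z \<noteq> 1" using w1[of j] j w0 by (simp add: z_def power_inverse)
    \<comment> \<open>The term with factor 0 vanishes, so together with \<open>wp\<close> this says
      z ^ p = 1; as z is not 1, its geometric sum is zero.\<close>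
    have "z ^ p = (\<omega> ^ p) ^ j * 0 + inverse ((\<omega> ^ p) ^ j)"
      by (simp add: z_def power_inverse flip: power_mult) (simp add: mult.commute)
    then have "(1 - z) * (\<Sum>i<p. z ^ i) = 0"
      using wp by (simp add: one_diff_power_eq[symmetric])
    then have "(\<Sum>i<p. z ^ i) = 0" using \<open>z \<noteq> 1\<close> by simp
    moreover have "inverse \<omega> ^ (i * j) = z ^ i" for i
      by (simp add: z_def mult.commute flip: power_mult)
    ultimately have "(\<Sum>i<p. inverse (of_nat p) * inverse \<omega> ^ (i * j)) = 0"
      by (simp add: sum_distrib_left[symmetric])
    then show "(\<Sum>i<p. inverse (of_nat p) * inverse \<omega> ^ (i * j)) \<cdot>\<^sub>m N ^\<^sub>m j = 0\<^sub>m n n"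
      using N by (simp add: zero_smult_mat)
  qed (use N p_pos in auto)
  also have "\<dots> = 1\<^sub>m n" using N p0 by simp
  finally show ?thesis .
qed

end

text \<open>Each matrix of \<open>S\<close> in turn, rescaled so that its p-th power is 1, cuts the
  current idempotent by one of its spectral projections; these sum to 1, so some product is nonzero.
  Commutation is carried along for all of \<open>T\<close>, not just the part already treated, to
  keep the next product idempotent.\<close>

lemma eigen_idempotent:
  fixes M :: "'i \<Rightarrow> 'a::field mat"
  assumes "finite S" and ST: "S \<subseteq> T"
    and M: "\<And>x. x \<in> T \<Longrightarrow> M x \<in> carrier_mat n n"
    and MM: "\<And>x y. x \<in> T \<Longrightarrow> y \<in> T \<Longrightarrow> M x * M y = M y * M x"
    and Mp: "\<And>x. x \<in> T \<Longrightarrow> \<exists>\<mu>. \<mu> \<noteq> 0 \<and> M x ^\<^sub>m p = \<mu> ^ p \<cdot>\<^sub>m 1\<^sub>m n"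
    and p: "of_nat p \<noteq> (0::'a)" "\<omega> ^ p = 1" "\<And>j. 0 < j \<Longrightarrow> j < p \<Longrightarrow> \<omega> ^ j \<noteq> (1::'a)"
    and Q: "Q \<in> carrier_mat n n" "Q * Q = Q" "Q \<noteq> 0\<^sub>m n n" "\<And>x. x \<in> T \<Longrightarrow> M x * Q = Q * M x"
  shows "\<exists>e \<in> carrier_mat n n. e \<noteq> 0\<^sub>m n n \<and> e * e = e \<and> Q * e = e \<and> e * Q = e \<and>
    (\<forall>x\<in>T. M x * e = e * M x) \<and> (\<exists>d. \<forall>x\<in>S. M x * e = d x \<cdot>\<^sub>m e)"
  using assms(1) ST
proof (induction S rule: finite_induct)
  case empty
  then show ?case using Q by blast
next
  case (insert x S)
  then obtain e d where e: "e \<in> carrier_mat n n" "e \<noteq> 0\<^sub>m n n" "e * e = e" "Q * e = e" "e * Q = e"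
     "\<And>x. x \<in> T \<Longrightarrow> M x * e = e * M x" "\<And>x. x \<in> S \<Longrightarrow> M x * e = d x \<cdot>\<^sub>m e" by auto
  have xT: "x \<in> T" using insert by auto
  note assoc = assoc_mult_mat[of _ n n _ n _ n]
  obtain \<mu> where mu: "\<mu> \<noteq> 0" "M x ^\<^sub>m p = \<mu> ^ p \<cdot>\<^sub>m 1\<^sub>m n" using Mp[OF xT] by auto
  define N where "N = inverse \<mu> \<cdot>\<^sub>m M x"
  have Nc: "N \<in> carrier_mat n n" using M[OF xT] by (simp add: N_def)
  have "N ^\<^sub>m p = 1\<^sub>m n"
    unfolding N_def using mu M[OF xT] by (simp add: pow_mat_smult smult_smult_mat power_inverse)
  then interpret finite_order_mat n p \<omega> N using Nc p by unfold_locales auto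
  \<comment> \<open>\<open>P i\<close> is a polynomial in \<open>M x\<close>, so it commutes with
    whatever commutes with \<open>M x\<close>.\<close>
  have Pcomm: "A * P i = P i * A" if "A \<in> carrier_mat n n" "A * M x = M x * A" for A i
  proof -
    have "A * N = N * A"
      using that M[OF xT] unfolding N_def
      by (simp add: mult_smult_distrib[of _ n n _ n] mult_smult_assoc_mat[of _ n n _ n])
    then show ?thesis unfolding spec_proj_def
      using that Nc commute_pow_mat[of A n N]
      by (intro msum_commute) (auto simp: mult_smult_distrib[of _ n n _ n] mult_smult_assoc_mat[of _ n n _ n])
  qed
  have eP: "e * P i = P i * e" for i using Pcomm[of e i] e(1,6) xT by auto
  have QP: "Q * P i = P i * Q" for i using Pcomm[of Q i] Q(1,4) xT by auto
  have MP: "M y * P i = P i * M y" if "y \<in> T" for y i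
    using Pcomm[of "M y" i] M MM xT that by auto
  have "\<exists>i<p. e * P i \<noteq> 0\<^sub>m n n"
  proof (rule ccontr)
    assume "\<not> ?thesis"
    then have "msum n {..<p} (\<lambda>i. e * P i) = 0\<^sub>m n n"
      by (intro eq_matI) (auto simp: msum_index intro!: sum.neutral)
    moreover have "msum n {..<p} (\<lambda>i. e * P i) = e * msum n {..<p} P"
      using e(1) by (subst mult_msum) auto
    ultimately show False using e(1,2) sum_P by simp
  qed
  then obtain i where i: "e * P i \<noteq> 0\<^sub>m n n" by auto
  let ?e = "e * P i"
  have "?e * ?e = e * (P i * e) * P i" using e(1) by (simp add: assoc mult_carrier_mat[of _ n n _ n])
  also have "\<dots> = e * (e * P i) * P i" by (simp add: eP)
  also have "\<dots> = (e * e) * (P i * P i)" using e(1) by (simp add: assoc mult_carrier_mat[of _ n n _ n])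
  finally have idem: "?e * ?e = ?e" by (simp add: e(3) P_idem)
  have "Q * ?e = (Q * e) * P i" using e(1) Q(1) by (simp add: assoc)
  then have Qe: "Q * ?e = ?e" by (simp add: e(4))
  have "?e * Q = e * (P i * Q)" using e(1) Q(1) by (simp add: assoc)
  also have "\<dots> = (e * Q) * P i" using e(1) Q(1) by (simp add: assoc QP[symmetric])
  finally have eQ: "?e * Q = ?e" by (simp add: e(5))
  have comm: "M y * ?e = ?e * M y" if "y \<in> T" for y
  proof -
    have "M y * ?e = (M y * e) * P i" using e(1) M[OF that] by (simp add: assoc)
    also have "\<dots> = e * (M y * P i)" using e(1) M[OF that] that by (simp add: assoc e(6))
    also have "\<dots> = ?e * M y" using e(1) M[OF that] that by (simp add: assoc MP)
    finally show ?thesis .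
  qed
  have "M y * ?e = (if y = x then \<mu> * \<omega> ^ i else d y) \<cdot>\<^sub>m ?e" if "y \<in> insert x S" for y
  proof (cases "y = x")
    case True
    have "M x = \<mu> \<cdot>\<^sub>m N" using mu by (simp add: N_def smult_smult_mat)
    then have "M x * P i = (\<mu> * \<omega> ^ i) \<cdot>\<^sub>m P i"
      using Nc mult_P[of i] by (simp add: mult_smult_assoc_mat[of _ n n _ n] smult_smult_mat)
    moreover have "M x * ?e = e * (M x * P i)"
      using comm[OF xT] e(1) M[OF xT] by (simp add: assoc MP[OF xT])
    ultimately show ?thesis using True e(1) by (simp add: mult_smult_distrib[of _ n n _ n])
  next
    case False
    then have y: "y \<in> S" "y \<in> T" using that insert by auto
    have "M y * ?e = (M y * e) * P i" using e(1) M[OF y(2)] by (simp add: assoc)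
    then show ?thesis using False e(1) by (simp add: e(7)[OF y(1)] mult_smult_assoc_mat[of _ n n _ n])
  qed
  then show ?case
    using i idem Qe eQ comm e(1)
    by (intro bexI[of _ ?e] conjI exI[of _ "\<lambda>y. if y = x then \<mu> * \<omega> ^ i else d y"] ballI)
       (blast intro: mult_carrier_mat P_carrier)+
qed

text \<open>A partial factorisation with as many columns as possible is taken. The remainder
  \<open>Q - U * W\<close> is an idempotent commuting with the family, and if it were nonzero
  \<open>eigen_idempotent\<close> would supply one more column. With \<open>Q = 1\<close> this is
  simultaneous diagonalisation, with an empty family it is plain rank factorisation.\<close>

lemma simultaneous_factorization:
  fixes M :: "'i \<Rightarrow> 'a::field mat"
  assumes "finite S"
    and M: "\<And>x. x \<in> S \<Longrightarrow> M x \<in> carrier_mat n n"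
    and MM: "\<And>x y. x \<in> S \<Longrightarrow> y \<in> S \<Longrightarrow> M x * M y = M y * M x"
    and Mp: "\<And>x. x \<in> S \<Longrightarrow> \<exists>\<mu>. \<mu> \<noteq> 0 \<and> M x ^\<^sub>m p = \<mu> ^ p \<cdot>\<^sub>m 1\<^sub>m n"
    and p: "of_nat p \<noteq> (0::'a)" "\<omega> ^ p = 1" "\<And>j. 0 < j \<Longrightarrow> j < p \<Longrightarrow> \<omega> ^ j \<noteq> (1::'a)"
    and Q: "Q \<in> carrier_mat n n" "Q * Q = Q" "\<And>x. x \<in> S \<Longrightarrow> M x * Q = Q * M x"
  shows "\<exists>a U W d. U \<in> carrier_mat n a \<and> W \<in> carrier_mat a n \<and> W * U = 1\<^sub>m a \<and> U * W = Q \<and>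
     (\<forall>x\<in>S. \<forall>i<n. \<forall>j<a. (M x * U) $$ (i, j) = d x j * U $$ (i, j))"
proof -
  \<comment> \<open>Rows of \<open>W\<close> are also required to be left eigenvectors, with the
    same eigenvalues, so that \<open>U * W\<close> commutes with the family.\<close>
  define good where "good a U W d \<longleftrightarrow> U \<in> carrier_mat n a \<and> W \<in> carrier_mat a n \<and> W * U = 1\<^sub>m a \<and>
     Q * U = U \<and> W * Q = W \<and>
     (\<forall>x\<in>S. \<forall>i<n. \<forall>j<a. (M x * U) $$ (i, j) = d x j * U $$ (i, j)) \<and>
     (\<forall>x\<in>S. \<forall>i<n. \<forall>j<a. (W * M x) $$ (j, i) = d x j * W $$ (j, i))" for a U W d
  define G where "G a \<longleftrightarrow> (\<exists>U W d. good a U W d)" for a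
  have "good 0 (0\<^sub>m n 0) (0\<^sub>m 0 n) (\<lambda>_ _. 0)"
    using Q by (auto simp: good_def intro!: eq_matI)
  then have G0: "G 0" unfolding G_def by blast
  have Gle: "a \<le> n" if "G a" for a
    using that left_inverse_dim_le unfolding G_def good_def by blast
  define a where "a = Greatest G"
  have Ga: "G a" unfolding a_def using G0 Gle by (rule GreatestI_nat)
  have amax: "\<not> G (Suc a)"
    using Greatest_le_nat[of G "Suc a" n] Gle unfolding a_def by auto
  obtain U W d where g: "good a U W d" using Ga unfolding G_def by blast
  have U: "U \<in> carrier_mat n a" and W: "W \<in> carrier_mat a n" and WU: "W * U = 1\<^sub>m a"
    and QU: "Q * U = U" and WQ: "W * Q = W"
    and dU: "\<And>x i j. x \<in> S \<Longrightarrow> i < n \<Longrightarrow> j < a \<Longrightarrow> (M x * U) $$ (i, j) = d x j * U $$ (i, j)"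
    and dW: "\<And>x i j. x \<in> S \<Longrightarrow> i < n \<Longrightarrow> j < a \<Longrightarrow> (W * M x) $$ (j, i) = d x j * W $$ (j, i)"
    using g by (auto simp: good_def)
  have UW: "U * W \<in> carrier_mat n n" using U W by auto
  define R where "R = Q - U * W"
  have R: "R \<in> carrier_mat n n" using Q(1) UW by (simp add: R_def minus_carrier_mat)
  have WR: "W * R = 0\<^sub>m a n"
  proof -
    have "W * R = W * Q - W * (U * W)"
      unfolding R_def using W Q(1) UW by (rule mult_minus_distrib_mat)
    also have "W * (U * W) = W" using assoc_mult_mat[OF W U W] WU W by simp
    finally show ?thesis using W WQ by simp
  qed
  have RU: "R * U = 0\<^sub>m n a"
  proof -
    have "R * U = Q * U - U * W * U"
      unfolding R_def using Q(1) UW U by (rule minus_mult_distrib_mat)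
    also have "U * W * U = U" using assoc_mult_mat[OF U W U] WU U by simp
    finally show ?thesis using U QU by simp
  qed
  have RR: "R * R = R"
  proof -
    have "R * R = R * Q - R * (U * W)"
      unfolding R_def[symmetric] by (subst (2) R_def) (rule mult_minus_distrib_mat[OF R Q(1) UW])
    also have "R * (U * W) = 0\<^sub>m n n" using assoc_mult_mat[OF R U W] RU W by simp
    also have "R * Q = Q * Q - U * W * Q"
      unfolding R_def by (rule minus_mult_distrib_mat[OF Q(1) UW Q(1)])
    also have "U * W * Q = U * W" using assoc_mult_mat[OF U W Q(1)] WQ by simp
    also have "Q * Q - U * W = R" by (simp add: Q(2) R_def)
    also have "R - 0\<^sub>m n n = R" using R by (rule minus_zero_mat)
    finally show ?thesis .
  qed
  have MR: "M x * R = R * M x" if x: "x \<in> S" for x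
  proof -
    have "(M x * (U * W)) = (U * W) * M x"
    proof (rule eq_matI)
      fix i j assume "i < dim_row (U * W * M x)" "j < dim_col (U * W * M x)"
      then have ij: "i < n" "j < n" using U M[OF x] by auto
      have "(M x * (U * W)) $$ (i, j) = ((M x * U) * W) $$ (i, j)"
        using assoc_mult_mat[OF M[OF x] U W] by simp
      also have "\<dots> = (\<Sum>t<a. (M x * U) $$ (i, t) * W $$ (t, j))"
        using ij M[OF x] U by (intro index_mult_mat_sum[OF _ W]) auto
      also have "\<dots> = (\<Sum>t<a. U $$ (i, t) * (W * M x) $$ (t, j))"
        using ij by (intro sum.cong refl) (simp add: dU[OF x] dW[OF x])
      also have "\<dots> = (U * (W * M x)) $$ (i, j)"
        using ij M[OF x] W by (intro index_mult_mat_sum[OF U, symmetric]) auto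
      also have "\<dots> = (U * W * M x) $$ (i, j)"
        using assoc_mult_mat[OF U W M[OF x]] by simp
      finally show "(M x * (U * W)) $$ (i, j) = (U * W * M x) $$ (i, j)" .
    qed (use U W M[OF x] in auto)
    then show ?thesis unfolding R_def
      using mult_minus_distrib_mat[OF M[OF x] Q(1) UW] minus_mult_distrib_mat[OF Q(1) UW M[OF x]] Q(3)[OF x]
      by simp
  qed
  have "R = 0\<^sub>m n n"
  proof (rule ccontr)
    assume "R \<noteq> 0\<^sub>m n n"
    from eigen_idempotent[where M = M, OF \<open>finite S\<close> subset_refl M MM Mp p R RR this MR]
    obtain e l where e: "e \<in> carrier_mat n n" "e \<noteq> 0\<^sub>m n n" "e * e = e" "R * e = e" "e * R = e"
      "\<And>x. x \<in> S \<Longrightarrow> M x * e = e * M x" "\<And>x. x \<in> S \<Longrightarrow> M x * e = l x \<cdot>\<^sub>m e" by blast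
    \<comment> \<open>A nonzero entry of \<open>e\<close> serves as pivot: column c is the new
      eigenvector and row r divided by the pivot is its dual, since \<open>e * e = e\<close> makes
      their product 1.\<close>
    obtain r c where rc: "r < n" "c < n" "e $$ (r, c) \<noteq> 0"
      using e(1,2) by (metis carrier_matD eq_matI index_zero_mat)
    define U' where "U' = mat n (Suc a) (\<lambda>(i, j). if j < a then U $$ (i, j) else e $$ (i, c))"
    define W' where "W' = mat (Suc a) n (\<lambda>(i, j). if i < a then W $$ (i, j) else e $$ (r, j) / e $$ (r, c))"
    define d' where "d' x j = (if j < a then d x j else l x)" for x j
    have U': "U' \<in> carrier_mat n (Suc a)" and W': "W' \<in> carrier_mat (Suc a) n"
      by (auto simp: U'_def W'_def)
    have AU: "(A * U') $$ (i, j) = (if j < a then (A * U) $$ (i, j) else (A * e) $$ (i, c))"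
      if "A \<in> carrier_mat s n" "i < s" "j < Suc a" for A s i j
      using that rc by (subst index_mult_mat_sum[OF that(1) U']) (auto simp: index_mult_mat_sum[OF that(1) U]
          index_mult_mat_sum[OF that(1) e(1)] U'_def simp del: index_mult_mat(1) intro!: sum.cong)
    have WA: "(W' * A) $$ (i, j) = (if i < a then (W * A) $$ (i, j) else (e * A) $$ (r, j) / e $$ (r, c))"
      if "A \<in> carrier_mat n s" "i < Suc a" "j < s" for A s i j
      using that rc by (subst index_mult_mat_sum[OF W' that(1)]) (auto simp: index_mult_mat_sum[OF W that(1)]
          index_mult_mat_sum[OF e(1) that(1)] W'_def sum_divide_distrib simp del: index_mult_mat(1) intro!: sum.cong)
    have We: "W * e = 0\<^sub>m a n"
      using assoc_mult_mat[OF W R e(1)] WR e(1,4) by simp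
    have eU: "e * U = 0\<^sub>m n a"
      using assoc_mult_mat[OF e(1) R U] RU e(1,5) by simp
    have Qe: "Q * e = e"
    proof -
      have "R * e = Q * e - U * W * e" unfolding R_def by (rule minus_mult_distrib_mat[OF Q(1) UW e(1)])
      also have "U * W * e = 0\<^sub>m n n" using assoc_mult_mat[OF U W e(1)] We U by simp
      finally show ?thesis using e(1,4) Q(1) minus_zero_mat[of "Q * e" n n] by simp
    qed
    have eQ: "e * Q = e"
    proof -
      have "e * R = e * Q - e * (U * W)" unfolding R_def by (rule mult_minus_distrib_mat[OF e(1) Q(1) UW])
      also have "e * (U * W) = 0\<^sub>m n n" using assoc_mult_mat[OF e(1) U W] eU W by simp
      finally show ?thesis using e(1,5) Q(1) minus_zero_mat[of "e * Q" n n] by simp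
    qed
    have "good (Suc a) U' W' d'" unfolding good_def
    proof (intro conjI ballI allI impI)
      show "W' * U' = 1\<^sub>m (Suc a)"
      proof (rule eq_matI)
        fix i j assume "i < dim_row (1\<^sub>m (Suc a))" "j < dim_col (1\<^sub>m (Suc a))"
        then have ij: "i < Suc a" "j < Suc a" by auto
        show "(W' * U') $$ (i, j) = 1\<^sub>m (Suc a) $$ (i, j)"
        proof (cases "j < a")
          case True
          then have "(W' * U') $$ (i, j) = (W' * U) $$ (i, j)" using AU[OF W' ij] by simp
          also have "\<dots> = 1\<^sub>m (Suc a) $$ (i, j)"
            using WA[OF U ij(1) True] True ij rc by (simp add: WU eU)
          finally show ?thesis .
        next
          case False
          then have "(W' * U') $$ (i, j) = (W' * e) $$ (i, c)" using AU[OF W' ij] by simp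
          also have "\<dots> = 1\<^sub>m (Suc a) $$ (i, j)"
            using WA[OF e(1) ij(1) rc(2)] False ij rc by (simp add: We e(3))
          finally show ?thesis .
        qed
      qed (use U' W' in auto)
      show "Q * U' = U'"
        using Q(1) U' AU[OF Q(1)] by (intro eq_matI) (auto simp: QU Qe U'_def)
      show "W' * Q = W'"
        using Q(1) W' WA[OF Q(1)] by (intro eq_matI) (auto simp: WQ eQ W'_def)
      fix x i j assume x: "x \<in> S" and ij: "i < n" "j < Suc a"
      show "(M x * U') $$ (i, j) = d' x j * U' $$ (i, j)"
        using AU[OF M[OF x] ij] dU[OF x] ij rc e(1) by (auto simp: d'_def U'_def e(7)[OF x])
      have "e * M x = l x \<cdot>\<^sub>m e" using e(6,7) x by simp
      then show "(W' * M x) $$ (j, i) = d' x j * W' $$ (j, i)"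
        using WA[OF M[OF x] ij(2,1)] dW[OF x] ij rc e(1) by (auto simp: d'_def W'_def)
    qed (use U' W' in auto)
    then show False using amax unfolding G_def by blast
  qed
  then have "U * W = Q"
  proof -
    have "Q = Q - U * W + U * W" using Q(1) UW by (intro eq_matI) auto
    then show ?thesis using \<open>R = 0\<^sub>m n n\<close> UW by (simp add: R_def)
  qed
  then show ?thesis using U W WU dU by blast
qed

section \<open>The groups PGL and PGU\<close>

lemma GL_simps [simp]:
  "carrier (GL n) = {A \<in> carrier_mat n n. det A \<noteq> 0}"
  "A \<otimes>\<^bsub>GL n\<^esub> B = A * B" "\<one>\<^bsub>GL n\<^esub> = 1\<^sub>m n"
  by (simp_all add: GL_def)

lemma GL_I:
  fixes A :: "'a::field mat"
  assumes "A \<in> carrier_mat n n" "B \<in> carrier_mat n n" "A * B = 1\<^sub>m n"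
  shows "A \<in> carrier (GL n)" "B \<in> carrier (GL n)"
  using det_mult[OF assms(1,2)] assms by auto

lemma GL_obtain_inverse:
  fixes A :: "'a::field mat"
  assumes "A \<in> carrier (GL n)"
  obtains B where "B \<in> carrier (GL n)" "A * B = 1\<^sub>m n" "B * A = 1\<^sub>m n"
proof -
  have A: "A \<in> carrier_mat n n" "det A \<noteq> 0" using assms by auto
  then have "A \<in> Units (ring_mat TYPE('a) n ())" by (rule det_non_zero_imp_unit)
  then obtain B where B: "B \<in> carrier_mat n n" "B * A = 1\<^sub>m n"
    by (auto simp: Units_def ring_mat_def)
  then have "A * B = 1\<^sub>m n" using mat_mult_left_right_inverse[OF B(1) A(1)] by simp
  then show ?thesis using that[of B] GL_I[OF A(1) B(1)] B by auto
qed

lemma group_GL: "group (GL n :: 'a::field mat monoid)"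
proof (rule groupI)
  fix A assume "A \<in> carrier (GL n :: 'a mat monoid)"
  then show "\<exists>B\<in>carrier (GL n). B \<otimes>\<^bsub>GL n\<^esub> A = \<one>\<^bsub>GL n\<^esub>"
    by (metis GL_obtain_inverse GL_simps(2,3))
qed (auto simp: det_mult[of _ n])

lemma GL_inv_eq:
  fixes A :: "'a::field mat"
  assumes "A \<in> carrier_mat n n" "B \<in> carrier_mat n n" "A * B = 1\<^sub>m n"
  shows "inv\<^bsub>GL n\<^esub> A = B" "inv\<^bsub>GL n\<^esub> B = A"
  by (rule group.inv_equality[OF group_GL],
      use GL_I[OF assms] mat_mult_left_right_inverse[OF assms] assms in auto)+

lemma scalar_mult_mat:
  fixes A :: "'a::field mat"
  shows "A \<in> carrier_mat n n \<Longrightarrow> (c \<cdot>\<^sub>m 1\<^sub>m n) * A = c \<cdot>\<^sub>m A"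
    "A \<in> carrier_mat n n \<Longrightarrow> A * (c \<cdot>\<^sub>m 1\<^sub>m n) = c \<cdot>\<^sub>m A"
  by (simp_all add: mult_smult_assoc_mat[of _ n n _ n] mult_smult_distrib[of _ n n _ n])

abbreviation cl :: "nat \<Rightarrow> 'a::field mat \<Rightarrow> 'a mat set" where
  "cl n A \<equiv> scalars n #>\<^bsub>GL n\<^esub> A"

lemma cl_eq: "A \<in> carrier_mat n n \<Longrightarrow> cl n A = {c \<cdot>\<^sub>m A | c. c \<noteq> 0}"
  by (auto simp: r_coset_def scalars_def scalar_mult_mat)

lemma cl_eq_iff:
  assumes "A \<in> carrier_mat n n" "B \<in> carrier_mat n n"
  shows "cl n A = cl n B \<longleftrightarrow> (\<exists>c. c \<noteq> 0 \<and> A = c \<cdot>\<^sub>m B)"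
proof
  assume "cl n A = cl n B"
  moreover have "A \<in> cl n A" using assms(1) by (auto simp: cl_eq intro!: exI[of _ 1])
  ultimately show "\<exists>c. c \<noteq> 0 \<and> A = c \<cdot>\<^sub>m B" using assms(2) by (auto simp: cl_eq)
next
  assume "\<exists>c. c \<noteq> 0 \<and> A = c \<cdot>\<^sub>m B"
  then obtain c where c: "c \<noteq> 0" "A = c \<cdot>\<^sub>m B" by auto
  show "cl n A = cl n B"
    unfolding cl_eq[OF assms(1)] cl_eq[OF assms(2)]
  proof (intro equalityI subsetI)
    fix Y assume "Y \<in> {d \<cdot>\<^sub>m A | d. d \<noteq> 0}"
    then show "Y \<in> {d \<cdot>\<^sub>m B | d. d \<noteq> 0}" using c by (auto simp: smult_smult_mat)
  next
    fix Y assume "Y \<in> {d \<cdot>\<^sub>m B | d. d \<noteq> 0}"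
    then obtain d where "d \<noteq> 0" "Y = d \<cdot>\<^sub>m B" by auto
    then have "Y = (d / c) \<cdot>\<^sub>m A" "d / c \<noteq> 0" using c by (auto simp: smult_smult_mat)
    then show "Y \<in> {d \<cdot>\<^sub>m A | d. d \<noteq> 0}" by blast
  qed
qed

lemma normal_scalars: "scalars n \<lhd> (GL n :: 'a::field mat monoid)"
proof -
  interpret group "GL n :: 'a mat monoid" by (rule group_GL)
  have in_carrier: "scalars n \<subseteq> carrier (GL n :: 'a mat monoid)"
    by (auto simp: scalars_def det_smult)
  have inv: "inv\<^bsub>GL n\<^esub> (c \<cdot>\<^sub>m 1\<^sub>m n) = inverse c \<cdot>\<^sub>m 1\<^sub>m n" if "c \<noteq> 0" for c :: 'a
    using that by (intro GL_inv_eq) (auto simp: scalar_mult_mat smult_smult_mat)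
  have sub: "subgroup (scalars n) (GL n :: 'a mat monoid)"
  proof (rule subgroupI)
    show "scalars n \<noteq> ({} :: 'a mat set)" by (auto simp: scalars_def intro!: exI[of _ 1])
    fix A B :: "'a mat" assume "A \<in> scalars n"
    then obtain c where c: "c \<noteq> 0" "A = c \<cdot>\<^sub>m 1\<^sub>m n" by (auto simp: scalars_def)
    then show "inv\<^bsub>GL n\<^esub> A \<in> scalars n" by (simp add: inv) (auto simp: scalars_def)
    assume "B \<in> scalars n"
    then obtain d where d: "d \<noteq> 0" "B = d \<cdot>\<^sub>m 1\<^sub>m n" by (auto simp: scalars_def)
    have "A * B = (c * d) \<cdot>\<^sub>m 1\<^sub>m n" "c * d \<noteq> 0" using c d
      by (auto simp: scalar_mult_mat smult_smult_mat)
    then show "A \<otimes>\<^bsub>GL n\<^esub> B \<in> scalars n" by (auto simp: scalars_def)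
  qed (rule in_carrier)
  show ?thesis
    unfolding normal_inv_iff
  proof (intro conjI ballI sub)
    fix Y H :: "'a mat" assume Y: "Y \<in> carrier (GL n)" and "H \<in> scalars n"
    then obtain c where c: "c \<noteq> 0" "H = c \<cdot>\<^sub>m 1\<^sub>m n" by (auto simp: scalars_def)
    obtain Z where Z: "Z \<in> carrier (GL n)" "Y * Z = 1\<^sub>m n" "Z * Y = 1\<^sub>m n" using GL_obtain_inverse[OF Y] .
    have "Y * H * Z = c \<cdot>\<^sub>m 1\<^sub>m n"
      using Y Z c by (simp add: scalar_mult_mat mult_smult_assoc_mat[of _ n n _ n])
    moreover have "inv\<^bsub>GL n\<^esub> Y = Z" using Y Z by (intro GL_inv_eq) auto
    ultimately show "Y \<otimes>\<^bsub>GL n\<^esub> H \<otimes>\<^bsub>GL n\<^esub> inv\<^bsub>GL n\<^esub> Y \<in> scalars n"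
      using c by (auto simp: scalars_def)
  qed
qed

lemma carrier_PGL: "carrier (PGL n) = cl n ` carrier (GL n)"
  by (auto simp: PGL_def FactGroup_def RCOSETS_def)

lemma PGL_mult:
  assumes "A \<in> carrier (GL n)" "B \<in> carrier (GL n)"
  shows "cl n A \<otimes>\<^bsub>PGL n\<^esub> cl n B = cl n (A * B)"
  using normal.rcos_sum[OF normal_scalars assms] by (simp add: PGL_def)

lemma PGL_one: "\<one>\<^bsub>PGL n\<^esub> = cl n (1\<^sub>m n)"
  unfolding cl_eq[OF one_carrier_mat] by (auto simp: PGL_def scalars_def)

text \<open>Replacing A by c A multiplies the factor d by c^(q+1), so this is a property of the
  coset of A, and no normalisation of d is asked for.\<close>

definition similitude :: "nat \<Rightarrow> nat \<Rightarrow> 'a::field mat \<Rightarrow> bool" where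
  "similitude q n A \<longleftrightarrow> A \<in> carrier_mat n n \<and>
     (\<exists>d. d \<noteq> 0 \<and> transpose_mat A * frob_mat q A = d \<cdot>\<^sub>m 1\<^sub>m n)"

lemma frob_mat_carrier [simp]: "frob_mat q A \<in> carrier_mat a b \<longleftrightarrow> A \<in> carrier_mat a b"
  by (auto simp: frob_mat_def)

lemma frob_mat_index [simp]:
  "i < dim_row A \<Longrightarrow> j < dim_col A \<Longrightarrow> frob_mat q A $$ (i, j) = (A $$ (i, j)) ^ q"
  "dim_row (frob_mat q A) = dim_row A" "dim_col (frob_mat q A) = dim_col A"
  by (auto simp: frob_mat_def)

lemma frob_mat_smult: "frob_mat q (c \<cdot>\<^sub>m A) = (c::'a::field) ^ q \<cdot>\<^sub>m frob_mat q A"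
  by (intro eq_matI) (auto simp: power_mult_distrib)

lemma frob_mat_kron: "frob_mat q (kron A B) = kron (frob_mat q A) (frob_mat q (B::'a::field mat))"
  by (rule eq_mat_pairI[of _ "dim_row A" "dim_row B" "dim_col A" "dim_col B"])
     (auto simp: kron_def pair_index_less power_mult_distrib)

lemma transpose_smult: "transpose_mat (c \<cdot>\<^sub>m A) = c \<cdot>\<^sub>m transpose_mat A"
  by (intro eq_matI) auto

lemma similitude_carrier: "similitude q n A \<Longrightarrow> A \<in> carrier_mat n n"
  by (simp add: similitude_def)

lemma similitude_GL: "similitude q n A \<Longrightarrow> A \<in> carrier (GL n)"
proof -
  assume "similitude q n A"
  then obtain d where A: "A \<in> carrier_mat n n" and d: "d \<noteq> 0" "transpose_mat A * frob_mat q A = d \<cdot>\<^sub>m 1\<^sub>m n"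
    by (auto simp: similitude_def)
  have "det (transpose_mat A) * det (frob_mat q A) = det (d \<cdot>\<^sub>m 1\<^sub>m n)"
    using det_mult[of "transpose_mat A" n "frob_mat q A"] A d by simp
  also have "\<dots> \<noteq> 0" using d by (simp add: det_smult)
  finally show ?thesis using A det_transpose[OF A] by auto
qed

text \<open>What the unitary groups require of q: raising to the q-th power is additive, so applying
  it entrywise respects matrix products. Algebraic closedness supplies q-th roots.\<close>

locale frobenius_power =
  fixes q :: nat and ty :: "'a::alg_closed_field itself"
  assumes q_pos: "q > 0" and add_power: "\<And>x y :: 'a. (x + y) ^ q = x ^ q + y ^ q"
begin

lemma sum_power: "(sum f I) ^ q = (\<Sum>i\<in>I. f i ^ q :: 'a)"
  by (induction I rule: infinite_finite_induct) (use q_pos in \<open>auto simp: add_power power_0_left\<close>)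

lemma frob_mat_mult:
  fixes A :: "'a mat"
  assumes "A \<in> carrier_mat a b" "B \<in> carrier_mat b c"
  shows "frob_mat q (A * B) = frob_mat q A * frob_mat q B"
proof (rule eq_matI)
  fix i j assume "i < dim_row (frob_mat q A * frob_mat q B)" "j < dim_col (frob_mat q A * frob_mat q B)"
  then have ij: "i < a" "j < c" using assms by auto
  have "frob_mat q (A * B) $$ (i, j) = ((A * B) $$ (i, j)) ^ q"
    using ij assms by (intro frob_mat_index(1)) auto
  also have "\<dots> = (\<Sum>t<b. (A $$ (i, t)) ^ q * (B $$ (t, j)) ^ q)"
    by (simp add: index_mult_mat_sum[OF assms ij] sum_power power_mult_distrib del: index_mult_mat)
  also have "\<dots> = (frob_mat q A * frob_mat q B) $$ (i, j)"
    using assms ij by (subst index_mult_mat_sum[where b = b]) auto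
  finally show "frob_mat q (A * B) $$ (i, j) = (frob_mat q A * frob_mat q B) $$ (i, j)" .
qed (use assms in auto)

lemma frob_mat_one: "frob_mat q (1\<^sub>m n) = (1\<^sub>m n :: 'a mat)"
  using q_pos by (intro eq_matI) (auto simp: power_0_left)

lemma frob_mat_GL: "A \<in> carrier (GL n) \<Longrightarrow> frob_mat q A \<in> carrier (GL n :: 'a mat monoid)"
proof -
  assume A: "A \<in> carrier (GL n)"
  then obtain B where B: "B \<in> carrier (GL n)" "A * B = 1\<^sub>m n" using GL_obtain_inverse by blast
  then have "frob_mat q A * frob_mat q B = 1\<^sub>m n"
    using frob_mat_mult[of A n n B n] A by (simp add: frob_mat_one)
  then show ?thesis using A B by (intro GL_I(1)[of _ n "frob_mat q B"]) auto
qed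

lemma similitude_mult:
  fixes A :: "'a mat"
  assumes "similitude q n A" "similitude q n B"
  shows "similitude q n (A * B)"
proof -
  obtain c where A: "A \<in> carrier_mat n n" and c: "c \<noteq> 0" "transpose_mat A * frob_mat q A = c \<cdot>\<^sub>m 1\<^sub>m n"
    using assms by (auto simp: similitude_def)
  obtain d where B: "B \<in> carrier_mat n n" and d: "d \<noteq> 0" "transpose_mat B * frob_mat q B = d \<cdot>\<^sub>m 1\<^sub>m n"
    using assms by (auto simp: similitude_def)
  have "transpose_mat (A * B) * frob_mat q (A * B) = transpose_mat B * (transpose_mat A * frob_mat q A) * frob_mat q B"
    using A B by (simp add: transpose_mult[OF A B] frob_mat_mult[OF A B] assoc_mult_mat[of _ n n _ n _ n] mult_carrier_mat[of _ n n _ n])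
  also have "\<dots> = (c * d) \<cdot>\<^sub>m 1\<^sub>m n"
    using A B by (simp add: c d scalar_mult_mat mult_smult_assoc_mat[of _ n n _ n] smult_smult_mat)
  finally show ?thesis using A B c d unfolding similitude_def by (intro conjI exI[of _ "c * d"]) auto
qed

lemma similitude_one: "similitude q n (1\<^sub>m n :: 'a mat)"
  by (auto simp: similitude_def frob_mat_one intro!: exI[of _ 1])

lemma similitude_cancel:
  fixes A :: "'a mat"
  assumes "similitude q n (A * B)" "similitude q n A" "A \<in> carrier_mat n n" "B \<in> carrier_mat n n"
  shows "similitude q n B"
proof -
  obtain c where c: "c \<noteq> 0" "transpose_mat (A * B) * frob_mat q (A * B) = c \<cdot>\<^sub>m 1\<^sub>m n"
    using assms by (auto simp: similitude_def)
  obtain d where d: "d \<noteq> 0" "transpose_mat A * frob_mat q A = d \<cdot>\<^sub>m 1\<^sub>m n"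
    using assms by (auto simp: similitude_def)
  have "transpose_mat (A * B) * frob_mat q (A * B) = transpose_mat B * (transpose_mat A * frob_mat q A) * frob_mat q B"
    using assms(3,4) by (simp add: transpose_mult[OF assms(3,4)] frob_mat_mult[OF assms(3,4)]
        assoc_mult_mat[of _ n n _ n _ n] mult_carrier_mat[of _ n n _ n])
  also have "\<dots> = d \<cdot>\<^sub>m (transpose_mat B * frob_mat q B)"
    using assms(3,4) by (simp add: d scalar_mult_mat mult_smult_assoc_mat[of _ n n _ n])
  finally have "inverse d \<cdot>\<^sub>m (d \<cdot>\<^sub>m (transpose_mat B * frob_mat q B)) = inverse d \<cdot>\<^sub>m (c \<cdot>\<^sub>m 1\<^sub>m n)"
    by (simp add: c)
  then have "transpose_mat B * frob_mat q B = (inverse d * c) \<cdot>\<^sub>m 1\<^sub>m n"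
    using d by (simp add: smult_smult_mat)
  then show ?thesis using assms(4) c d unfolding similitude_def
    by (intro conjI exI[of _ "inverse d * c"]) auto
qed

text \<open>If the coset is fixed as a set, then A itself goes to a multiple of A, which is the
  similitude equation inverted. Conversely c A goes to \<open>inverse (c ^ q) * inverse d\<close>
  times A, and every multiple of A is reached because the field has q-th roots.\<close>

lemma steinbergF_image:
  fixes A :: "'a mat"
  assumes A: "A \<in> carrier (GL n)"
  shows "steinbergF q n ` cl n A = cl n A \<longleftrightarrow> similitude q n A"
proof
  assume eq: "steinbergF q n ` cl n A = cl n A"
  have Ac: "A \<in> carrier_mat n n" using A by auto
  have "A \<in> cl n A" using A by (auto simp: cl_eq intro!: exI[of _ 1])
  then have "steinbergF q n A \<in> cl n A" using eq by blast
  then obtain c where c: "c \<noteq> 0" "steinbergF q n A = c \<cdot>\<^sub>m A" using A by (auto simp: cl_eq)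
  obtain B where B: "B \<in> carrier (GL n)" "B * frob_mat q A = 1\<^sub>m n" "frob_mat q A * B = 1\<^sub>m n"
    using GL_obtain_inverse[OF frob_mat_GL[OF A]] by blast
  then have "inv\<^bsub>GL n\<^esub> (frob_mat q A) = B" using Ac by (intro GL_inv_eq) auto
  then have "transpose_mat B = c \<cdot>\<^sub>m A" using c by (simp add: steinbergF_def)
  then have "B = c \<cdot>\<^sub>m transpose_mat A"
    by (metis transpose_smult transpose_transpose)
  then have "c \<cdot>\<^sub>m (transpose_mat A * frob_mat q A) = 1\<^sub>m n"
    using B Ac by (simp add: mult_smult_assoc_mat[of _ n n _ n])
  then have "inverse c \<cdot>\<^sub>m (c \<cdot>\<^sub>m (transpose_mat A * frob_mat q A)) = inverse c \<cdot>\<^sub>m 1\<^sub>m n" by simp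
  then have "transpose_mat A * frob_mat q A = inverse c \<cdot>\<^sub>m 1\<^sub>m n" using c by (simp add: smult_smult_mat)
  then show "similitude q n A" using c Ac unfolding similitude_def
    by (intro conjI exI[of _ "inverse c"]) auto
next
  assume "similitude q n A"
  then obtain d where Ac: "A \<in> carrier_mat n n" and d: "d \<noteq> 0" "transpose_mat A * frob_mat q A = d \<cdot>\<^sub>m 1\<^sub>m n"
    by (auto simp: similitude_def)
  have F: "steinbergF q n (c \<cdot>\<^sub>m A) = (inverse (c ^ q) * inverse d) \<cdot>\<^sub>m A" if "c \<noteq> 0" for c
  proof -
    let ?B = "(inverse (c ^ q) * inverse d) \<cdot>\<^sub>m transpose_mat A"
    have "?B * frob_mat q (c \<cdot>\<^sub>m A) = 1\<^sub>m n"
      using Ac that d by (simp add: mult.assoc frob_mat_smult mult_smult_assoc_mat[of _ n n _ n]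
        mult_smult_distrib[of _ n n _ n] smult_smult_mat)
    then have "inv\<^bsub>GL n\<^esub> (frob_mat q (c \<cdot>\<^sub>m A)) = ?B"
      using Ac by (intro GL_inv_eq) auto
    then show ?thesis by (simp add: steinbergF_def transpose_smult)
  qed
  show "steinbergF q n ` cl n A = cl n A"
  proof (intro equalityI subsetI)
    fix Y assume "Y \<in> steinbergF q n ` cl n A"
    then show "Y \<in> cl n A" using Ac d F by (auto simp: cl_eq)
  next
    fix Y assume "Y \<in> cl n A"
    then obtain e where e: "e \<noteq> 0" "Y = e \<cdot>\<^sub>m A" using Ac by (auto simp: cl_eq)
    obtain c where c: "c ^ q = inverse (e * d)" using nth_root_exists[OF q_pos, of "inverse (e * d)"] by auto
    then have "c \<noteq> 0" using e d q_pos by (auto simp: power_0_left)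
    moreover have "inverse (c ^ q) * inverse d = e" using c d e by simp
    ultimately have "Y = steinbergF q n (c \<cdot>\<^sub>m A)" using F e by simp
    then show "Y \<in> steinbergF q n ` cl n A" using Ac \<open>c \<noteq> 0\<close> by (auto simp: cl_eq)
  qed
qed

lemma carrier_PGU: "carrier (PGU q n) = cl n ` {A :: 'a mat. similitude q n A}"
proof -
  have "carrier (PGU q n :: 'a mat set monoid) = {C \<in> cl n ` carrier (GL n). steinbergF q n ` C = C}"
    by (simp add: PGU_def carrier_PGL)
  also have "\<dots> = cl n ` {A \<in> carrier (GL n). steinbergF q n ` cl n A = cl n A}"
    by auto
  also have "{A \<in> carrier (GL n :: 'a mat monoid). steinbergF q n ` cl n A = cl n A} = {A \<in> carrier (GL n). similitude q n A}"
    by (intro Collect_cong conj_cong refl steinbergF_image)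
  also have "{A \<in> carrier (GL n). similitude q n A} = {A :: 'a mat. similitude q n A}"
    using similitude_GL by blast
  finally show ?thesis .
qed

lemma PGU_mult:
  fixes A :: "'a mat"
  assumes "similitude q n A" "similitude q n B"
  shows "cl n A \<otimes>\<^bsub>PGU q n\<^esub> cl n B = cl n (A * B)"
  using PGL_mult[of A n B] similitude_GL[OF assms(1)] similitude_GL[OF assms(2)] by (simp add: PGU_def)

lemma PGU_one: "\<one>\<^bsub>PGU q n\<^esub> = cl n (1\<^sub>m n :: 'a mat)"
  by (simp add: PGU_def PGL_one)

lemma similitude_obtain_inverse:
  fixes A :: "'a mat"
  assumes "similitude q n A"
  obtains B where "similitude q n B" "A * B = 1\<^sub>m n" "B * A = 1\<^sub>m n"
proof -
  obtain B where B: "B \<in> carrier (GL n)" "A * B = 1\<^sub>m n" "B * A = 1\<^sub>m n"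
    using GL_obtain_inverse[OF similitude_GL[OF assms]] .
  have "similitude q n B"
    using similitude_cancel[of n A B] assms similitude_carrier[OF assms] B similitude_one by auto
  then show ?thesis using that B by blast
qed

lemma group_PGU: "group (PGU q n :: 'a mat set monoid)"
proof (rule groupI)
  fix x y z assume "x \<in> carrier (PGU q n :: 'a mat set monoid)" "y \<in> carrier (PGU q n :: 'a mat set monoid)"
  then obtain A B where AB: "similitude q n A" "x = cl n A" "similitude q n B" "y = cl n B"
    by (auto simp: carrier_PGU)
  then show "x \<otimes>\<^bsub>PGU q n\<^esub> y \<in> carrier (PGU q n)"
    by (auto simp: PGU_mult carrier_PGU similitude_mult)
  assume "z \<in> carrier (PGU q n :: 'a mat set monoid)"
  then obtain C where C: "similitude q n C" "z = cl n C" by (auto simp: carrier_PGU)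
  have "A * B * C = A * (B * C)"
    using assoc_mult_mat similitude_carrier AB C by blast
  then show "x \<otimes>\<^bsub>PGU q n\<^esub> y \<otimes>\<^bsub>PGU q n\<^esub> z = x \<otimes>\<^bsub>PGU q n\<^esub> (y \<otimes>\<^bsub>PGU q n\<^esub> z)"
    using AB C by (simp add: PGU_mult similitude_mult)
next
  show "\<one>\<^bsub>PGU q n\<^esub> \<in> carrier (PGU q n :: 'a mat set monoid)"
    by (auto simp: PGU_one carrier_PGU similitude_one)
next
  fix x assume "x \<in> carrier (PGU q n :: 'a mat set monoid)"
  then obtain A where A: "similitude q n A" "x = cl n A" by (auto simp: carrier_PGU)
  then show "\<one>\<^bsub>PGU q n\<^esub> \<otimes>\<^bsub>PGU q n\<^esub> x = x"
    using similitude_carrier[OF A(1)] by (simp add: PGU_one PGU_mult similitude_one)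
  obtain B where B: "similitude q n B" "B * A = 1\<^sub>m n" using similitude_obtain_inverse[OF A(1)] by metis
  then show "\<exists>y\<in>carrier (PGU q n). y \<otimes>\<^bsub>PGU q n\<^esub> x = \<one>\<^bsub>PGU q n\<^esub>"
    using A by (intro bexI[of _ "cl n B"]) (auto simp: PGU_mult PGU_one carrier_PGU)
qed

lemma PGU_inv:
  fixes A :: "'a mat"
  assumes "similitude q n A" "similitude q n B" "B * A = 1\<^sub>m n"
  shows "inv\<^bsub>PGU q n\<^esub> (cl n A) = cl n B"
  using assms by (intro group.inv_equality[OF group_PGU]) (auto simp: PGU_mult PGU_one carrier_PGU)

lemma PGU_pow:
  fixes A :: "'a mat"
  assumes "similitude q n A"
  shows "similitude q n (A ^\<^sub>m k)" "cl n A [^]\<^bsub>PGU q n\<^esub> k = cl n (A ^\<^sub>m k)"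
proof (induction k)
  case 0
  case 1
  show ?case using similitude_one similitude_carrier[OF assms] by simp
  case 2
  show ?case using similitude_carrier[OF assms] by (simp add: PGU_one)
next
  case (Suc k)
  case 1
  show ?case using Suc assms by (simp add: similitude_mult)
  case 2
  show ?case using Suc assms by (simp add: PGU_mult)
qed

end

section \<open>Block elements of the symplectic group\<close>

lemma Sp_simps [simp]:
  "carrier (Sp m) = {A \<in> carrier_mat (2 * m) (2 * m). transpose_mat A * sympl_J m * A = sympl_J m}"
  "A \<otimes>\<^bsub>Sp m\<^esub> B = A * B" "\<one>\<^bsub>Sp m\<^esub> = 1\<^sub>m (2 * m)"
  by (simp_all add: Sp_def)

definition dg :: "nat \<Rightarrow> (nat \<Rightarrow> 'a::field) \<Rightarrow> 'a mat" where
  "dg m a = mat m m (\<lambda>(i, j). if i = j then a i else 0)"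

lemma dg_carrier [simp]: "dg m a \<in> carrier_mat m m"
  by (simp add: dg_def)

lemma dg_cong: "(\<And>i. i < m \<Longrightarrow> a i = b i) \<Longrightarrow> dg m a = dg m b"
  by (intro eq_matI) (auto simp: dg_def)

lemma dg_transpose: "transpose_mat (dg m a) = dg m a"
  by (intro eq_matI) (auto simp: dg_def)

lemma dg_add: "dg m a + dg m b = dg m (\<lambda>i. a i + b i)"
  by (intro eq_matI) (auto simp: dg_def)

lemma dg_mult: "dg m a * dg m b = dg m (\<lambda>i. a i * b i)"
proof (rule eq_matI)
  fix i j assume "i < dim_row (dg m (\<lambda>i. a i * b i))" "j < dim_col (dg m (\<lambda>i. a i * b i))"
  then have ij: "i < m" "j < m" by (auto simp: dg_def)
  have "(dg m a * dg m b) $$ (i, j) = (\<Sum>t<m. dg m a $$ (i, t) * dg m b $$ (t, j))"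
    using ij by (intro index_mult_mat_sum[of _ m m _ m]) auto
  also have "\<dots> = (\<Sum>t<m. if t = i then a i * (if i = j then b i else 0) else 0)"
    using ij by (intro sum.cong) (auto simp: dg_def)
  also have "\<dots> = dg m (\<lambda>i. a i * b i) $$ (i, j)" using ij by (simp add: dg_def)
  finally show "(dg m a * dg m b) $$ (i, j) = dg m (\<lambda>i. a i * b i) $$ (i, j)" .
qed (auto simp: dg_def)

text \<open>Matrices acting separately on the m hyperbolic planes spanned by the i-th and (m+i)-th
  basis vectors, with 2 by 2 block (a i, b i; c i, d i) on plane i. They multiply blockwise, so
  identities between them are checked in dimension two.\<close>

definition dblk :: "nat \<Rightarrow> (nat \<Rightarrow> 'a::field) \<Rightarrow> (nat \<Rightarrow> 'a) \<Rightarrow> (nat \<Rightarrow> 'a) \<Rightarrow> (nat \<Rightarrow> 'a) \<Rightarrow> 'a mat" where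
  "dblk m a b c d = four_block_mat (dg m a) (dg m b) (dg m c) (dg m d)"

lemma dblk_carrier [simp]: "dblk m a b c d \<in> carrier_mat (2 * m) (2 * m)"
  unfolding dblk_def mult_2 by (intro four_block_carrier_mat) auto

lemma dblk_cong:
  assumes "\<And>i. i < m \<Longrightarrow> a i = a' i" "\<And>i. i < m \<Longrightarrow> b i = b' i"
    "\<And>i. i < m \<Longrightarrow> c i = c' i" "\<And>i. i < m \<Longrightarrow> d i = d' i"
  shows "dblk m a b c d = dblk m a' b' c' d'"
  unfolding dblk_def using dg_cong assms by metis

lemma dblk_mult:
  "dblk m a b c d * dblk m a' b' c' d' =
   dblk m (\<lambda>i. a i * a' i + b i * c' i) (\<lambda>i. a i * b' i + b i * d' i)
     (\<lambda>i. c i * a' i + d i * c' i) (\<lambda>i. c i * b' i + d i * d' i)"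
  unfolding dblk_def by (subst mult_four_block_mat[of _ m m _ m _ m _ _ m _ m]) (auto simp: dg_mult dg_add)

lemma dblk_transpose: "transpose_mat (dblk m a b c d) = dblk m a c b d"
  unfolding dblk_def by (subst transpose_four_block_mat[of _ m m _ m _ m]) (auto simp: dg_transpose)

lemma dblk_one: "dblk m (\<lambda>_. 1) (\<lambda>_. 0) (\<lambda>_. 0) (\<lambda>_. 1) = 1\<^sub>m (2 * m)"
  by (intro eq_matI) (auto simp: dblk_def dg_def four_block_mat_def Let_def)

lemma sympl_J_dblk: "sympl_J m = dblk m (\<lambda>_. 0) (\<lambda>_. 1) (\<lambda>_. -1) (\<lambda>_. 0)"
  by (intro eq_matI) (auto simp: sympl_J_def dblk_def dg_def four_block_mat_def Let_def)

text \<open>On each plane the symplectic condition is determinant 1.\<close>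

lemma dblk_Sp:
  assumes "\<And>i. i < m \<Longrightarrow> a i * d i - b i * c i = 1"
  shows "dblk m a b c d \<in> carrier (Sp m)"
proof -
  have "transpose_mat (dblk m a b c d) * sympl_J m * dblk m a b c d =
    dblk m (\<lambda>i. - c i * a i + a i * c i) (\<lambda>i. - c i * b i + a i * d i)
      (\<lambda>i. - d i * a i + b i * c i) (\<lambda>i. - d i * b i + b i * d i)"
    by (simp add: dblk_transpose sympl_J_dblk dblk_mult)
  also have "\<dots> = sympl_J m"
    unfolding sympl_J_dblk
  proof (rule dblk_cong)
    fix i assume "i < m"
    note i = assms[OF this]
    show "- c i * a i + a i * c i = 0" "- d i * b i + b i * d i = 0" by simp_all
    show "- c i * b i + a i * d i = 1" using i by (simp add: mult.commute)
    have "- d i * a i + b i * c i = - (a i * d i - b i * c i)" by (simp add: algebra_simps)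
    then show "- d i * a i + b i * c i = - 1" by (simp only: i)
  qed
  finally show ?thesis by simp
qed

definition pm :: "nat \<Rightarrow> (nat \<Rightarrow> nat) \<Rightarrow> 'a::field mat" where
  "pm m \<pi> = mat m m (\<lambda>(i, j). if i = \<pi> j then 1 else 0)"

lemma pm_carrier [simp]: "pm m \<pi> \<in> carrier_mat m m"
  by (simp add: pm_def)

lemma dg_mult_pm: "\<pi> permutes {..<m} \<Longrightarrow> dg m a * pm m \<pi> = pm m \<pi> * dg m (\<lambda>i. a (\<pi> i))"
proof (rule eq_matI)
  assume \<pi>: "\<pi> permutes {..<m}"
  fix i j assume "i < dim_row (pm m \<pi> * dg m (\<lambda>i. a (\<pi> i)))" "j < dim_col (pm m \<pi> * dg m (\<lambda>i. a (\<pi> i)))"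
  then have ij: "i < m" "j < m" by (auto simp: dg_def pm_def)
  have "(dg m a * pm m \<pi>) $$ (i, j) = (\<Sum>t<m. dg m a $$ (i, t) * pm m \<pi> $$ (t, j))"
    using ij by (intro index_mult_mat_sum[of _ m m _ m]) auto
  also have "\<dots> = (\<Sum>t<m. if t = i then (if i = \<pi> j then a i else 0) else 0)"
    using ij by (intro sum.cong) (auto simp: dg_def pm_def)
  also have "\<dots> = (\<Sum>t<m. if t = j then (if i = \<pi> j then a i else 0) else 0)" using ij by simp
  also have "\<dots> = (\<Sum>t<m. pm m \<pi> $$ (i, t) * dg m (\<lambda>i. a (\<pi> i)) $$ (t, j))"
    using ij by (intro sum.cong) (auto simp: dg_def pm_def)
  also have "\<dots> = (pm m \<pi> * dg m (\<lambda>i. a (\<pi> i))) $$ (i, j)"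
    using ij by (intro index_mult_mat_sum[of _ m m _ m, symmetric]) auto
  finally show "(dg m a * pm m \<pi>) $$ (i, j) = (pm m \<pi> * dg m (\<lambda>i. a (\<pi> i))) $$ (i, j)" .
qed (auto simp: dg_def pm_def)

lemma pm_orth: "\<pi> permutes {..<m} \<Longrightarrow> transpose_mat (pm m \<pi>) * pm m \<pi> = 1\<^sub>m m"
proof (rule eq_matI)
  assume \<pi>: "\<pi> permutes {..<m}"
  fix i j assume "i < dim_row (1\<^sub>m m)" "j < dim_col (1\<^sub>m m)"
  then have ij: "i < m" "j < m" by auto
  have pi: "\<pi> i < m" using \<pi> ij permutes_in_image by fastforce
  have inj: "\<pi> i = \<pi> j \<longleftrightarrow> i = j" using permutes_inj[OF \<pi>] by (auto simp: inj_def)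
  have "(transpose_mat (pm m \<pi>) * pm m \<pi>) $$ (i, j) =
     (\<Sum>t<m. transpose_mat (pm m \<pi>) $$ (i, t) * pm m \<pi> $$ (t, j))"
    using ij by (intro index_mult_mat_sum[of _ m m _ m]) auto
  also have "\<dots> = (\<Sum>t<m. if t = \<pi> i then (if i = j then 1 else 0) else 0)"
    using ij inj by (intro sum.cong) (auto simp: pm_def)
  also have "\<dots> = 1\<^sub>m m $$ (i, j)" using ij pi by simp
  finally show "(transpose_mat (pm m \<pi>) * pm m \<pi>) $$ (i, j) = 1\<^sub>m m $$ (i, j)" .
qed (auto simp: pm_def)

text \<open>The same permutation on both halves of the coordinates permutes the hyperbolic planes.
  It is orthogonal and commutes with \<open>sympl_J\<close>, hence symplectic.\<close>

definition pmb :: "nat \<Rightarrow> (nat \<Rightarrow> nat) \<Rightarrow> 'a::field mat" where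
  "pmb m \<pi> = four_block_mat (pm m \<pi>) (0\<^sub>m m m) (0\<^sub>m m m) (pm m \<pi>)"

lemma pmb_carrier [simp]: "pmb m \<pi> \<in> carrier_mat (2 * m) (2 * m)"
  unfolding pmb_def mult_2 by (intro four_block_carrier_mat) auto

lemma dblk_mult_pmb:
  assumes "\<pi> permutes {..<m}"
  shows "dblk m a b c d * pmb m \<pi> =
    pmb m \<pi> * dblk m (\<lambda>i. a (\<pi> i)) (\<lambda>i. b (\<pi> i)) (\<lambda>i. c (\<pi> i)) (\<lambda>i. d (\<pi> i))"
  unfolding dblk_def pmb_def
  by (simp add: mult_four_block_mat[of _ m m _ m _ m _ _ m _ m] dg_mult_pm[OF assms] mult_carrier_mat[of _ m m _ m]
        left_mult_zero_mat[of _ m m] right_mult_zero_mat[of _ m m]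
        left_add_zero_mat[of _ m m] right_add_zero_mat[of _ m m])

lemma pmb_orth:
  assumes "\<pi> permutes {..<m}"
  shows "transpose_mat (pmb m \<pi>) * pmb m \<pi> = (1\<^sub>m (2 * m) :: 'a::field mat)"
proof -
  let ?P = "pm m \<pi> :: 'a mat"
  have "transpose_mat (pmb m \<pi>) = four_block_mat (transpose_mat ?P) (0\<^sub>m m m) (0\<^sub>m m m) (transpose_mat ?P)"
    unfolding pmb_def by (subst transpose_four_block_mat[of _ m m _ m _ m]) auto
  then have "transpose_mat (pmb m \<pi>) * pmb m \<pi> = four_block_mat (1\<^sub>m m) (0\<^sub>m m m) (0\<^sub>m m m) (1\<^sub>m m :: 'a mat)"
    by (simp add: pmb_def mult_four_block_mat[of _ m m _ m _ m _ _ m _ m] pm_orth[OF assms]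
        left_mult_zero_mat[of _ m m] right_mult_zero_mat[of _ m m]
        left_add_zero_mat[of _ m m] right_add_zero_mat[of _ m m])
  then show ?thesis by (simp add: mult_2)
qed

lemma pmb_Sp:
  assumes "\<pi> permutes {..<m}"
  shows "pmb m \<pi> \<in> carrier (Sp m :: 'a::field mat monoid)"
proof -
  let ?B = "pmb m \<pi> :: 'a mat"
  have J: "(sympl_J m :: 'a mat) \<in> carrier_mat (2 * m) (2 * m)" by (simp add: sympl_J_dblk)
  have "transpose_mat ?B * sympl_J m * ?B = transpose_mat ?B * (sympl_J m * ?B)"
    using J by (simp add: assoc_mult_mat[of _ "2 * m" "2 * m" _ "2 * m" _ "2 * m"])
  also have "sympl_J m * ?B = ?B * sympl_J m"
    unfolding sympl_J_dblk by (rule dblk_mult_pmb[OF assms])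
  also have "transpose_mat ?B * (?B * sympl_J m) = transpose_mat ?B * ?B * sympl_J m"
    using J by (simp add: assoc_mult_mat[of _ "2 * m" "2 * m" _ "2 * m" _ "2 * m"])
  finally show ?thesis using J by (simp add: pmb_orth[OF assms])
qed

text \<open>Lower bound for the orbit of a nonempty proper set of planes under all permutations of
  the planes.\<close>

lemma choose_ge_self: "0 < k \<Longrightarrow> k < m \<Longrightarrow> m \<le> m choose k"
proof (induction m arbitrary: k)
  case (Suc m)
  then obtain l where k: "k = Suc l" by (cases k) auto
  show ?case
  proof (cases "k < m")
    case True
    then have "m \<le> m choose k" using Suc by auto
    moreover have "1 \<le> m choose l" using True k by (simp add: Suc_leI)
    ultimately show ?thesis using k by simp
  next
    case False
    then have "m = k" using Suc by auto
    then show ?thesis by simp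
  qed
qed simp

lemma permutes_image_exists:
  assumes "finite S" "A \<subseteq> S" "B \<subseteq> S" "card A = card B"
  shows "\<exists>\<pi>. \<pi> permutes S \<and> \<pi> ` A = B"
proof -
  have fin: "finite A" "finite B" using assms finite_subset by auto
  then obtain f where f: "bij_betw f A B" using assms finite_same_card_bij by blast
  have "card (S - A) = card (S - B)" using assms fin by (simp add: card_Diff_subset)
  then obtain g where g: "bij_betw g (S - A) (S - B)"
    using finite_same_card_bij[of "S - A" "S - B"] assms(1) by auto
  define h where "h x = (if x \<in> A then f x else if x \<in> S then g x else x)" for x
  have hA: "bij_betw h A B" using f by (subst bij_betw_cong[of _ _ f]) (auto simp: h_def)
  have "bij_betw h (S - A) (S - B)" using g by (subst bij_betw_cong[of _ _ g]) (auto simp: h_def)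
  from bij_betw_combine[OF hA this] have "bij_betw h S S"
    using assms by (auto simp: Un_absorb1)
  then have "h permutes S" by (rule bij_imp_permutes) (use assms in \<open>auto simp: h_def\<close>)
  moreover have "h ` A = B" using hA by (simp add: bij_betw_def)
  ultimately show ?thesis by blast
qed

text \<open>The exponent \<open>h\<close> plays the role of 1/2. An element x is the product of the
  square roots of x * \<zeta> x, which is fixed, and of x * inv (\<zeta> x), which is inverted;
  conversely x = u * v determines u, because u * u = x * \<zeta> x.\<close>

lemma (in comm_group) card_involution_split:
  assumes A: "subgroup A G" and fin: "finite A" and h: "\<And>x. x \<in> A \<Longrightarrow> (x \<otimes> x) [^] (h::nat) = x"
    and \<zeta>: "\<And>x. x \<in> A \<Longrightarrow> \<zeta> x \<in> A" "\<And>x y. x \<in> A \<Longrightarrow> y \<in> A \<Longrightarrow> \<zeta> (x \<otimes> y) = \<zeta> x \<otimes> \<zeta> y"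
      "\<And>x. x \<in> A \<Longrightarrow> \<zeta> (\<zeta> x) = x"
  shows "card A = card {x \<in> A. \<zeta> x = x} * card {x \<in> A. \<zeta> x = inv x}"
    and "\<And>x. x \<in> A \<Longrightarrow> \<exists>u v. u \<in> A \<and> \<zeta> u = u \<and> v \<in> A \<and> \<zeta> v = inv v \<and> x = u \<otimes> v"
proof -
  let ?P = "{x \<in> A. \<zeta> x = x}" and ?N = "{x \<in> A. \<zeta> x = inv x}"
  have Ac: "\<And>x. x \<in> A \<Longrightarrow> x \<in> carrier G" using A subgroup.mem_carrier by metis
  have Am: "\<And>x y. x \<in> A \<Longrightarrow> y \<in> A \<Longrightarrow> x \<otimes> y \<in> A" using A by (simp add: subgroup.m_closed)
  have Ai: "\<And>x. x \<in> A \<Longrightarrow> inv x \<in> A" using A by (simp add: subgroup.m_inv_closed)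
  have A1: "\<one> \<in> A" using A by (simp add: subgroup.one_closed)
  interpret A: group "G\<lparr>carrier := A\<rparr>" using A by (simp add: subgroup_imp_group)
  have Ap: "x [^] k \<in> A" if "x \<in> A" for x and k :: nat
    using A.nat_pow_closed[of x k] that by (simp add: nat_pow_consistent[symmetric])
  have cancel: "(a \<otimes> b) \<otimes> (a \<otimes> inv b) = a \<otimes> a" if "a \<in> carrier G" "b \<in> carrier G" for a b
    using that by (simp add: m_assoc m_lcomm[of b a "inv b"])
  have z1: "\<zeta> \<one> = \<one>"
  proof -
    have "\<zeta> \<one> \<otimes> \<zeta> \<one> = \<zeta> \<one>" using \<zeta>(2)[OF A1 A1] by simp
    then show ?thesis using \<zeta>(1)[OF A1] Ac by simp
  qed
  have zi: "\<zeta> (inv x) = inv (\<zeta> x)" if "x \<in> A" for x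
  proof -
    have "\<zeta> (inv x) \<otimes> \<zeta> x = \<one>" using \<zeta>(2)[OF Ai[OF that] that] Ac[OF that] z1 by simp
    then show ?thesis using Ac \<zeta>(1) that Ai by (metis inv_equality)
  qed
  have zp: "\<zeta> (x [^] k) = \<zeta> x [^] k" if "x \<in> A" for x and k :: nat
    by (induction k) (use that z1 \<zeta>(2) Ap in auto)
  have dec: "\<exists>u v. u \<in> A \<and> \<zeta> u = u \<and> v \<in> A \<and> \<zeta> v = inv v \<and> x = u \<otimes> v" if x: "x \<in> A" for x
  proof (intro exI conjI)
    let ?u = "(x \<otimes> \<zeta> x) [^] h" and ?v = "(x \<otimes> inv (\<zeta> x)) [^] h"
    have zx: "\<zeta> x \<in> A" "inv (\<zeta> x) \<in> A" using \<zeta>(1)[OF x] Ai by auto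
    note c = Ac[OF x] Ac[OF zx(1)] Ac[OF zx(2)]
    show "?u \<in> A" "?v \<in> A" using x zx Am Ap by auto
    show "\<zeta> ?u = ?u" using x zx c by (simp add: zp Am \<zeta> m_comm)
    have "\<zeta> ?v = (\<zeta> x \<otimes> inv x) [^] h" using x zx c by (simp add: zp Am \<zeta> zi)
    also have "\<zeta> x \<otimes> inv x = inv (x \<otimes> inv (\<zeta> x))" using c by (simp add: inv_mult)
       (simp add: m_comm)
    finally show "\<zeta> ?v = inv ?v" using c by (simp add: nat_pow_inv)
    have "?u \<otimes> ?v = ((x \<otimes> \<zeta> x) \<otimes> (x \<otimes> inv (\<zeta> x))) [^] h" using c by (simp add: pow_mult_distrib m_comm)
    also have "(x \<otimes> \<zeta> x) \<otimes> (x \<otimes> inv (\<zeta> x)) = x \<otimes> x"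
      using c by (simp add: cancel)
    finally show "x = ?u \<otimes> ?v" using h[OF x] by simp
  qed
  then show "\<And>x. x \<in> A \<Longrightarrow> \<exists>u v. u \<in> A \<and> \<zeta> u = u \<and> v \<in> A \<and> \<zeta> v = inv v \<and> x = u \<otimes> v" .
  have "bij_betw (\<lambda>(u, v). u \<otimes> v) (?P \<times> ?N) A"
    unfolding bij_betw_def
  proof
    show "inj_on (\<lambda>(u, v). u \<otimes> v) (?P \<times> ?N)"
    proof (rule inj_onI, clarify)
      fix u v u' v' assume uv: "u \<in> A" "\<zeta> u = u" "v \<in> A" "\<zeta> v = inv v"
         "u' \<in> A" "\<zeta> u' = u'" "v' \<in> A" "\<zeta> v' = inv v'" and eq: "u \<otimes> v = u' \<otimes> v'"
      note c = Ac[OF uv(1)] Ac[OF uv(3)] Ac[OF uv(5)] Ac[OF uv(7)]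
      have eq': "u \<otimes> inv v = u' \<otimes> inv v'" using uv \<zeta>(2)[of u v] \<zeta>(2)[of u' v'] eq by simp
      have "u \<otimes> u = (u \<otimes> v) \<otimes> (u \<otimes> inv v)" using c by (simp add: cancel)
      also have "\<dots> = (u' \<otimes> v') \<otimes> (u' \<otimes> inv v')" by (simp add: eq eq')
      also have "\<dots> = u' \<otimes> u'" using c by (simp add: cancel)
      finally have "u = u'" using h uv by metis
      then show "u = u' \<and> v = v'" using eq c by simp
    qed
    show "(\<lambda>(u, v). u \<otimes> v) ` (?P \<times> ?N) = A"
      using dec Am by (fastforce simp: image_iff)
  qed
  then show "card A = card ?P * card ?N"
    using bij_betw_same_card by (fastforce simp: card_cartesian_product)
qed

text \<open>A group of order p is cyclic, so \<tau> is a power map x -> x^c. Its p-th iterate has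
  exponent c^p, which is c modulo p by Fermat; so the p-th iterate equals \<tau>, and it is the
  identity by assumption.\<close>

lemma (in group) prime_order_automorphism_trivial:
  assumes A: "subgroup A G" "card A = p" "prime p"
    and \<tau>: "\<And>x. x \<in> A \<Longrightarrow> \<tau> x \<in> A" "\<And>x y. x \<in> A \<Longrightarrow> y \<in> A \<Longrightarrow> \<tau> (x \<otimes> y) = \<tau> x \<otimes> \<tau> y"
    and \<tau>p: "\<And>x. x \<in> A \<Longrightarrow> (\<tau> ^^ p) x = x" and x: "x \<in> A"
  shows "\<tau> x = x"
proof -
  have Ac: "\<And>x. x \<in> A \<Longrightarrow> x \<in> carrier G" using A subgroup.mem_carrier by metis
  have fin: "finite A" using A prime_gt_0_nat card_ge_0_finite by metis
  interpret A: group "G\<lparr>carrier := A\<rparr>" using A by (simp add: subgroup_imp_group)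
  have Ap: "x [^] k \<in> A" if "x \<in> A" for x and k :: nat
    using A.nat_pow_closed[of x k] that by (simp add: nat_pow_consistent[symmetric])
  have t1: "\<tau> \<one> = \<one>"
  proof -
    have 1: "\<one> \<in> A" using A by (simp add: subgroup.one_closed)
    have "\<tau> \<one> \<otimes> \<tau> \<one> = \<tau> \<one>" using \<tau>(2)[OF 1 1] by simp
    then show ?thesis using \<tau>(1)[OF 1] Ac by simp
  qed
  have tp: "\<tau> (x [^] k) = \<tau> x [^] k" if "x \<in> A" for x and k :: nat
    by (induction k) (use that t1 \<tau>(2) Ap in auto)
  show ?thesis
  proof (cases "x = \<one>")
    case True
    then show ?thesis using t1 by simp
  next
    case False
    have xp: "x [^] p = \<one>"
      using A.pow_order_eq_1[of x] x A(2) by (simp add: Coset.order_def nat_pow_consistent[symmetric])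
    have pow_mod: "x [^] k = x [^] (k mod p)" for k :: nat
    proof -
      have "x [^] k = x [^] (p * (k div p) + k mod p)" by simp
      also have "\<dots> = (x [^] p) [^] (k div p) \<otimes> x [^] (k mod p)"
        using Ac[OF x] by (simp add: nat_pow_mult nat_pow_pow)
      finally show ?thesis using Ac[OF x] xp by simp
    qed
    from xp have "ord x dvd p" using Ac[OF x] pow_eq_id by blast
    moreover have "ord x \<noteq> 1" using False Ac[OF x] ord_eq_1 by blast
    ultimately have ordx: "ord x = p" using A(3) by (metis prime_nat_iff)
    have "(\<lambda>k. x [^] k) ` {0..ord x - 1} \<subseteq> A" using Ap x by auto
    moreover have "card ((\<lambda>k. x [^] k) ` {0..ord x - 1}) = p"
      using card_image[OF ord_inj[OF Ac[OF x]]] ordx A(3) prime_gt_0_nat by fastforce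
    ultimately have "(\<lambda>k. x [^] k) ` {0..ord x - 1} = A" using A(2) fin by (simp add: card_subset_eq)
    then obtain c where c: "\<tau> x = x [^] (c::nat)" using \<tau>(1)[OF x] by auto
    have it: "(\<tau> ^^ j) x = x [^] (c ^ j)" for j
    proof (induction j)
      case (Suc j)
      then show ?case using x Ac by (simp add: tp c nat_pow_pow mult.commute)
    qed (use x Ac in auto)
    have "[c ^ p = c] (mod p)"
    proof (cases "p dvd c")
      case True
      then have "[c ^ p = 0] (mod p)" "[c = 0] (mod p)"
        using A(3) prime_gt_0_nat[of p] by (auto simp: cong_0_iff intro: dvd_trans)
      then show ?thesis using cong_sym cong_trans by blast
    next
      case False
      then have "[c ^ (p - 1) = 1] (mod p)" using A(3) fermat_theorem by blast
      then have "[c * c ^ (p - 1) = c * 1] (mod p)" by (rule cong_scalar_left)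
      then show ?thesis using A(3) prime_gt_0_nat[of p] by (simp add: power_eq_if)
    qed
    then have "x [^] (c ^ p) = x [^] c"
      using pow_mod[of "c ^ p"] pow_mod[of c] by (simp add: cong_def)
    then show ?thesis using it[of p] \<tau>p[OF x] c by simp
  qed
qed

section \<open>Symplectic actions on elementary abelian groups\<close>

lemma prime_dvd_prime_power_cases:
  assumes "prime (p::nat)" "k dvd p ^ e"
  shows "k = 1 \<or> k = p \<or> p ^ 2 \<le> k"
proof -
  obtain i where i: "k = p ^ i" using divides_primepow_nat[OF assms(1)] assms(2) by blast
  show ?thesis
  proof (cases "i \<ge> 2")
    case True
    then have "p ^ 2 \<le> p ^ i" using prime_gt_0_nat[OF assms(1)] by (intro power_increasing) auto
    then show ?thesis using i by simp
  next
    case False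
    then have "i = 0 \<or> i = 1" by auto
    then show ?thesis using i by auto
  qed
qed

text \<open>Nothing connects \<alpha> with the natural action on vectors: only a faithful action by
  automorphisms is assumed, and \<alpha> is unconstrained outside Sp.\<close>

locale sp_action = comm_group G for G (structure) +
  fixes p m :: nat and \<alpha> :: "'g::{finite,field} mat \<Rightarrow> 'a \<Rightarrow> 'a"
  assumes p: "prime p" "odd p" "card (UNIV :: 'g set) = p"
    and fin: "finite (carrier G)" and cardG: "card (carrier G) = p ^ (2 * m)"
    and expo: "\<And>x. x \<in> carrier G \<Longrightarrow> x [^] p = \<one>"
    and act_hom: "\<And>s x y. s \<in> carrier (Sp m) \<Longrightarrow> x \<in> carrier G \<Longrightarrow> y \<in> carrier G \<Longrightarrow> \<alpha> s (x \<otimes> y) = \<alpha> s x \<otimes> \<alpha> s y"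
    and act_closed: "\<And>s x. s \<in> carrier (Sp m) \<Longrightarrow> x \<in> carrier G \<Longrightarrow> \<alpha> s x \<in> carrier G"
    and act_mult: "\<And>s t x. s \<in> carrier (Sp m) \<Longrightarrow> t \<in> carrier (Sp m) \<Longrightarrow> x \<in> carrier G \<Longrightarrow> \<alpha> (s * t) x = \<alpha> s (\<alpha> t x)"
    and act_one: "\<And>x. x \<in> carrier G \<Longrightarrow> \<alpha> (1\<^sub>m (2 * m)) x = x"
    and faithful: "\<And>s t. s \<in> carrier (Sp m) \<Longrightarrow> t \<in> carrier (Sp m) \<Longrightarrow> (\<And>x. x \<in> carrier G \<Longrightarrow> \<alpha> s x = \<alpha> t x) \<Longrightarrow> s = t"
begin

lemma one_neq_minus_one: "(1::'g) \<noteq> - 1" and of_nat_p: "of_nat p = (0::'g)"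
proof -
  have d: "CHAR('g) dvd p" using CHAR_dvd_CARD[where ?'a = 'g] p(3) by simp
  then show "of_nat p = (0::'g)" by (simp add: of_nat_eq_0_iff_char_dvd)
  show "(1::'g) \<noteq> - 1"
  proof
    assume "(1::'g) = - 1"
    then have "of_nat 2 = (0::'g)" by (metis add.right_inverse of_nat_numeral one_add_one)
    then have "CHAR('g) dvd 2" by (simp only: of_nat_eq_0_iff_char_dvd)
    moreover have "CHAR('g) \<noteq> 1" by simp
    ultimately have "CHAR('g) = 2" by (metis prime_nat_iff two_is_prime_nat)
    then show False using d p(1,2) by (metis)
  qed
qed

text \<open>(p + 1) / 2 is the inverse of 2 modulo the exponent p.\<close>

lemma square_root: "x \<in> carrier G \<Longrightarrow> (x \<otimes> x) [^] ((p + 1) div 2) = x"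
proof -
  assume x: "x \<in> carrier G"
  have "(x \<otimes> x) [^] ((p + 1) div 2) = (x [^] (2::nat)) [^] ((p + 1) div 2)"
    using x by (simp add: numeral_2_eq_2)
  also have "\<dots> = x [^] (2 * ((p + 1) div 2))" using x by (simp add: nat_pow_pow)
  also have "2 * ((p + 1) div 2) = Suc p" using p(2) by simp
  finally show ?thesis using x expo by simp
qed

lemma square_eq_one: "x \<in> carrier G \<Longrightarrow> x \<otimes> x = \<one> \<Longrightarrow> x = \<one>"
  using square_root[of x] by simp

lemma act_pow_one: "s \<in> carrier (Sp m) \<Longrightarrow> \<alpha> s \<one> = \<one>"
proof -
  assume s: "s \<in> carrier (Sp m)"
  have "\<alpha> s \<one> \<otimes> \<alpha> s \<one> = \<alpha> s \<one>" using act_hom[OF s one_closed one_closed] by simp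
  then show ?thesis using act_closed[OF s one_closed] by simp
qed

lemma act_inv: "s \<in> carrier (Sp m) \<Longrightarrow> x \<in> carrier G \<Longrightarrow> \<alpha> s (inv x) = inv (\<alpha> s x)"
proof -
  assume s: "s \<in> carrier (Sp m)" and x: "x \<in> carrier G"
  have "\<alpha> s (inv x) \<otimes> \<alpha> s x = \<one>" using act_hom[OF s inv_closed[OF x] x] x act_pow_one[OF s] by simp
  then show ?thesis using act_closed[OF s] x inv_equality by auto
qed

definition zz :: "nat set \<Rightarrow> 'g mat" where
  "zz S = dblk m (\<lambda>i. if i \<in> S then -1 else 1) (\<lambda>_. 0) (\<lambda>_. 0) (\<lambda>i. if i \<in> S then -1 else 1)"

lemma zz_Sp: "zz S \<in> carrier (Sp m)"
  unfolding zz_def by (rule dblk_Sp) auto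

lemma zz_empty: "zz {} = 1\<^sub>m (2 * m)"
  unfolding zz_def by (simp add: dblk_one)

lemma zz_insert: "i \<notin> S \<Longrightarrow> zz (insert i S) = zz {i} * zz S"
  unfolding zz_def dblk_mult by (rule dblk_cong) auto

lemma zz_square: "zz S * zz S = 1\<^sub>m (2 * m)"
  unfolding zz_def dblk_mult dblk_one[symmetric] by (rule dblk_cong) auto

lemma zz_commute: "zz S * zz T = zz T * zz S"
  unfolding zz_def dblk_mult by (rule dblk_cong) auto

lemma zz_inj: assumes "S \<subseteq> {..<m}" "T \<subseteq> {..<m}" "zz S = zz T" shows "S = T"
proof -
  have "i \<in> S \<longleftrightarrow> i \<in> T" if "i < m" for i
  proof -
    have "zz U $$ (i, i) = (if i \<in> U then -1 else 1)" for U
      using that by (simp add: zz_def dblk_def dg_def)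
    then show ?thesis using assms(3) one_neq_minus_one by (metis (full_types))
  qed
  then show ?thesis using assms by blast
qed

text \<open>Joint eigenspace in R of the involutions \<open>zz {i}\<close> with i < j, where \<chi>
  lists the indices with eigenvalue -1. The stage j allows refinement by one involution at a time,
  starting from R itself at j = 0.\<close>

definition V :: "'a set \<Rightarrow> nat \<Rightarrow> nat set \<Rightarrow> 'a set" where
  "V R j \<chi> = {x \<in> R. \<forall>i<j. \<alpha> (zz {i}) x = (if i \<in> \<chi> then inv x else x)}"

definition inv_subgroup :: "'a set \<Rightarrow> bool" where
  "inv_subgroup R \<longleftrightarrow> subgroup R G \<and> (\<forall>s\<in>carrier (Sp m). \<forall>x\<in>R. \<alpha> s x \<in> R)"

lemma inv_subgroup_carrier: "inv_subgroup (carrier G)"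
  by (auto simp: inv_subgroup_def subgroup_self act_closed simp del: Sp_simps)

lemma V_subgroup: assumes "inv_subgroup R" shows "subgroup (V R j \<chi>) G"
proof -
  have R: "subgroup R G" using assms by (simp add: inv_subgroup_def)
  note Rc = subgroup.mem_carrier[OF R]
  show ?thesis
  proof (rule subgroupI)
    show "V R j \<chi> \<subseteq> carrier G" using Rc by (auto simp: V_def)
    have "\<one> \<in> V R j \<chi>" using R zz_Sp by (auto simp: V_def subgroup.one_closed act_pow_one)
    then show "V R j \<chi> \<noteq> {}" by auto
    show "inv x \<in> V R j \<chi>" if "x \<in> V R j \<chi>" for x
      using that zz_Sp Rc R by (auto simp: V_def act_inv subgroup.m_inv_closed simp del: Sp_simps)
    show "x \<otimes> y \<in> V R j \<chi>" if "x \<in> V R j \<chi>" "y \<in> V R j \<chi>" for x y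
      using that zz_Sp Rc R
      by (auto simp: V_def act_hom subgroup.m_closed inv_mult simp del: Sp_simps)
  qed
qed

text \<open>The involutions commute, so \<open>zz {j}\<close> maps each eigenspace of stage j to
  itself and splits it by \<open>card_involution_split\<close>.\<close>

lemma V_split:
  assumes R: "inv_subgroup R" and \<chi>: "\<chi> \<subseteq> {..<j}"
  shows "card (V R j \<chi>) = card (V R (Suc j) \<chi>) * card (V R (Suc j) (insert j \<chi>))"
    and "x \<in> V R j \<chi> \<Longrightarrow> \<exists>u v. u \<in> V R (Suc j) \<chi> \<and> v \<in> V R (Suc j) (insert j \<chi>) \<and> x = u \<otimes> v"
proof -
  let ?\<zeta> = "\<alpha> (zz {j})"
  have Rs: "subgroup R G" and Ra: "\<And>s x. s \<in> carrier (Sp m) \<Longrightarrow> x \<in> R \<Longrightarrow> \<alpha> s x \<in> R"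
    using R by (auto simp: inv_subgroup_def)
  note Rc = subgroup.mem_carrier[OF Rs]
  have "j \<notin> \<chi>" using \<chi> by auto
  then have 1: "{x \<in> V R j \<chi>. ?\<zeta> x = x} = V R (Suc j) \<chi>"
    and 2: "{x \<in> V R j \<chi>. ?\<zeta> x = inv x} = V R (Suc j) (insert j \<chi>)"
    by (auto simp: V_def less_Suc_eq)
  have fV: "finite (V R j \<chi>)" using fin Rc by (auto simp: V_def intro: finite_subset)
  have cl: "?\<zeta> x \<in> V R j \<chi>" if x: "x \<in> V R j \<chi>" for x
  proof -
    have xR: "x \<in> R" "x \<in> carrier G" using x Rc by (auto simp: V_def)
    have "\<alpha> (zz {i}) (?\<zeta> x) = ?\<zeta> (\<alpha> (zz {i}) x)" for i
      using act_mult[OF zz_Sp zz_Sp xR(2)] zz_commute by metis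
    then show ?thesis using x xR Ra[OF zz_Sp] act_inv[OF zz_Sp xR(2)] by (auto simp: V_def)
  qed
  have hom: "?\<zeta> (x \<otimes> y) = ?\<zeta> x \<otimes> ?\<zeta> y" if "x \<in> V R j \<chi>" "y \<in> V R j \<chi>" for x y
    using that act_hom[OF zz_Sp] Rc by (auto simp: V_def)
  have sq: "?\<zeta> (?\<zeta> x) = x" if "x \<in> V R j \<chi>" for x
    using that act_mult[OF zz_Sp zz_Sp, of x "{j}" "{j}"] Rc zz_square act_one by (auto simp: V_def)
  have rt: "(x \<otimes> x) [^] ((p + 1) div 2) = x" if "x \<in> V R j \<chi>" for x
    using that square_root Rc by (auto simp: V_def)
  note split = card_involution_split[OF V_subgroup[OF R] fV rt, of ?\<zeta>, OF _ cl hom sq]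
  show "card (V R j \<chi>) = card (V R (Suc j) \<chi>) * card (V R (Suc j) (insert j \<chi>))"
    using split(1) unfolding 1 2 by simp
  show "x \<in> V R j \<chi> \<Longrightarrow> \<exists>u v. u \<in> V R (Suc j) \<chi> \<and> v \<in> V R (Suc j) (insert j \<chi>) \<and> x = u \<otimes> v"
    using split(2)[of x] unfolding 1[symmetric] 2[symmetric] by blast
qed

lemma card_prod_V:
  assumes R: "inv_subgroup R"
  shows "card R = (\<Prod>\<chi>\<in>Pow {..<j}. card (V R j \<chi>))"
proof (induction j)
  case 0
  show ?case by (simp add: V_def)
next
  case (Suc j)
  have "Pow {..<Suc j} = Pow {..<j} \<union> insert j ` Pow {..<j}"
    by (simp add: lessThan_Suc Pow_insert)
  moreover have "Pow {..<j} \<inter> insert j ` Pow {..<j} = {}" by auto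
  moreover have "inj_on (insert j) (Pow {..<j})" by (auto simp: inj_on_def)
  ultimately have "(\<Prod>\<chi>\<in>Pow {..<Suc j}. card (V R (Suc j) \<chi>)) =
    (\<Prod>\<chi>\<in>Pow {..<j}. card (V R (Suc j) \<chi>)) * (\<Prod>\<chi>\<in>Pow {..<j}. card (V R (Suc j) (insert j \<chi>)))"
    by (simp add: prod.union_disjoint prod.reindex)
  also have "\<dots> = (\<Prod>\<chi>\<in>Pow {..<j}. card (V R j \<chi>))"
    using V_split(1)[OF R] by (simp add: prod.distrib[symmetric])
  finally show ?case using Suc by simp
qed

text \<open>Every element is a product of joint eigenvectors: agreement descends from stage m, where
  it is assumed, to stage 0, where the eigenspace is all of G. Faithfulness finishes.\<close>

lemma agree_on_V:
  assumes s: "s \<in> carrier (Sp m)" "t \<in> carrier (Sp m)"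
    and eq: "\<And>\<chi> x. \<chi> \<subseteq> {..<m} \<Longrightarrow> x \<in> V (carrier G) m \<chi> \<Longrightarrow> \<alpha> s x = \<alpha> t x"
  shows "s = t"
proof (rule faithful[OF s])
  have step: "\<forall>\<chi>\<subseteq>{..<j}. \<forall>x\<in>V (carrier G) j \<chi>. \<alpha> s x = \<alpha> t x" if "j \<le> m" for j
    using that
  proof (induction rule: inc_induct)
    case base
    then show ?case using eq by blast
  next
    case (step j)
    show ?case
    proof (intro allI impI ballI)
      fix \<chi> x assume \<chi>: "\<chi> \<subseteq> {..<j}" and x: "x \<in> V (carrier G) j \<chi>"
      obtain u v where uv: "u \<in> V (carrier G) (Suc j) \<chi>" "v \<in> V (carrier G) (Suc j) (insert j \<chi>)" "x = u \<otimes> v"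
        using V_split(2)[OF inv_subgroup_carrier \<chi> x] by blast
      have "\<chi> \<subseteq> {..<Suc j}" "insert j \<chi> \<subseteq> {..<Suc j}" using \<chi> by auto
      then have "\<alpha> s u = \<alpha> t u" "\<alpha> s v = \<alpha> t v" using step.IH uv(1,2) by blast+
      moreover have "u \<in> carrier G" "v \<in> carrier G" using uv by (auto simp: V_def)
      ultimately show "\<alpha> s x = \<alpha> t x" using act_hom[OF s(1)] act_hom[OF s(2)] uv(3) by simp
    qed
  qed
  fix x assume "x \<in> carrier G"
  then show "\<alpha> s x = \<alpha> t x" using step[of 0] by (auto simp: V_def)
qed

lemma zz_on_V:
  assumes "finite S" "S \<subseteq> {..<m}" "x \<in> V (carrier G) m \<chi>"
  shows "\<alpha> (zz S) x = (if even (card (S \<inter> \<chi>)) then x else inv x)"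
  using assms
proof (induction S rule: finite_induct)
  case empty
  then show ?case by (simp add: zz_empty act_one V_def)
next
  case (insert i S)
  have x: "x \<in> carrier G" using insert by (simp add: V_def)
  have "\<alpha> (zz (insert i S)) x = \<alpha> (zz {i}) (\<alpha> (zz S) x)"
    using zz_insert[OF insert(2)] act_mult[OF zz_Sp zz_Sp x] by simp
  also have "\<alpha> (zz S) x = (if even (card (S \<inter> \<chi>)) then x else inv x)" using insert by auto
  finally show ?case
    using insert act_inv[OF zz_Sp x, of "{i}"] x by (auto simp: V_def Int_insert_left)
qed

text \<open>\<open>uu\<close> and \<open>ll\<close> are the upper and lower transvections in plane
  i. They are additive in the parameter, hence have order dividing p.\<close>

definition uu :: "nat \<Rightarrow> 'g \<Rightarrow> 'g mat" where
  "uu i c = dblk m (\<lambda>_. 1) (\<lambda>j. if j = i then c else 0) (\<lambda>_. 0) (\<lambda>_. 1)"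

definition ll :: "nat \<Rightarrow> 'g \<Rightarrow> 'g mat" where
  "ll i c = dblk m (\<lambda>_. 1) (\<lambda>_. 0) (\<lambda>j. if j = i then c else 0) (\<lambda>_. 1)"

lemma uu_Sp: "uu i c \<in> carrier (Sp m)" and ll_Sp: "ll i c \<in> carrier (Sp m)"
  unfolding uu_def ll_def by (rule dblk_Sp; simp)+

lemma uu_add: "uu i c * uu i d = uu i (c + d)" and ll_add: "ll i c * ll i d = ll i (c + d)"
  unfolding uu_def ll_def dblk_mult by (rule dblk_cong; simp add: add.commute)+

lemma uu_0: "uu i 0 = 1\<^sub>m (2 * m)" and ll_0: "ll i 0 = 1\<^sub>m (2 * m)"
  unfolding uu_def ll_def by (simp_all add: dblk_one)

lemma uu_zz: "zz S * uu i c = uu i c * zz S" and ll_zz: "zz S * ll i c = ll i c * zz S"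
  unfolding uu_def ll_def zz_def dblk_mult by (rule dblk_cong; simp)+

text \<open>The bracketed product is the rotation (0, 1; -1, 0) of plane i, whose square is -1
  there.\<close>

lemma zz_transvections:
  "(uu i 1 * ll i (-1) * uu i 1) * (uu i 1 * ll i (-1) * uu i 1) = zz {i}"
  unfolding uu_def ll_def zz_def dblk_mult by (rule dblk_cong) auto

lemma funpow_act:
  assumes "\<And>c d. T c * T d = T (c + d)" "T 0 = 1\<^sub>m (2 * m)" "\<And>c. T c \<in> carrier (Sp m)" "x \<in> carrier G"
  shows "(\<alpha> (T c) ^^ k) x = \<alpha> (T (of_nat k * c)) x"
proof (induction k)
  case 0
  then show ?case using assms act_one by simp
next
  case (Suc k)
  then show ?case using assms by (simp add: act_mult[symmetric] algebra_simps del: Sp_simps)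
qed

text \<open>Nonemptiness of \<chi> supplies a plane i such that \<open>zz {i}\<close> inverts the
  eigenspace. If the order were p, the transvections of that plane would make \<open>zz {i}\<close>
  trivial as well, so x = inv x and x = 1 by odd exponent. For empty \<chi> there is no such plane,
  and that eigenspace is treated by counting.\<close>

lemma card_V_ge:
  assumes R: "inv_subgroup R" and \<chi>: "\<chi> \<noteq> {}" "\<chi> \<subseteq> {..<m}" and ne: "card (V R m \<chi>) \<noteq> 1"
  shows "p ^ 2 \<le> card (V R m \<chi>)"
proof -
  let ?A = "V R m \<chi>"
  have A: "subgroup ?A G" by (rule V_subgroup[OF R])
  have Rs: "subgroup R G" and Ra: "\<And>s x. s \<in> carrier (Sp m) \<Longrightarrow> x \<in> R \<Longrightarrow> \<alpha> s x \<in> R"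
    using R by (auto simp: inv_subgroup_def)
  note Rc = subgroup.mem_carrier[OF Rs]
  note Ac = subgroup.mem_carrier[OF A]
  have "card ?A dvd p ^ (2 * m)"
    using lagrange_finite[OF fin A] cardG by (metis dvd_triv_right Coset.order_def)
  then consider "card ?A = p" | "p ^ 2 \<le> card ?A" using prime_dvd_prime_power_cases[OF p(1)] ne by blast
  then show ?thesis
  proof cases
    case 1
    obtain i where i: "i \<in> \<chi>" "i < m" using \<chi> by blast
    \<comment> \<open>T stands for \<open>uu i\<close> or \<open>ll i\<close>: it commutes with
      every \<open>zz S\<close>, so it maps the eigenspace to itself, and its p-th iterate has
      parameter p * c = 0.\<close>
    have triv: "\<alpha> (T c) x = x"
      if T: "\<And>c d. T c * T d = T (c + d)" "T 0 = 1\<^sub>m (2 * m)" "\<And>c. T c \<in> carrier (Sp m)"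
        "\<And>S c. zz S * T c = T c * zz S" and x: "x \<in> ?A" for T :: "'g \<Rightarrow> 'g mat" and c x
    proof (rule prime_order_automorphism_trivial[OF A 1 p(1) _ _ _ x])
      fix y assume y: "y \<in> ?A"
      have yc: "y \<in> carrier G" "y \<in> R" using y Rc by (auto simp: V_def)
      have "\<alpha> (zz {j}) (\<alpha> (T c) y) = \<alpha> (T c) (\<alpha> (zz {j}) y)" for j
        using act_mult[OF zz_Sp T(3) yc(1)] act_mult[OF T(3) zz_Sp yc(1)] T(4) by metis
      then show "\<alpha> (T c) y \<in> ?A"
        using y yc Ra[OF T(3)] act_inv[OF T(3) yc(1)] by (auto simp: V_def)
      have "(\<alpha> (T c) ^^ p) y = \<alpha> (T (of_nat p * c)) y" by (rule funpow_act[OF T(1,2,3) yc(1)])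
      then show "(\<alpha> (T c) ^^ p) y = y" using of_nat_p T(2) act_one yc by simp
      fix z assume "z \<in> ?A"
      then show "\<alpha> (T c) (y \<otimes> z) = \<alpha> (T c) y \<otimes> \<alpha> (T c) z"
        using act_hom[OF T(3) yc(1)] Ac by auto
    qed
    have u: "\<alpha> (uu i 1) x = x" if "x \<in> ?A" for x
      using triv[of "uu i", OF uu_add uu_0 uu_Sp uu_zz that] .
    have l: "\<alpha> (ll i (-1)) x = x" if "x \<in> ?A" for x
      using triv[of "ll i", OF ll_add ll_0 ll_Sp ll_zz that] .
    have mul: "s * t \<in> carrier (Sp m) \<and> (\<forall>x\<in>?A. \<alpha> (s * t) x = x)"
      if "s \<in> carrier (Sp m) \<and> (\<forall>x\<in>?A. \<alpha> s x = x)" "t \<in> carrier (Sp m) \<and> (\<forall>x\<in>?A. \<alpha> t x = x)" for s t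
    proof -
      have "s * t \<in> carrier (Sp m)"
      proof -
        have s: "s \<in> carrier_mat (2*m) (2*m)" "transpose_mat s * sympl_J m * s = sympl_J m"
          and t: "t \<in> carrier_mat (2*m) (2*m)" "transpose_mat t * sympl_J m * t = sympl_J m"
          using that by auto
        have J: "(sympl_J m :: 'g mat) \<in> carrier_mat (2*m) (2*m)" by (simp add: sympl_J_dblk)
        have "transpose_mat (s * t) * sympl_J m * (s * t) = transpose_mat t * (transpose_mat s * sympl_J m * s) * t"
          using s(1) t(1) J by (simp add: transpose_mult[OF s(1) t(1)] assoc_mult_mat[of _ "2*m" "2*m" _ "2*m" _ "2*m"]
             mult_carrier_mat[of _ "2*m" "2*m" _ "2*m"])
        then show ?thesis using s t by auto
      qed
      then show ?thesis using that act_mult Ac by simp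
    qed
    have U: "uu i 1 \<in> carrier (Sp m) \<and> (\<forall>x\<in>?A. \<alpha> (uu i 1) x = x)" using uu_Sp u by blast
    have L: "ll i (-1) \<in> carrier (Sp m) \<and> (\<forall>x\<in>?A. \<alpha> (ll i (-1)) x = x)" using ll_Sp l by blast
    have z: "\<alpha> (zz {i}) x = x" if "x \<in> ?A" for x
      using mul[OF mul[OF mul[OF U L] U] mul[OF mul[OF U L] U]] that unfolding zz_transvections by blast
    have "x = \<one>" if x: "x \<in> ?A" for x
    proof -
      have "inv x = x" using z[OF x] x i by (auto simp: V_def)
      then have "x \<otimes> x = \<one>" using Ac[OF x] by (metis r_inv)
      then show ?thesis using square_eq_one Ac x by blast
    qed
    then have "?A = {\<one>}" using subgroup.one_closed[OF A] by blast
    then show ?thesis using ne by simp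
  qed
qed

text \<open>\<open>pmb m \<pi>\<close> conjugates \<open>zz {i}\<close> into
  \<open>zz {\<pi> i}\<close> and therefore moves the eigenspace of \<chi> into that of its image.
  Its inverse is its transpose, again a permutation of planes, whence injectivity.\<close>

lemma card_V_perm:
  assumes R: "inv_subgroup R" and \<pi>: "\<pi> permutes {..<m}" and \<chi>: "\<chi> \<subseteq> {..<m}"
  shows "card (V R m \<chi>) \<le> card (V R m (\<pi> ` \<chi>))"
proof (rule card_inj_on_le)
  have Rs: "subgroup R G" and Ra: "\<And>s x. s \<in> carrier (Sp m) \<Longrightarrow> x \<in> R \<Longrightarrow> \<alpha> s x \<in> R"
    using R by (auto simp: inv_subgroup_def)
  note Rc = subgroup.mem_carrier[OF Rs]
  let ?b = "pmb m \<pi> :: 'g mat" and ?b' = "pmb m (Hilbert_Choice.inv \<pi>) :: 'g mat"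
  note b = pmb_Sp[OF \<pi>, where ?'a = 'g]
  show "finite (V R m (\<pi> ` \<chi>))" using fin Rc by (auto simp: V_def intro: finite_subset)
  have conj: "zz {\<pi> i} * ?b = ?b * zz {i}" for i
  proof -
    have "\<pi> j = \<pi> i \<longleftrightarrow> j = i" for j using permutes_inj[OF \<pi>] by (auto simp: inj_def)
    then show ?thesis unfolding zz_def dblk_mult_pmb[OF \<pi>] by simp
  qed
  show "\<alpha> ?b ` V R m \<chi> \<subseteq> V R m (\<pi> ` \<chi>)"
  proof
    fix y assume "y \<in> \<alpha> ?b ` V R m \<chi>"
    then obtain x where x: "x \<in> V R m \<chi>" "y = \<alpha> ?b x" by blast
    have xR: "x \<in> R" "x \<in> carrier G" using x Rc by (auto simp: V_def)
    have "\<alpha> (zz {j}) y = (if j \<in> \<pi> ` \<chi> then inv y else y)" if "j < m" for j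
    proof -
      have "j \<in> \<pi> ` {..<m}" using permutes_image[OF \<pi>] that by simp
      then obtain i where i: "i < m" "j = \<pi> i" by blast
      have "\<alpha> (zz {j}) y = \<alpha> ?b (\<alpha> (zz {i}) x)"
        using act_mult[OF zz_Sp b xR(2), of "{j}"] act_mult[OF b zz_Sp xR(2), of "{i}"] conj[of i] i x by simp
      moreover have "j \<in> \<pi> ` \<chi> \<longleftrightarrow> i \<in> \<chi>" using i permutes_inj[OF \<pi>] by (auto simp: inj_def)
      ultimately show ?thesis using x i act_inv[OF b xR(2)] by (simp add: V_def)
    qed
    then show "y \<in> V R m (\<pi> ` \<chi>)" using Ra[OF b xR(1)] x by (simp add: V_def)
  qed
  show "inj_on (\<alpha> ?b) (V R m \<chi>)"
  proof (rule inj_onI)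
    fix x y assume xy: "x \<in> V R m \<chi>" "y \<in> V R m \<chi>" "\<alpha> ?b x = \<alpha> ?b y"
    then have c: "x \<in> carrier G" "y \<in> carrier G" using Rc by (auto simp: V_def)
    let ?t = "transpose_mat ?b"
    have tb: "?t * ?b = 1\<^sub>m (2 * m)" using pmb_orth[OF \<pi>] .
    have inv_pi: "Hilbert_Choice.inv \<pi> permutes {..<m}" using \<pi> by (rule permutes_inv)
    have "?t = ?b'"
    proof -
      have "transpose_mat (pm m \<pi>) = (pm m (Hilbert_Choice.inv \<pi>) :: 'g mat)"
        by (intro eq_matI) (auto simp: pm_def permutes_inverses[OF \<pi>])
      then show ?thesis
        unfolding pmb_def by (subst transpose_four_block_mat[of _ m m _ m _ m]) auto
    qed
    then have "?t \<in> carrier (Sp m)" using pmb_Sp[OF inv_pi, where ?'a = 'g] by simp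
    then have "\<alpha> ?t (\<alpha> ?b z) = z" if "z \<in> carrier G" for z
      using act_mult[OF _ b that, of ?t] tb act_one[OF that] by simp
    then show "x = y" using xy(3) c by metis
  qed
qed

lemma card_V_eq:
  assumes R: "inv_subgroup R" and "\<chi> \<subseteq> {..<m}" "\<psi> \<subseteq> {..<m}" "card \<chi> = card \<psi>"
  shows "card (V R m \<chi>) = card (V R m \<psi>)"
proof (rule antisym)
  obtain \<pi> where "\<pi> permutes {..<m}" "\<pi> ` \<chi> = \<psi>" using permutes_image_exists[of "{..<m}" \<chi> \<psi>] assms by auto
  then show "card (V R m \<chi>) \<le> card (V R m \<psi>)" using card_V_perm[OF R] assms by blast
  obtain \<pi> where "\<pi> permutes {..<m}" "\<pi> ` \<psi> = \<chi>" using permutes_image_exists[of "{..<m}" \<psi> \<chi>] assms by auto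
  then show "card (V R m \<psi>) \<le> card (V R m \<chi>)" using card_V_perm[OF R] assms by blast
qed

theorem no_invariant_subgroup:
  assumes R: "inv_subgroup R"
  shows "R = {\<one>} \<or> R = carrier G"
proof (rule ccontr)
  assume neg: "\<not> ?thesis"
  have Rs: "subgroup R G" using R by (simp add: inv_subgroup_def)
  have Rsub: "R \<subseteq> carrier G" using Rs subgroup.subset by blast
  have p0: "p > 1" using p(1) prime_gt_1_nat by blast
  let ?E = "carrier G"
  define c where "c \<chi> = card (V ?E m \<chi>)" for \<chi>
  define r where "r \<chi> = card (V R m \<chi>)" for \<chi>
  \<comment> \<open>The empty set is left out because \<open>card_V_ge\<close> does not apply to it;
    that its eigenspace is trivial comes out of the count.\<close>
  define Y where "Y = {\<chi> \<in> Pow {..<m}. \<chi> \<noteq> {} \<and> c \<chi> \<noteq> 1}"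
  have finY: "finite Y" by (simp add: Y_def)
  have Vsub: "V R m \<chi> \<subseteq> V ?E m \<chi>" for \<chi> using Rsub by (auto simp: V_def)
  have finV: "finite (V ?E m \<chi>)" "finite (V R m \<chi>)" for \<chi>
    using fin finite_subset[OF Vsub] by (auto simp: V_def)
  have r_le: "r \<chi> \<le> c \<chi>" for \<chi> unfolding r_def c_def by (rule card_mono[OF finV(1) Vsub])
  have c_pos: "0 < c \<chi>" for \<chi>
    using subgroup.one_closed[OF V_subgroup[OF inv_subgroup_carrier]] finV unfolding c_def by (metis card_gt_0_iff empty_iff)
  have r_pos: "0 < r \<chi>" for \<chi>
    using subgroup.one_closed[OF V_subgroup[OF R]] finV unfolding r_def by (metis card_gt_0_iff empty_iff)
  have prodc: "p ^ (2 * m) = (\<Prod>\<chi>\<in>Pow {..<m}. c \<chi>)"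
    using card_prod_V[OF inv_subgroup_carrier, of m] cardG by (simp add: c_def)
  have prodr: "card R = (\<Prod>\<chi>\<in>Pow {..<m}. r \<chi>)"
    using card_prod_V[OF R, of m] by (simp add: r_def)
  have Yge: "p ^ 2 \<le> c \<chi>" if "\<chi> \<in> Y" for \<chi>
    using card_V_ge[OF inv_subgroup_carrier, of \<chi>] that by (auto simp: Y_def c_def)
  have Yr: "p ^ 2 \<le> r \<chi>" if "\<chi> \<in> Y" "r \<chi> \<noteq> 1" for \<chi>
    using card_V_ge[OF R, of \<chi>] that by (auto simp: Y_def r_def)
  \<comment> \<open>Faithfulness of the elementary abelian group of the \<open>z\<^sub>S\<close> forces at least \<open>m\<close> characters.\<close>
  have "card (Pow {..<m}) \<le> card (Pow Y)"
  proof (rule card_inj_on_le)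
    show "inj_on (\<lambda>S. {\<chi> \<in> Y. odd (card (S \<inter> \<chi>))}) (Pow {..<m})"
    proof (rule inj_onI)
      fix S T assume ST: "S \<in> Pow {..<m}" "T \<in> Pow {..<m}"
        and eq: "{\<chi> \<in> Y. odd (card (S \<inter> \<chi>))} = {\<chi> \<in> Y. odd (card (T \<inter> \<chi>))}"
      have fST: "finite S" "finite T" using ST finite_subset[OF _ finite_lessThan] by auto
      have "zz S = zz T"
      proof (rule agree_on_V[OF zz_Sp zz_Sp])
        fix \<chi> x assume \<chi>: "\<chi> \<subseteq> {..<m}" and x: "x \<in> V ?E m \<chi>"
        have e: "\<alpha> (zz S) x = (if even (card (S \<inter> \<chi>)) then x else inv x)"
             "\<alpha> (zz T) x = (if even (card (T \<inter> \<chi>)) then x else inv x)"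
          using zz_on_V fST ST x by auto
        show "\<alpha> (zz S) x = \<alpha> (zz T) x"
        proof (cases "\<chi> \<in> Y")
          case True
          then show ?thesis using e eq by auto
        next
          case False
          show ?thesis
          proof (cases "\<chi> = {}")
            case True
            then show ?thesis using e by simp
          next
            case ne: False
            then have "card (V ?E m \<chi>) = 1" using False \<chi> by (auto simp: Y_def c_def)
            then obtain z where "V ?E m \<chi> = {z}" by (auto simp: card_1_singleton_iff)
            moreover have "\<one> \<in> V ?E m \<chi>" using subgroup.one_closed[OF V_subgroup[OF inv_subgroup_carrier]] .
            ultimately have "x = \<one>" using x by auto
            then show ?thesis using e by simp
          qed
        qed
      qed
      then show "S = T" using zz_inj ST by auto
    qed
  qed (use finY in auto)
  then have "(2::nat) ^ m \<le> 2 ^ card Y" using finY by (simp add: card_Pow)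
  then have mY: "m \<le> card Y" by simp
  \<comment> \<open>From here on a squeeze: p^(2m) is c {} times the product over Y, which is at
    least p^(2 |Y|), which is at least p^(2m). So all of these inequalities are equalities.\<close>
  have "c {} * (\<Prod>\<chi>\<in>Y. c \<chi>) = (\<Prod>\<chi>\<in>insert {} Y. c \<chi>)"
    using finY by (subst prod.insert) (auto simp: Y_def)
  also have "\<dots> = (\<Prod>\<chi>\<in>Pow {..<m}. c \<chi>)"
    by (rule prod.mono_neutral_left) (auto simp: Y_def)
  finally have cY: "c {} * (\<Prod>\<chi>\<in>Y. c \<chi>) = p ^ (2 * m)" using prodc by simp
  have "(\<Prod>\<chi>\<in>Y. p ^ 2) \<le> (\<Prod>\<chi>\<in>Y. c \<chi>)" by (rule prod_mono) (use Yge in auto)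
  then have pY: "p ^ (2 * card Y) \<le> (\<Prod>\<chi>\<in>Y. c \<chi>)" by (simp add: power_mult)
  have "p ^ (2 * m) \<le> p ^ (2 * card Y)" using mY p0 by (intro power_increasing) auto
  then have ge: "p ^ (2 * m) \<le> (\<Prod>\<chi>\<in>Y. c \<chi>)" using pY by linarith
  have "p ^ (2 * m) > 0" using p0 by simp
  have c0: "c {} = 1"
  proof (rule ccontr)
    assume "c {} \<noteq> 1"
    then have "2 \<le> c {}" using c_pos[of "{}"] by linarith
    then have "2 * (\<Prod>\<chi>\<in>Y. c \<chi>) \<le> p ^ (2 * m)" using cY by (metis mult_le_mono1)
    then show False using ge \<open>p ^ (2 * m) > 0\<close> by linarith
  qed
  then have prodY: "(\<Prod>\<chi>\<in>Y. c \<chi>) = p ^ (2 * m)" using cY by simp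
  then have "p ^ (2 * card Y) \<le> p ^ (2 * m)" using pY by simp
  then have "2 * card Y \<le> 2 * m" using p0 power_le_imp_le_exp by blast
  then have cardY: "card Y = m" using mY by simp
  have c2: "c \<chi> = p ^ 2" if \<chi>: "\<chi> \<in> Y" for \<chi>
  proof (rule antisym)
    have m0: "m = Suc (card (Y - {\<chi>}))" using cardY finY \<chi> by (metis card_Suc_Diff1)
    have "(\<Prod>\<psi>\<in>Y - {\<chi>}. p ^ 2) \<le> (\<Prod>\<psi>\<in>Y - {\<chi>}. c \<psi>)" by (rule prod_mono) (use Yge in auto)
    then have "c \<chi> * p ^ (2 * (m - 1)) \<le> c \<chi> * (\<Prod>\<psi>\<in>Y - {\<chi>}. c \<psi>)"
      using m0 by (intro mult_left_mono) (auto simp: power_mult)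
    also have "\<dots> = p ^ (2 * m)" using prod.remove[OF finY \<chi>, of c] prodY by simp
    also have "\<dots> = p ^ 2 * p ^ (2 * (m - 1))" using m0 by (simp flip: power_add)
    finally show "c \<chi> \<le> p ^ 2" using p0 by simp
  qed (rule Yge[OF \<chi>])
  \<comment> \<open>A subgroup of order at least p^2 inside a group of order p^2 is the whole
    group.\<close>
  have r_alt: "r \<chi> = 1 \<or> r \<chi> = c \<chi>" if "\<chi> \<in> Y" for \<chi>
    using Yr[OF that] c2[OF that] r_le[of \<chi>] by linarith
  have out: "c \<chi> = 1" "r \<chi> = 1" if "\<chi> \<subseteq> {..<m}" "\<chi> \<notin> Y" for \<chi>
  proof -
    show "c \<chi> = 1" using that c0 by (auto simp: Y_def)
    then show "r \<chi> = 1" using r_le[of \<chi>] r_pos[of \<chi>] by linarith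
  qed
  \<comment> \<open>\<open>Y1\<close> collects the eigenspaces lying in R, \<open>Y2\<close> those
    meeting R trivially. Both are nonempty when R is proper and nontrivial.\<close>
  define Y1 where "Y1 = {\<chi> \<in> Y. r \<chi> \<noteq> 1}"
  define Y2 where "Y2 = {\<chi> \<in> Y. r \<chi> = 1}"
  have Y12: "Y1 \<subseteq> Y" "Y2 \<subseteq> Y" "Y1 \<inter> Y2 = {}" by (auto simp: Y1_def Y2_def)
  have Y1: "Y1 \<noteq> {}"
  proof
    assume "Y1 = {}"
    then have "card R = 1" unfolding prodr using out by (intro prod.neutral) (auto simp: Y1_def)
    then obtain z where "R = {z}" by (auto simp: card_1_singleton_iff)
    then show False using neg subgroup.one_closed[OF Rs] by auto
  qed
  have Y2: "Y2 \<noteq> {}"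
  proof
    assume e: "Y2 = {}"
    have "card R = (\<Prod>\<chi>\<in>Pow {..<m}. c \<chi>)" unfolding prodr
    proof (intro prod.cong refl)
      fix \<chi> assume "\<chi> \<in> Pow {..<m}"
      then show "r \<chi> = c \<chi>" using out[of \<chi>] r_alt[of \<chi>] e by (cases "\<chi> \<in> Y") (auto simp: Y2_def)
    qed
    then have "card R = card ?E" using prodc cardG by simp
    then have "R = ?E" using card_subset_eq[OF fin Rsub] by simp
    then show False using neg by simp
  qed
  \<comment> \<open>A part containing a nonempty proper set of planes contains all sets of that
    size, at least m = |Y| of them, and so exhausts Y, leaving the other part empty. Hence both
    parts consist of the full set of planes alone, yet they are disjoint.\<close>
  have full: "Z \<subseteq> {{..<m}}" if Z: "Z = Y1 \<or> Z = Y2" for Z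
  proof
    fix \<chi> assume \<chi>: "\<chi> \<in> Z"
    then have \<chi>Y: "\<chi> \<in> Y" "\<chi> \<subseteq> {..<m}" "\<chi> \<noteq> {}" using Z Y12 by (auto simp: Y_def)
    have f\<chi>: "finite \<chi>" using \<chi>Y(2) finite_subset by blast
    show "\<chi> \<in> {{..<m}}"
    proof (rule ccontr)
      assume "\<chi> \<notin> {{..<m}}"
      then have "\<chi> \<subset> {..<m}" using \<chi>Y by auto
      then have lt: "card \<chi> < m" using psubset_card_mono[of "{..<m}" \<chi>] by simp
      have gt: "0 < card \<chi>" using f\<chi> \<chi>Y by (simp add: card_gt_0_iff)
      have "{\<psi>. \<psi> \<subseteq> {..<m} \<and> card \<psi> = card \<chi>} \<subseteq> Z"
      proof clarify
        fix \<psi> assume \<psi>: "\<psi> \<subseteq> {..<m}" "card \<psi> = card \<chi>"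
        have "c \<psi> = c \<chi>" "r \<psi> = r \<chi>"
          using card_V_eq[OF inv_subgroup_carrier \<psi>(1) \<chi>Y(2) \<psi>(2)] card_V_eq[OF R \<psi>(1) \<chi>Y(2) \<psi>(2)]
          by (auto simp: c_def r_def)
        moreover have "\<psi> \<noteq> {}" using gt \<psi> by auto
        ultimately have "\<psi> \<in> Y" using \<chi>Y \<psi> by (auto simp: Y_def)
        then show "\<psi> \<in> Z" using \<open>r \<psi> = r \<chi>\<close> \<chi> Z by (auto simp: Y1_def Y2_def)
      qed
      moreover have "finite Z" using Z Y12 finY finite_subset by blast
      ultimately have "card {\<psi>. \<psi> \<subseteq> {..<m} \<and> card \<psi> = card \<chi>} \<le> card Z" by (intro card_mono)
      then have "m choose card \<chi> \<le> card Z" using n_subsets[of "{..<m}" "card \<chi>"] by simp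
      then have "card Y \<le> card Z" using choose_ge_self[OF gt lt] cardY by linarith
      moreover have "Z \<subseteq> Y" using Z Y12 by blast
      ultimately have "Z = Y" using card_seteq[OF finY] by blast
      then show False using Z Y12 Y1 Y2 by auto
    qed
  qed
  have "Y1 = {{..<m}}" "Y2 = {{..<m}}" using full[of Y1] full[of Y2] Y1 Y2 by auto
  then show False using Y12 by auto
qed

end

section \<open>Normalisers and conjugate idempotents\<close>

lemma (in group) normalizer_iff:
  assumes "E \<subseteq> carrier G"
  shows "g \<in> normalizer G E \<longleftrightarrow> g \<in> carrier G \<and> (\<lambda>x. g \<otimes> x \<otimes> inv g) ` E = E"
proof -
  have "g <# E #> inv g = (\<lambda>x. g \<otimes> x \<otimes> inv g) ` E"
    by (auto simp: l_coset_def r_coset_def)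
  then show ?thesis using assms by (auto simp: normalizer_def stabilizer_def)
qed

lemma (in group) inv_mult_cancel:
  "g \<in> carrier G \<Longrightarrow> x \<in> carrier G \<Longrightarrow> inv g \<otimes> (g \<otimes> x) = x"
  by (simp flip: m_assoc)

lemma (in group) conj_mult:
  assumes "g \<in> carrier G" "x \<in> carrier G" "y \<in> carrier G"
  shows "g \<otimes> (x \<otimes> y) \<otimes> inv g = (g \<otimes> x \<otimes> inv g) \<otimes> (g \<otimes> y \<otimes> inv g)"
proof -
  have "(g \<otimes> x \<otimes> inv g) \<otimes> (g \<otimes> y \<otimes> inv g) = g \<otimes> x \<otimes> ((inv g \<otimes> g) \<otimes> y \<otimes> inv g)"
    using assms by (simp add: m_assoc inv_mult_cancel)
  then show ?thesis using assms by (simp add: m_assoc inv_mult_cancel)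
qed

lemma (in group) conj_conj:
  assumes "g \<in> carrier G" "h \<in> carrier G" "x \<in> carrier G"
  shows "g \<otimes> (h \<otimes> x \<otimes> inv h) \<otimes> inv g = (g \<otimes> h) \<otimes> x \<otimes> inv (g \<otimes> h)"
  using assms by (simp add: inv_mult_group m_assoc)

lemma (in group) conj_eq_iff:
  assumes "g \<in> carrier G" "x \<in> carrier G" "y \<in> carrier G"
  shows "g \<otimes> x \<otimes> inv g = y \<longleftrightarrow> g \<otimes> x = y \<otimes> g"
  using assms by (metis inv_closed m_assoc m_closed r_inv r_one l_inv)

lemma (in group) conj_inj:
  assumes "g \<in> carrier G" "x \<in> carrier G" "y \<in> carrier G" "g \<otimes> x \<otimes> inv g = g \<otimes> y \<otimes> inv g"
  shows "x = y"
  using assms by simp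

lemma (in group) centralizer_iff:
  assumes "E \<subseteq> carrier G"
  shows "g \<in> centralizer G E \<longleftrightarrow> g \<in> carrier G \<and> (\<forall>x\<in>E. g \<otimes> x \<otimes> inv g = x)"
  using assms conj_eq_iff by (auto simp: centralizer_def subset_iff)

lemma (in group) centralizer_normal:
  assumes E: "E \<subseteq> carrier G"
  shows "centralizer G E \<lhd> G\<lparr>carrier := normalizer G E\<rparr>"
proof -
  let ?N = "normalizer G E" and ?C = "centralizer G E"
  have Ns: "subgroup ?N G" using normalizer_imp_subgroup[OF E] .
  interpret N: group "G\<lparr>carrier := ?N\<rparr>" using Ns by (rule subgroup_imp_group)
  have Ec: "x \<in> carrier G" if "x \<in> E" for x using that E by auto
  have Cc: "g \<in> carrier G" if "g \<in> ?C" for g using that by (simp add: centralizer_def)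
  have Csub: "subgroup ?C G"
  proof (rule subgroupI)
    show "?C \<subseteq> carrier G" by (auto simp: centralizer_def)
    have "\<one> \<in> ?C" using Ec by (auto simp: centralizer_def)
    then show "?C \<noteq> {}" by auto
    show "inv g \<in> ?C" if g: "g \<in> ?C" for g
    proof -
      have "inv g \<otimes> x = x \<otimes> inv g" if "x \<in> E" for x
      proof -
        have "g \<otimes> x \<otimes> inv g = x" using g that by (simp add: centralizer_iff[OF E])
        then have "inv g \<otimes> (g \<otimes> x \<otimes> inv g) = inv g \<otimes> x" by simp
        moreover have "inv g \<otimes> (g \<otimes> x \<otimes> inv g) = (inv g \<otimes> g) \<otimes> x \<otimes> inv g"
          using Cc[OF g] Ec[OF that] by (simp add: m_assoc inv_mult_cancel)
        ultimately show ?thesis using Cc[OF g] Ec[OF that] by simp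
      qed
      then show ?thesis using Cc[OF g] by (simp add: centralizer_def)
    qed
    show "g \<otimes> h \<in> ?C" if "g \<in> ?C" "h \<in> ?C" for g h
    proof -
      have "(g \<otimes> h) \<otimes> x \<otimes> inv (g \<otimes> h) = x" if "x \<in> E" for x
        using conj_conj[of g h x] that \<open>g \<in> ?C\<close> \<open>h \<in> ?C\<close> Ec by (simp add: centralizer_iff[OF E])
      then show ?thesis using that Cc by (simp add: centralizer_iff[OF E])
    qed
  qed
  have CN: "?C \<subseteq> ?N"
  proof
    fix g assume "g \<in> ?C"
    then have "g \<in> carrier G" "\<forall>x\<in>E. g \<otimes> x \<otimes> inv g = x" by (auto simp: centralizer_iff[OF E])
    then show "g \<in> ?N" by (simp add: normalizer_iff[OF E])
  qed
  have "subgroup ?C (G\<lparr>carrier := ?N\<rparr>)" using subgroup_incl[OF Csub Ns CN] .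
  moreover have "g \<otimes> c \<otimes> inv\<^bsub>G\<lparr>carrier := ?N\<rparr>\<^esub> g \<in> ?C" if g: "g \<in> ?N" and c: "c \<in> ?C" for g c
  proof -
    have gc: "g \<in> carrier G" and im: "(\<lambda>x. g \<otimes> x \<otimes> inv g) ` E = E" using g by (auto simp: normalizer_iff[OF E])
    have "(g \<otimes> c \<otimes> inv g) \<otimes> x \<otimes> inv (g \<otimes> c \<otimes> inv g) = x" if "x \<in> E" for x
    proof -
      have "x \<in> (\<lambda>x. g \<otimes> x \<otimes> inv g) ` E" using that im by simp
      then obtain y where y: "y \<in> E" "x = g \<otimes> y \<otimes> inv g" by (elim imageE)
      have "(g \<otimes> c \<otimes> inv g) \<otimes> x = g \<otimes> c \<otimes> (inv g \<otimes> g) \<otimes> y \<otimes> inv g"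
        using gc Cc[OF c] Ec[OF y(1)] y(2) by (simp add: m_assoc inv_mult_cancel)
      also have "\<dots> = g \<otimes> (c \<otimes> y) \<otimes> inv g" using gc Cc[OF c] Ec[OF y(1)] by (simp add: m_assoc)
      also have "c \<otimes> y = y \<otimes> c" using c y by (simp add: centralizer_def)
      also have "g \<otimes> (y \<otimes> c) \<otimes> inv g = x \<otimes> (g \<otimes> c \<otimes> inv g)"
        unfolding y(2) using gc Cc[OF c] Ec[OF y(1)] by (rule_tac conj_mult) auto
      finally show ?thesis using gc Cc[OF c] Ec[OF that] by (subst conj_eq_iff) auto
    qed
    then show ?thesis using gc Cc[OF c] m_inv_consistent[OF Ns g] by (simp add: centralizer_iff[OF E])
  qed
  ultimately show ?thesis unfolding N.normal_inv_iff by auto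
qed

text \<open>The abstract isomorphism becomes an action of Sp on E: conjugation by chosen coset
  representatives. Two representatives of one coset differ by the centraliser, so the choice is
  immaterial on E; and elements acting equally on E lie in the same coset, which gives
  faithfulness.\<close>

lemma (in group) sp_quotient_irreducible:
  assumes ea: "elem_abelian_subgroup G E p (2 * m)" and p: "prime p" "odd p" "card (UNIV :: 'g::{finite,field} set) = p"
    and iso: "(G\<lparr>carrier := normalizer G E\<rparr>) Mod (centralizer G E) \<cong> (Sp m :: 'g mat monoid)"
    and R: "subgroup R G" "R \<subseteq> E" "\<And>g x. g \<in> normalizer G E \<Longrightarrow> x \<in> R \<Longrightarrow> g \<otimes> x \<otimes> inv g \<in> R"
  shows "R = {\<one>} \<or> R = E"
proof -
  let ?N = "normalizer G E" and ?C = "centralizer G E"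
  let ?GN = "G\<lparr>carrier := ?N\<rparr>"
  have Es: "subgroup E G" using ea by (simp add: elem_abelian_subgroup_def)
  then have E: "E \<subseteq> carrier G" by (rule subgroup.subset)
  have Ec: "x \<in> carrier G" if "x \<in> E" for x using that E by auto
  have Ns: "subgroup ?N G" using normalizer_imp_subgroup[OF E] .
  have Nc: "g \<in> carrier G" if "g \<in> ?N" for g using that by (simp add: normalizer_iff[OF E])
  have NE: "g \<otimes> x \<otimes> inv g \<in> E" if "g \<in> ?N" "x \<in> E" for g x using that by (auto simp: normalizer_iff[OF E])
  interpret CN: normal ?C ?GN by (rule centralizer_normal[OF E])
  have Csub: "subgroup ?C G" using incl_subgroup[OF Ns CN.subgroup_axioms] .
  have rc: "?C #>\<^bsub>?GN\<^esub> g = ?C #> g" for g by (simp add: r_coset_def)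
  obtain h where h: "h \<in> iso (?GN Mod ?C) (Sp m :: 'g mat monoid)" using iso by (auto simp: is_iso_def)
  then have hom: "h \<in> hom (?GN Mod ?C) (Sp m)" and bij: "bij_betw h (carrier (?GN Mod ?C)) (carrier (Sp m))"
    by (auto simp: iso_def)
  have car: "carrier (?GN Mod ?C) = (\<lambda>g. ?C #> g) ` ?N"
    by (auto simp: FactGroup_def RCOSETS_def rc)
  have "\<exists>g\<in>?N. h (?C #> g) = s" if "s \<in> carrier (Sp m)" for s
    using bij that unfolding bij_betw_def car by (metis (no_types, lifting) imageE)
  then obtain \<nu> where nu: "\<And>s. s \<in> carrier (Sp m) \<Longrightarrow> \<nu> s \<in> ?N \<and> h (?C #> \<nu> s) = s" by metis
  have nuc: "\<nu> s \<in> carrier G" if "s \<in> carrier (Sp m)" for s using nu[OF that] Nc by blast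
  have hmult: "h (?C #> (a \<otimes> b)) = h (?C #> a) * h (?C #> b)" if "a \<in> ?N" "b \<in> ?N" for a b
    using hom_mult[OF hom, of "?C #> a" "?C #> b"] that car CN.rcos_sum[of a b] by (simp add: rc set_mult_def)
  have hinj: "?C #> a = ?C #> b" if "a \<in> ?N" "b \<in> ?N" "h (?C #> a) = h (?C #> b)" for a b
    using bij that unfolding bij_betw_def car inj_on_def by blast
  have same: "a \<otimes> x \<otimes> inv a = b \<otimes> x \<otimes> inv b" if ab: "a \<in> ?N" "b \<in> ?N" "?C #> a = ?C #> b" and x: "x \<in> E" for a b x
  proof -
    have "a \<in> ?C #> b" using rcos_self[OF Nc[OF ab(1)] Csub] ab(3) by simp
    then obtain c where c: "c \<in> ?C" "a = c \<otimes> b" by (auto simp: r_coset_def)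
    then have "a \<otimes> x \<otimes> inv a = c \<otimes> (b \<otimes> x \<otimes> inv b) \<otimes> inv c"
      using conj_conj[of c b x] Nc[OF ab(2)] Ec[OF x] by (simp add: centralizer_iff[OF E])
    also have "\<dots> = b \<otimes> x \<otimes> inv b" using c NE[OF ab(2) x] by (simp add: centralizer_iff[OF E])
    finally show ?thesis .
  qed
  define \<alpha> where "\<alpha> s x = \<nu> s \<otimes> x \<otimes> inv (\<nu> s)" for s x
  \<comment> \<open>Closure of Sp under products is transported through \<open>h\<close> from
    closure of the normaliser.\<close>
  have Spm: "s * t \<in> carrier (Sp m)" if "s \<in> carrier (Sp m :: 'g mat monoid)" "t \<in> carrier (Sp m)" for s t
  proof -
    have "\<nu> s \<otimes> \<nu> t \<in> ?N" using nu that subgroup.m_closed[OF Ns] by blast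
    then have "h (?C #> (\<nu> s \<otimes> \<nu> t)) \<in> carrier (Sp m)" using bij unfolding bij_betw_def car by blast
    then show ?thesis using hmult nu that by metis
  qed
  have amult: "\<alpha> (s * t) x = \<alpha> s (\<alpha> t x)" if st: "s \<in> carrier (Sp m)" "t \<in> carrier (Sp m)" and x: "x \<in> E" for s t x
  proof -
    have N: "\<nu> s \<otimes> \<nu> t \<in> ?N" using nu st subgroup.m_closed[OF Ns] by blast
    have "h (?C #> (\<nu> s \<otimes> \<nu> t)) = h (?C #> \<nu> (s * t))" using hmult nu st Spm by metis
    then have "?C #> (\<nu> s \<otimes> \<nu> t) = ?C #> \<nu> (s * t)" using hinj N nu[OF Spm[OF st]] by blast
    then have "\<nu> (s * t) \<otimes> x \<otimes> inv (\<nu> (s * t)) = (\<nu> s \<otimes> \<nu> t) \<otimes> x \<otimes> inv (\<nu> s \<otimes> \<nu> t)"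
      using same N nu[OF Spm[OF st]] x by metis
    then show ?thesis using conj_conj[of "\<nu> s" "\<nu> t" x] nuc st Ec[OF x] by (simp add: \<alpha>_def)
  qed
  have one: "1\<^sub>m (2 * m) \<in> carrier (Sp m :: 'g mat monoid)"
    unfolding dblk_one[symmetric] by (rule dblk_Sp) simp
  have aE: "\<alpha> s x \<in> E" if "s \<in> carrier (Sp m)" "x \<in> E" for s x
    using nu[OF that(1)] NE that(2) by (simp add: \<alpha>_def)
  interpret cg: comm_group "G\<lparr>carrier := E\<rparr>"
    using ea subgroup_imp_group[OF Es] unfolding elem_abelian_subgroup_def
    by (intro group.group_comm_groupI) auto
  interpret sp: sp_action "G\<lparr>carrier := E\<rparr>" p m \<alpha>
  proof
    show "prime p" "odd p" "card (UNIV :: 'g set) = p" by fact+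
    show "finite (carrier (G\<lparr>carrier := E\<rparr>))" "card (carrier (G\<lparr>carrier := E\<rparr>)) = p ^ (2 * m)"
      using ea by (auto simp: elem_abelian_subgroup_def)
    show "x [^]\<^bsub>G\<lparr>carrier := E\<rparr>\<^esub> p = \<one>\<^bsub>G\<lparr>carrier := E\<rparr>\<^esub>" if "x \<in> carrier (G\<lparr>carrier := E\<rparr>)" for x
      using ea that by (auto simp: elem_abelian_subgroup_def nat_pow_consistent[symmetric])
    fix s t :: "'g mat" and x y
    assume s: "s \<in> carrier (Sp m)"
    show "\<alpha> s x \<in> carrier (G\<lparr>carrier := E\<rparr>)" if "x \<in> carrier (G\<lparr>carrier := E\<rparr>)" using aE s that by simp
    show "\<alpha> s (x \<otimes>\<^bsub>G\<lparr>carrier := E\<rparr>\<^esub> y) = \<alpha> s x \<otimes>\<^bsub>G\<lparr>carrier := E\<rparr>\<^esub> \<alpha> s y"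
      if "x \<in> carrier (G\<lparr>carrier := E\<rparr>)" "y \<in> carrier (G\<lparr>carrier := E\<rparr>)"
      using that conj_mult[OF nuc[OF s]] Ec by (simp add: \<alpha>_def)
    assume t: "t \<in> carrier (Sp m)"
    show "\<alpha> (s * t) x = \<alpha> s (\<alpha> t x)" if "x \<in> carrier (G\<lparr>carrier := E\<rparr>)" using amult s t that by simp
    show "s = t" if eq: "\<And>x. x \<in> carrier (G\<lparr>carrier := E\<rparr>) \<Longrightarrow> \<alpha> s x = \<alpha> t x"
    proof -
      let ?g = "\<nu> s" and ?k = "\<nu> t"
      have g: "?g \<in> carrier G" "?k \<in> carrier G" using nuc s t by auto
      have "?g \<otimes> inv ?k \<in> ?C"
        unfolding centralizer_iff[OF E]
      proof (intro conjI ballI)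
        fix z assume z: "z \<in> E"
        have ik: "inv ?k \<in> ?N" using nu[OF t] subgroup.m_inv_closed[OF Ns] by blast
        define y where "y = inv ?k \<otimes> z \<otimes> inv (inv ?k)"
        have y: "y \<in> E" using NE[OF ik z] by (simp add: y_def)
        have "?k \<otimes> y \<otimes> inv ?k = z"
          unfolding y_def using conj_conj[of ?k "inv ?k" z] g Ec[OF z] by simp
        then have "?g \<otimes> y \<otimes> inv ?g = z" using eq[of y] y by (simp add: \<alpha>_def)
        then show "?g \<otimes> inv ?k \<otimes> z \<otimes> inv (?g \<otimes> inv ?k) = z"
          unfolding y_def using conj_conj[of ?g "inv ?k" z] g Ec[OF z] by simp
      qed (use g in auto)
      then have "?g \<in> ?C #> ?k" using g by (auto simp: r_coset_def m_assoc intro!: bexI[of _ "?g \<otimes> inv ?k"])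
      then have "?C #> ?k = ?C #> ?g" using repr_independence g Csub by blast
      then show "s = t" using nu[OF s] nu[OF t] by metis
    qed
  next
    fix x assume "x \<in> carrier (G\<lparr>carrier := E\<rparr>)"
    then have x: "x \<in> E" by simp
    \<comment> \<open>The representative of the identity matrix need not be the identity of the
      group; but its action is idempotent and, being a conjugation, injective, hence
      trivial.\<close>
    have "\<alpha> (1\<^sub>m (2 * m) * 1\<^sub>m (2 * m)) x = \<alpha> (1\<^sub>m (2 * m)) (\<alpha> (1\<^sub>m (2 * m)) x)" by (rule amult[OF one one x])
    then have "\<alpha> (1\<^sub>m (2 * m)) x = \<alpha> (1\<^sub>m (2 * m)) (\<alpha> (1\<^sub>m (2 * m)) x)" by simp
    then have "x = \<alpha> (1\<^sub>m (2 * m)) x"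
      unfolding \<alpha>_def[of _ x] \<alpha>_def[of _ "\<alpha> _ x"]
      using conj_inj[OF nuc[OF one] Ec[OF x]] Ec[OF aE[OF one x]] by (simp add: \<alpha>_def)
    then show "\<alpha> (1\<^sub>m (2 * m)) x = x" by simp
  qed
  have "sp.inv_subgroup R"
    unfolding sp.inv_subgroup_def using R subgroup_incl[OF R(1) Es R(2)] nu by (simp add: \<alpha>_def del: Sp_simps)
  from sp.no_invariant_subgroup[OF this] show ?thesis by simp
qed

text \<open>If Q has rank a, its conjugates are orthogonal idempotents of rank a with sum 1, so N =
  r * a. Concretely, with Q = U W, the blocks \<open>D i * U\<close> placed side by side and the
  blocks \<open>W * D' i\<close> stacked are mutually inverse matrices of sizes N by r * a and r * a
  by N.\<close>

lemma conjugate_idempotents_dvd: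
  fixes Q :: "'a::field mat"
  assumes Q: "Q \<in> carrier_mat N N" "Q * Q = Q"
    and D: "\<And>i. i < r \<Longrightarrow> D i \<in> carrier_mat N N" "\<And>i. i < r \<Longrightarrow> D' i \<in> carrier_mat N N"
      "\<And>i. i < r \<Longrightarrow> D' i * D i = 1\<^sub>m N"
    and sum: "msum N {..<r} (\<lambda>i. D i * Q * D' i) = 1\<^sub>m N"
    and orth: "\<And>i j. i < r \<Longrightarrow> j < r \<Longrightarrow> i \<noteq> j \<Longrightarrow> (D i * Q * D' i) * (D j * Q * D' j) = 0\<^sub>m N N"
  shows "r dvd N"
proof -
  \<comment> \<open>The family to be diagonalised is empty: only the rank factorisation of \<open>Q\<close> is used.\<close>
  have "\<exists>a U W (d :: nat \<Rightarrow> nat \<Rightarrow> 'a). U \<in> carrier_mat N a \<and> W \<in> carrier_mat a N \<and> W * U = 1\<^sub>m a \<and> U * W = Q \<and>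
     (\<forall>x\<in>{}. \<forall>i<N. \<forall>j<a. (undefined x * U) $$ (i, j) = d x j * U $$ (i, j))"
    by (rule simultaneous_factorization[where p = 1 and \<omega> = 1]) (use Q in auto)
  then obtain a U W where U: "U \<in> carrier_mat N a" and W: "W \<in> carrier_mat a N"
    and WU: "W * U = 1\<^sub>m a" and UW: "U * W = Q" by blast
  have QU: "Q * U = U" using assoc_mult_mat[OF U W U] WU UW U by simp
  have WQ: "W * Q = W" using assoc_mult_mat[OF W U W] WU UW W by simp
  note ac = assoc_mult_mat[of _ N N _ N _ N] mult_carrier_mat[of _ N N _ N]
  define G where "G = mat N (r * a) (\<lambda>(i, j). (D (j div a) * U) $$ (i, j mod a))"
  define H where "H = mat (r * a) N (\<lambda>(i, j). (W * D' (i div a)) $$ (i mod a, j))"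
  have Gc: "G \<in> carrier_mat N (r * a)" and Hc: "H \<in> carrier_mat (r * a) N" by (auto simp: G_def H_def)
  have Gi: "G $$ (i, t * a + s) = (D t * U) $$ (i, s)" if "i < N" "t < r" "s < a" for i t s
    using that by (simp add: G_def pair_index_less del: index_mult_mat)
  have Hi: "H $$ (t * a + s, i) = (W * D' t) $$ (s, i)" if "i < N" "t < r" "s < a" for i t s
    using that by (simp add: H_def pair_index_less del: index_mult_mat)
  have "G * H = 1\<^sub>m N"
  proof (rule eq_matI)
    fix i j assume "i < dim_row (1\<^sub>m N)" "j < dim_col (1\<^sub>m N)"
    then have ij: "i < N" "j < N" by auto
    have "(G * H) $$ (i, j) = (\<Sum>t<r. \<Sum>s<a. G $$ (i, t * a + s) * H $$ (t * a + s, j))"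
      using index_mult_mat_sum[OF Gc Hc ij] by (simp add: sum_lessThan_mult)
    also have "\<dots> = (\<Sum>t<r. \<Sum>s<a. (D t * U) $$ (i, s) * (W * D' t) $$ (s, j))"
      using ij by (intro sum.cong refl) (simp add: Gi Hi del: index_mult_mat)
    also have "\<dots> = (\<Sum>t<r. (D t * Q * D' t) $$ (i, j))"
    proof (intro sum.cong refl)
      fix t assume "t \<in> {..<r}"
      then have t: "t < r" by simp
      have DU: "D t * U \<in> carrier_mat N a" and WD: "W * D' t \<in> carrier_mat a N"
        using D(1)[OF t] D(2)[OF t] U W by auto
      have "D t * U * (W * D' t) = D t * (U * (W * D' t))" by (rule assoc_mult_mat[OF D(1)[OF t] U WD])
      also have "U * (W * D' t) = Q * D' t" using assoc_mult_mat[OF U W D(2)[OF t]] UW by simp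
      also have "D t * (Q * D' t) = D t * Q * D' t" using D(1)[OF t] D(2)[OF t] Q(1) by (simp add: ac)
      finally show "(\<Sum>s<a. (D t * U) $$ (i, s) * (W * D' t) $$ (s, j)) = (D t * Q * D' t) $$ (i, j)"
        using index_mult_mat_sum[OF DU WD ij] by simp
    qed
    also have "\<dots> = 1\<^sub>m N $$ (i, j)" using ij by (simp add: sum[symmetric] msum_index)
    finally show "(G * H) $$ (i, j) = 1\<^sub>m N $$ (i, j)" .
  qed (use Gc Hc in auto)
  then have 1: "N \<le> r * a" by (rule left_inverse_dim_le[OF Gc Hc])
  have "H * G = 1\<^sub>m (r * a)"
    unfolding kron_one[symmetric]
  proof (rule eq_mat_pairI[of _ r a r a])
    fix t u s v assume tu: "t < r" "u < r" and sv: "s < a" "v < a"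
    have WD: "W * D' t \<in> carrier_mat a N" and DU: "D u * U \<in> carrier_mat N a"
      using D(1)[OF tu(2)] D(2)[OF tu(1)] U W by auto
    have "(H * G) $$ (t * a + s, u * a + v) = (\<Sum>i<N. (W * D' t) $$ (s, i) * (D u * U) $$ (i, v))"
      using tu sv by (subst index_mult_mat_sum[OF Hc Gc]) (auto simp: Gi Hi pair_index_less simp del: index_mult_mat)
    also have "\<dots> = (W * D' t * (D u * U)) $$ (s, v)"
      using index_mult_mat_sum[OF WD DU sv] by simp
    also have "W * D' t * (D u * U) = W * (D' t * D u) * U"
      using assoc_mult_mat[OF WD D(1)[OF tu(2)] U] assoc_mult_mat[OF W D(2)[OF tu(1)] D(1)[OF tu(2)]] by simp
    also have "\<dots> = (if t = u then 1\<^sub>m a else 0\<^sub>m a a)"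
    proof (cases "t = u")
      case True
      then show ?thesis using D(3)[OF tu(2)] W WU by simp
    next
      case False
      note d = D(1)[OF tu(1)] D(2)[OF tu(1)] D(1)[OF tu(2)] D(2)[OF tu(2)]
      \<comment> \<open>Cancelling the outer invertible factors in the orthogonality relation leaves
        \<open>Q * (D' t * D u) * Q = 0\<close>, which the rank factorisation carries over to the
        off-diagonal blocks.\<close>
      have "D' t * ((D t * Q * D' t) * (D u * Q * D' u)) * D u = (D' t * D t) * Q * (D' t * D u) * Q * (D' u * D u)"
        using d Q(1) by (simp add: ac)
      also have "\<dots> = Q * (D' t * D u) * Q" using D(3)[OF tu(1)] D(3)[OF tu(2)] d Q(1) by (simp add: ac)
      finally have z: "Q * (D' t * D u) * Q = 0\<^sub>m N N"
        using orth[OF tu False] d by (simp add: left_mult_zero_mat[of _ N N] right_mult_zero_mat[of _ N N])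
      have X: "D' t * D u \<in> carrier_mat N N" using d by (simp add: ac)
      have "W * (D' t * D u) * U = W * Q * (D' t * D u) * (Q * U)" by (simp add: WQ QU)
      also have "\<dots> = W * (Q * (D' t * D u) * Q) * U"
      proof -
        have 1: "W * Q * (D' t * D u) = W * (Q * (D' t * D u))" by (rule assoc_mult_mat[OF W Q(1) X])
        have c: "Q * (D' t * D u) \<in> carrier_mat N N" using Q(1) X by (simp add: ac)
        have 2: "W * (Q * (D' t * D u)) * (Q * U) = W * (Q * (D' t * D u)) * Q * U"
          by (rule assoc_mult_mat[symmetric, OF mult_carrier_mat[OF W c] Q(1) U])
        have 3: "W * (Q * (D' t * D u)) * Q = W * (Q * (D' t * D u) * Q)" by (rule assoc_mult_mat[OF W c Q(1)])
        show ?thesis unfolding 1 2 3 ..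
      qed
      also have "\<dots> = 0\<^sub>m a a" unfolding z using W U by simp
      finally show ?thesis using False by simp
    qed
    also have "(if t = u then 1\<^sub>m a else 0\<^sub>m a a) $$ (s, v) = (1\<^sub>m r $$ (t, u) * 1\<^sub>m a $$ (s, v) :: 'a)"
      using tu sv by simp
    also have "\<dots> = kron (1\<^sub>m r) (1\<^sub>m a) $$ (t * a + s, u * a + v)"
      using tu sv by (intro kron_index[symmetric, of _ r r _ a a]) auto
    finally show "(H * G) $$ (t * a + s, u * a + v) = kron (1\<^sub>m r) (1\<^sub>m a) $$ (t * a + s, u * a + v)" .
  qed (use Gc Hc in auto)
  then have "r * a \<le> N" by (rule left_inverse_dim_le[OF Hc Gc])
  with 1 show ?thesis by simp
qed

text \<open>A root of 1 + X + ... + X^(p-1) is taken: it differs from 1 because p is nonzero in the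
  field, and primality of p makes its order exactly p.\<close>

lemma primitive_root_exists:
  fixes ty :: "'a::alg_closed_field itself"
  assumes "prime p" "of_nat p \<noteq> (0::'a)"
  obtains \<omega> :: 'a where "\<omega> ^ p = 1" "\<And>j. 0 < j \<Longrightarrow> j < p \<Longrightarrow> \<omega> ^ j \<noteq> 1"
proof -
  have p: "p > 1" using assms prime_gt_1_nat by blast
  obtain w :: 'a where w: "(\<Sum>k\<le>p - 1. 1 * w ^ k) = 0" using alg_closed[of "p - 1" "\<lambda>_. 1"] p by auto
  have "{..p - 1} = {..<p}" using p by auto
  then have s: "(\<Sum>k<p. w ^ k) = 0" using w by simp
  have w1: "w \<noteq> 1" using s assms(2) by auto
  have wp: "w ^ p = 1" using one_diff_power_eq[of w p] s by simp
  have "w ^ j \<noteq> 1" if j: "0 < j" "j < p" for j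
  proof
    assume wj: "w ^ j = 1"
    have "coprime j p" using assms(1) j by (metis coprime_commute nat_dvd_not_less prime_imp_coprime)
    then obtain u where u: "[j * u = 1] (mod p)" using cong_solve_coprime_nat by (metis One_nat_def)
    have "(j * u) mod p = 1" using u p by (simp add: cong_def)
    then have "j * u = p * ((j * u) div p) + 1" by (metis mult_div_mod_eq)
    then have "w ^ (j * u) = w" by (metis power_add power_mult wp power_one power_one_right mult_1)
    then show False using wj w1 by (simp add: power_mult)
  qed
  then show ?thesis using that wp by blast
qed

section \<open>The commutator pairing on an elementary abelian subgroup of PGU\<close>

text \<open>Used to compare commutation scalars. The bound on n excludes the 0 by 0 matrix, all of
  whose multiples coincide.\<close>

lemma smult_GL_inject:
  fixes A :: "'a::field mat"
  assumes "A \<in> carrier (GL n)" "n \<ge> 1" "c \<cdot>\<^sub>m A = d \<cdot>\<^sub>m A"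
  shows "c = d"
proof -
  obtain B where B: "B \<in> carrier (GL n)" "A * B = 1\<^sub>m n" using GL_obtain_inverse[OF assms(1)] by blast
  have "(c \<cdot>\<^sub>m A) * B = (d \<cdot>\<^sub>m A) * B" using assms by simp
  then have "c \<cdot>\<^sub>m 1\<^sub>m n = d \<cdot>\<^sub>m (1\<^sub>m n :: 'a mat)"
    using assms(1) B by (simp add: mult_smult_assoc_mat[of _ n n _ n])
  then have "(c \<cdot>\<^sub>m 1\<^sub>m n) $$ (0, 0) = (d \<cdot>\<^sub>m (1\<^sub>m n :: 'a mat)) $$ (0, 0)" by simp
  then show ?thesis using assms(2) by simp
qed

text \<open>Translation by \<open>a\<close> permutes the summands and multiplies the sum by
  \<open>f a\<close>.\<close>

lemma character_sum_zero:
  fixes f :: "'b \<Rightarrow> 'a::field"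
  assumes "group G" "finite (carrier G)"
    and f: "\<And>x y. x \<in> carrier G \<Longrightarrow> y \<in> carrier G \<Longrightarrow> f (x \<otimes>\<^bsub>G\<^esub> y) = f x * f y"
    and a: "a \<in> carrier G" "f a \<noteq> 1"
  shows "(\<Sum>x\<in>carrier G. f x) = 0"
proof -
  interpret group G by fact
  have "bij_betw (\<lambda>x. a \<otimes>\<^bsub>G\<^esub> x) (carrier G) (carrier G)"
    by (rule bij_betwI[where g = "\<lambda>x. inv\<^bsub>G\<^esub> a \<otimes>\<^bsub>G\<^esub> x"]) (use a in \<open>auto simp: m_assoc[symmetric]\<close>)
  then have "(\<Sum>x\<in>carrier G. f x) = (\<Sum>x\<in>carrier G. f (a \<otimes>\<^bsub>G\<^esub> x))"
    by (rule sum.reindex_bij_betw[symmetric])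
  also have "\<dots> = f a * (\<Sum>x\<in>carrier G. f x)" using f a by (simp add: sum_distrib_left)
  finally show ?thesis using a by (simp add: algebra_simps)
qed

locale elem_abelian_PGU = frobenius_power q ty for q and ty :: "'a::alg_closed_field itself" +
  fixes n p r :: nat and E :: "'a mat set set"
  assumes ea: "elem_abelian_subgroup (PGU q n) E p r" and p: "prime p" "of_nat p \<noteq> (0::'a)" and n: "n \<ge> 1"
begin

abbreviation "GU \<equiv> PGU q n :: 'a mat set monoid"

sublocale GU: group GU by (rule group_PGU)

lemma E_subgroup: "subgroup E GU" and E_comm: "x \<in> E \<Longrightarrow> y \<in> E \<Longrightarrow> x \<otimes>\<^bsub>GU\<^esub> y = y \<otimes>\<^bsub>GU\<^esub> x"
  and E_pow: "x \<in> E \<Longrightarrow> x [^]\<^bsub>GU\<^esub> p = \<one>\<^bsub>GU\<^esub>" and E_fin: "finite E" and E_card: "card E = p ^ r"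
  using ea by (auto simp: elem_abelian_subgroup_def)

lemma E_carrier: "x \<in> E \<Longrightarrow> x \<in> carrier GU" using subgroup.mem_carrier[OF E_subgroup] .
lemma E_mult: "x \<in> E \<Longrightarrow> y \<in> E \<Longrightarrow> x \<otimes>\<^bsub>GU\<^esub> y \<in> E" using subgroup.m_closed[OF E_subgroup] .
lemma E_inv: "x \<in> E \<Longrightarrow> inv\<^bsub>GU\<^esub> x \<in> E" using subgroup.m_inv_closed[OF E_subgroup] .
lemma E_one: "\<one>\<^bsub>GU\<^esub> \<in> E" using subgroup.one_closed[OF E_subgroup] .

definition M :: "'a mat set \<Rightarrow> 'a mat" where
  "M x = (SOME A. similitude q n A \<and> cl n A = x)"

lemma M: assumes "x \<in> carrier GU" shows "similitude q n (M x)" "cl n (M x) = x"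
proof -
  have "\<exists>A. similitude q n A \<and> cl n A = x" using assms by (auto simp: carrier_PGU)
  from someI_ex[OF this] show "similitude q n (M x)" "cl n (M x) = x" by (auto simp: M_def)
qed

lemma M_carrier: "x \<in> E \<Longrightarrow> M x \<in> carrier_mat n n" and M_GL: "x \<in> E \<Longrightarrow> M x \<in> carrier (GL n)"
  using M(1) E_carrier similitude_carrier similitude_GL by blast+

text \<open>The commutator scalar of the lifts. It exists because x and y commute modulo scalars,
  and by \<open>b_any\<close> it does not depend on the choice of the lifts.\<close>

definition b :: "'a mat set \<Rightarrow> 'a mat set \<Rightarrow> 'a" where
  "b x y = (SOME c. c \<noteq> 0 \<and> M x * M y = c \<cdot>\<^sub>m (M y * M x))"

lemmas ac = assoc_mult_mat[of _ n n _ n _ n] mult_carrier_mat[of _ n n _ n]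
lemmas sm = mult_smult_assoc_mat[of _ n n _ n] mult_smult_distrib[of _ n n _ n] smult_smult_mat

lemma b: assumes "x \<in> E" "y \<in> E" shows "b x y \<noteq> 0" "M x * M y = b x y \<cdot>\<^sub>m (M y * M x)"
proof -
  note x = M[OF E_carrier[OF assms(1)]] and y = M[OF E_carrier[OF assms(2)]]
  have "cl n (M x * M y) = cl n (M y * M x)"
    using E_comm[OF assms] PGU_mult[OF x(1) y(1)] PGU_mult[OF y(1) x(1)] x y by simp
  then have "\<exists>c. c \<noteq> 0 \<and> M x * M y = c \<cdot>\<^sub>m (M y * M x)"
    using M_carrier[OF assms(1)] M_carrier[OF assms(2)] by (subst (asm) cl_eq_iff) auto
  from someI_ex[OF this] show "b x y \<noteq> 0" "M x * M y = b x y \<cdot>\<^sub>m (M y * M x)" by (auto simp: b_def)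
qed

lemma b_any:
  assumes xy: "x \<in> E" "y \<in> E" and A: "A \<in> carrier_mat n n" "cl n A = x" and B: "B \<in> carrier_mat n n" "cl n B = y"
  shows "A * B = b x y \<cdot>\<^sub>m (B * A)"
proof -
  note x = M[OF E_carrier[OF xy(1)]] and y = M[OF E_carrier[OF xy(2)]]
  note c = M_carrier[OF xy(1)] M_carrier[OF xy(2)]
  obtain u where u: "A = u \<cdot>\<^sub>m M x" using cl_eq_iff[OF A(1) c(1)] A x by auto
  obtain v where v: "B = v \<cdot>\<^sub>m M y" using cl_eq_iff[OF B(1) c(2)] B y by auto
  show ?thesis unfolding u v using c b(2)[OF xy] by (simp add: sm mult_ac)
qed

text \<open>The means of computing \<open>b\<close>: its value may be read off from any convenient
  lifts of x and y.\<close>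

lemma b_unique:
  assumes xy: "x \<in> E" "y \<in> E" and A: "A \<in> carrier (GL n)" "cl n A = x" and B: "B \<in> carrier (GL n)" "cl n B = y"
    and eq: "A * B = c \<cdot>\<^sub>m (B * A)"
  shows "c = b x y"
proof -
  have "B * A \<in> carrier (GL n)" using A B by (auto simp: det_mult[of _ n])
  moreover have "c \<cdot>\<^sub>m (B * A) = b x y \<cdot>\<^sub>m (B * A)" using b_any[OF xy, of A B] A B eq by auto
  ultimately show ?thesis using smult_GL_inject n by blast
qed

lemma cl_M_mult: "x \<in> E \<Longrightarrow> y \<in> E \<Longrightarrow> cl n (M x * M y) = x \<otimes>\<^bsub>GU\<^esub> y"
  using PGU_mult M E_carrier by metis

lemma b_mult_left:
  assumes "x \<in> E" "y \<in> E" "z \<in> E"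
  shows "b (x \<otimes>\<^bsub>GU\<^esub> y) z = b x z * b y z"
proof (rule b_unique[symmetric])
  note c = M_carrier[OF assms(1)] M_carrier[OF assms(2)] M_carrier[OF assms(3)]
  show "M x * M y \<in> carrier (GL n)" using M_GL[OF assms(1)] M_GL[OF assms(2)] by (auto simp: det_mult[of _ n])
  show "cl n (M x * M y) = x \<otimes>\<^bsub>GU\<^esub> y" using cl_M_mult assms by blast
  have "M x * M y * M z = b y z \<cdot>\<^sub>m (M x * M z * M y)"
    using c b(2)[OF assms(2,3)] by (simp add: ac sm)
  also have "M x * M z * M y = b x z \<cdot>\<^sub>m (M z * (M x * M y))"
    using c b(2)[OF assms(1,3)] by (simp add: ac sm)
  finally show "M x * M y * M z = (b x z * b y z) \<cdot>\<^sub>m (M z * (M x * M y))"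
    by (simp add: smult_smult_mat mult.commute)
qed (use assms E_mult M_GL M E_carrier in auto)

lemma b_swap: assumes "x \<in> E" "y \<in> E" shows "b y x = inverse (b x y)"
proof (rule b_unique[symmetric, of y x "M y" "M x"])
  have "inverse (b x y) \<cdot>\<^sub>m (M x * M y) = M y * M x"
    unfolding b(2)[OF assms] using b(1)[OF assms] by (simp add: smult_smult_mat)
  then show "M y * M x = inverse (b x y) \<cdot>\<^sub>m (M x * M y)" by simp
qed (use assms M_GL M E_carrier in auto)

lemma b_mult_right:
  assumes "x \<in> E" "y \<in> E" "z \<in> E"
  shows "b x (y \<otimes>\<^bsub>GU\<^esub> z) = b x y * b x z"
  using b_swap[OF E_mult[OF assms(2,3)] assms(1)] b_mult_left[OF assms(2,3,1)]
    b_swap[OF assms(2,1)] b_swap[OF assms(3,1)] by simp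

lemma b_one_left: assumes "y \<in> E" shows "b \<one>\<^bsub>GU\<^esub> y = 1"
proof -
  have "b \<one>\<^bsub>GU\<^esub> y = b \<one>\<^bsub>GU\<^esub> y * b \<one>\<^bsub>GU\<^esub> y" using b_mult_left[OF E_one E_one assms] by simp
  then show ?thesis using b(1)[OF E_one assms] by simp
qed

lemma b_inv_right: assumes "x \<in> E" "y \<in> E" shows "b x (inv\<^bsub>GU\<^esub> y) = inverse (b x y)"
proof -
  have "b x y * b x (inv\<^bsub>GU\<^esub> y) = b x \<one>\<^bsub>GU\<^esub>"
    using b_mult_right[OF assms E_inv[OF assms(2)]] E_carrier[OF assms(2)] by simp
  also have "\<dots> = 1" using b_swap[OF E_one assms(1)] b_one_left[OF assms(1)] by simp
  finally show ?thesis using b(1)[OF assms] by (simp add: field_simps)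
qed

lemma b_inv_left: assumes "x \<in> E" "y \<in> E" shows "b (inv\<^bsub>GU\<^esub> x) y = inverse (b x y)"
  using b_inv_right[OF assms(2,1)] b_swap[OF assms] b_swap[OF assms(2) E_inv[OF assms(1)]] by simp

lemma b_pow_p: assumes "x \<in> E" "y \<in> E" shows "b x y ^ p = 1"
proof -
  have "x [^]\<^bsub>GU\<^esub> k \<in> E \<and> b (x [^]\<^bsub>GU\<^esub> k) y = b x y ^ k" for k :: nat
    by (induction k) (use assms E_one E_mult b_one_left b_mult_left in auto)
  then show ?thesis using E_pow[OF assms(1)] b_one_left[OF assms(2)] by metis
qed

text \<open>\<open>M x * M y\<close> and \<open>M y * M x\<close> have the same similitude factor,
  namely the product of the factors of the two lifts; but rescaling a matrix by b multiplies its
  factor by b^(q+1).\<close>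

lemma b_frobenius: assumes "x \<in> E" "y \<in> E" shows "b x y ^ (q + 1) = 1"
proof -
  note x = M[OF E_carrier[OF assms(1)]] and y = M[OF E_carrier[OF assms(2)]]
  note c = M_carrier[OF assms(1)] M_carrier[OF assms(2)]
  have "similitude q n (M y * M x)" using x y similitude_mult by blast
  then obtain d where d: "d \<noteq> 0" "transpose_mat (M y * M x) * frob_mat q (M y * M x) = d \<cdot>\<^sub>m 1\<^sub>m n"
    by (auto simp: similitude_def)
  obtain dx where dx: "transpose_mat (M x) * frob_mat q (M x) = dx \<cdot>\<^sub>m 1\<^sub>m n" using x by (auto simp: similitude_def)
  obtain dy where dy: "transpose_mat (M y) * frob_mat q (M y) = dy \<cdot>\<^sub>m 1\<^sub>m n" using y by (auto simp: similitude_def)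
  have prod: "transpose_mat (A * B) * frob_mat q (A * B) = (u * v) \<cdot>\<^sub>m 1\<^sub>m n"
    if "A \<in> carrier_mat n n" "B \<in> carrier_mat n n" "transpose_mat A * frob_mat q A = u \<cdot>\<^sub>m 1\<^sub>m n"
      "transpose_mat B * frob_mat q B = v \<cdot>\<^sub>m 1\<^sub>m n" for A B :: "'a mat" and u v
  proof -
    have "transpose_mat (A * B) * frob_mat q (A * B) = transpose_mat B * (transpose_mat A * frob_mat q A) * frob_mat q B"
      using that(1,2) by (simp add: transpose_mult[OF that(1,2)] frob_mat_mult[OF that(1,2)] ac)
    then show ?thesis using that by (simp add: scalar_mult_mat sm mult.commute)
  qed
  have 1: "(dy * dx) \<cdot>\<^sub>m 1\<^sub>m n = d \<cdot>\<^sub>m (1\<^sub>m n :: 'a mat)" using prod[OF c(2,1) dy dx] d by simp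
  have "(dx * dy) \<cdot>\<^sub>m 1\<^sub>m n = transpose_mat (M x * M y) * frob_mat q (M x * M y)"
    using prod[OF c dx dy] by simp
  also have "\<dots> = (b x y * b x y ^ q) \<cdot>\<^sub>m (transpose_mat (M y * M x) * frob_mat q (M y * M x))"
    unfolding b(2)[OF assms] using c by (simp add: transpose_smult frob_mat_smult sm ac mult_ac)
  also have "\<dots> = (b x y ^ (q + 1) * d) \<cdot>\<^sub>m 1\<^sub>m n" by (simp add: d smult_smult_mat)
  finally have "(b x y ^ (q + 1) * d) \<cdot>\<^sub>m 1\<^sub>m n = d \<cdot>\<^sub>m (1\<^sub>m n :: 'a mat)" using 1 by (simp add: mult.commute)
  then have "b x y ^ (q + 1) * d = d"
    by (intro smult_GL_inject[of "1\<^sub>m n" n]) (use n in auto)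
  then show ?thesis using d by simp
qed

definition rad :: "'a mat set set" where "rad = {x \<in> E. \<forall>y\<in>E. b x y = 1}"

lemma rad_subgroup: "subgroup rad GU"
proof (rule GU.subgroupI)
  show "rad \<subseteq> carrier GU" using E_carrier by (auto simp: rad_def)
  show "rad \<noteq> {}" using E_one b_one_left by (auto simp: rad_def)
qed (auto simp: rad_def E_inv b_inv_left E_mult b_mult_left)

text \<open>Conjugating both lifts by a lift of g leaves their commutator scalar unchanged, so the
  normaliser preserves the pairing and hence its radical.\<close>

lemma rad_conj:
  assumes g: "g \<in> normalizer GU E" and x: "x \<in> rad"
  shows "g \<otimes>\<^bsub>GU\<^esub> x \<otimes>\<^bsub>GU\<^esub> inv\<^bsub>GU\<^esub> g \<in> rad"
proof -
  have Esub: "E \<subseteq> carrier GU" using E_carrier by auto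
  have gc: "g \<in> carrier GU" and im: "(\<lambda>x. g \<otimes>\<^bsub>GU\<^esub> x \<otimes>\<^bsub>GU\<^esub> inv\<^bsub>GU\<^esub> g) ` E = E"
    using g by (simp_all add: GU.normalizer_iff[OF Esub])
  let ?c = "\<lambda>x. g \<otimes>\<^bsub>GU\<^esub> x \<otimes>\<^bsub>GU\<^esub> inv\<^bsub>GU\<^esub> g"
  have cE: "?c z \<in> E" if "z \<in> E" for z using im that by (metis imageI)
  note A = M[OF gc]
  obtain A' where A': "similitude q n A'" "M g * A' = 1\<^sub>m n" "A' * M g = 1\<^sub>m n"
    using similitude_obtain_inverse[OF A(1)] .
  note Ac = similitude_carrier[OF A(1)] similitude_carrier[OF A'(1)]
  have inv: "inv\<^bsub>GU\<^esub> g = cl n A'" using PGU_inv[OF A(1) A'(1,3)] A(2) by simp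
  have rep: "similitude q n (M g * M z * A')" "cl n (M g * M z * A') = ?c z" if "z \<in> E" for z
  proof -
    note z = M[OF E_carrier[OF that]]
    show "similitude q n (M g * M z * A')" using A A' z similitude_mult by blast
    show "cl n (M g * M z * A') = ?c z"
      using PGU_mult[OF A(1) z(1)] PGU_mult[OF similitude_mult[OF A(1) z(1)] A'(1)] A z inv by simp
  qed
  have "b (?c x) (?c y) = b x y" if y: "y \<in> E" for y
  proof (rule b_unique[symmetric])
    have xE: "x \<in> E" using x by (simp add: rad_def)
    show "?c x \<in> E" "?c y \<in> E" using cE xE y by auto
    show "M g * M x * A' \<in> carrier (GL n)" "M g * M y * A' \<in> carrier (GL n)"
      using rep similitude_GL xE y by blast+
    show "cl n (M g * M x * A') = ?c x" "cl n (M g * M y * A') = ?c y" using rep xE y by auto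
    have pr: "(M g * M u * A') * (M g * M v * A') = M g * (M u * M v) * A'" if "u \<in> E" "v \<in> E" for u v
    proof -
      have "(M g * M u * A') * (M g * M v * A') = M g * M u * (A' * M g) * M v * A'"
        using Ac M_carrier that by (simp add: ac)
      then show ?thesis using Ac M_carrier that A'(3) by (simp add: ac left_mult_one_mat[of _ n n])
    qed
    show "M g * M x * A' * (M g * M y * A') = b x y \<cdot>\<^sub>m (M g * M y * A' * (M g * M x * A'))"
      using pr[OF xE y] pr[OF y xE] b(2)[OF xE y] Ac M_carrier xE y by (simp add: sm ac)
  qed
  moreover have "\<exists>y\<in>E. z = ?c y" if "z \<in> E" for z
  proof -
    have "z \<in> ?c ` E" using that im by simp
    then show ?thesis by blast
  qed
  ultimately have "b (?c x) z = 1" if "z \<in> E" for z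
    using that x unfolding rad_def by (metis (mono_tags, lifting) mem_Collect_eq)
  then show ?thesis using cE x by (simp add: rad_def)
qed

text \<open>With trivial pairing the lifts commute. Their p-th powers are scalars, which have p-th
  roots in the field, so \<open>simultaneous_factorization\<close> with \<open>Q = 1\<close>
  diagonalises all of them at once.\<close>

lemma toral_if_rad:
  assumes "rad = E"
  shows "\<exists>T. maximal_torus_PGL n T \<and> E \<subseteq> T"
proof -
  have b1: "b x y = 1" if "x \<in> E" "y \<in> E" for x y using assms that by (auto simp: rad_def)
  obtain \<omega> :: 'a where \<omega>: "\<omega> ^ p = 1" "\<And>j. 0 < j \<Longrightarrow> j < p \<Longrightarrow> \<omega> ^ j \<noteq> 1"
    using primitive_root_exists[OF p] by blast
  have "\<exists>\<mu>. \<mu> \<noteq> 0 \<and> M x ^\<^sub>m p = \<mu> ^ p \<cdot>\<^sub>m 1\<^sub>m n" if x: "x \<in> E" for x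
  proof -
    note m = M[OF E_carrier[OF x]]
    have "cl n (M x ^\<^sub>m p) = cl n (1\<^sub>m n)" using PGU_pow[OF m(1), of p] m(2) E_pow[OF x] PGU_one by simp
    then obtain c where c: "c \<noteq> 0" "M x ^\<^sub>m p = c \<cdot>\<^sub>m 1\<^sub>m n"
      using cl_eq_iff[of "M x ^\<^sub>m p" n "1\<^sub>m n"] M_carrier[OF x] by auto
    have p0: "p > 0" using p prime_gt_0_nat by blast
    then obtain \<mu> where "\<mu> ^ p = c" using nth_root_exists by blast
    then show ?thesis using c p0 by (intro exI[of _ \<mu>]) (auto simp: power_0_left)
  qed
  moreover have "M x * M y = M y * M x" if "x \<in> E" "y \<in> E" for x y using b(2)[OF that] b1[OF that] by simp
  ultimately have "\<exists>a U W d. U \<in> carrier_mat n a \<and> W \<in> carrier_mat a n \<and> W * U = 1\<^sub>m a \<and> U * W = 1\<^sub>m n \<and>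
     (\<forall>x\<in>E. \<forall>i<n. \<forall>j<a. (M x * U) $$ (i, j) = d x j * U $$ (i, j))"
    using M_carrier by (intro simultaneous_factorization[OF E_fin _ _ _ p(2) \<omega>])
       (auto simp: left_mult_one_mat[of _ n n] right_mult_one_mat[of _ n n])
  then obtain a U W d where U: "U \<in> carrier_mat n a" and W: "W \<in> carrier_mat a n" and WU: "W * U = 1\<^sub>m a"
    and UW: "U * W = 1\<^sub>m n" and d: "\<And>x i j. x \<in> E \<Longrightarrow> i < n \<Longrightarrow> j < a \<Longrightarrow> (M x * U) $$ (i, j) = d x j * U $$ (i, j)" by blast
  \<comment> \<open>Being inverse to each other on both sides forces U and W to be square; U then
    serves as the conjugating element of the torus.\<close>
  have "a = n" using left_inverse_dim_le[OF U W UW] left_inverse_dim_le[OF W U WU] by simp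
  note U = U[unfolded this] and W = W[unfolded this] and WU = WU[unfolded this] and d = d[unfolded this]
  have UG: "U \<in> carrier (GL n)" "W \<in> carrier (GL n)" using GL_I[OF U W UW] by auto
  have invU: "inv\<^bsub>GL n\<^esub> U = W" using GL_inv_eq[OF U W UW] by simp
  let ?T = "(\<lambda>D. cl n (U * D * inv\<^bsub>GL n\<^esub> U)) ` {D \<in> carrier (GL n). diagonal_mat D}"
  have "x \<in> ?T" if x: "x \<in> E" for x
  proof -
    let ?D = "W * (M x * U)"
    have Mc: "M x \<in> carrier_mat n n" by (rule M_carrier[OF x])
    have MU: "M x * U \<in> carrier_mat n n" using Mc U by auto
    have "diagonal_mat ?D"
      unfolding diagonal_mat_def
    proof (intro allI impI)
      fix i j assume "i < dim_row ?D" "j < dim_col ?D" and ne: "i \<noteq> j"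
      then have ij: "i < n" "j < n" using W U by auto
      have "?D $$ (i, j) = (\<Sum>t<n. W $$ (i, t) * (M x * U) $$ (t, j))"
        by (rule index_mult_mat_sum[OF W MU ij])
      also have "\<dots> = d x j * (\<Sum>t<n. W $$ (i, t) * U $$ (t, j))"
        using ij d[OF x] by (simp add: sum_distrib_left mult_ac del: index_mult_mat)
      also have "(\<Sum>t<n. W $$ (i, t) * U $$ (t, j)) = (W * U) $$ (i, j)"
        by (rule index_mult_mat_sum[OF W U ij, symmetric])
      finally show "?D $$ (i, j) = 0" using WU ij ne by simp
    qed
    moreover have "?D \<in> carrier (GL n)"
      using UG M_GL[OF x] by (auto simp: det_mult[of _ n] ac)
    moreover have "U * ?D * W = M x"
    proof -
      have "U * ?D * W = (U * W) * M x * (U * W)" using U W Mc by (simp add: ac)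
      then show ?thesis using UW Mc by simp
    qed
    ultimately show ?thesis using M(2)[OF E_carrier[OF x]] invU by (intro image_eqI[of _ _ ?D]) auto
  qed
  moreover have "maximal_torus_PGL n ?T" unfolding maximal_torus_PGL_def using UG by blast
  ultimately show ?thesis by blast
qed

text \<open>\<open>S x\<close> is conjugation by x on n by n matrices, written as a Kronecker
  product. Its spectral projections \<open>Q y\<close> are indexed by E through the characters t ->
  b t y, which are distinct because the radical is trivial, and they are conjugate to each other, so
  \<open>conjugate_idempotents_dvd\<close> applies with r = |E|.\<close>

lemma card_dvd_if_nondegenerate:
  assumes "rad = {\<one>\<^bsub>GU\<^esub>}"
  shows "card E dvd n * n"
proof -
  let ?N = "n * n" and ?e = "of_nat (card E) :: 'a"
  have e0: "?e \<noteq> 0" using E_card p(2) by simp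
  interpret EG: group "GU\<lparr>carrier := E\<rparr>" using E_subgroup by (rule GU.subgroup_imp_group)
  have "\<exists>B. B \<in> carrier_mat n n \<and> M x * B = 1\<^sub>m n \<and> B * M x = 1\<^sub>m n" if "x \<in> E" for x
    using GL_obtain_inverse[OF M_GL[OF that]] by (metis (no_types, lifting) GL_simps(1) mem_Collect_eq)
  then obtain I where I: "\<And>x. x \<in> E \<Longrightarrow> I x \<in> carrier_mat n n" "\<And>x. x \<in> E \<Longrightarrow> M x * I x = 1\<^sub>m n"
    "\<And>x. x \<in> E \<Longrightarrow> I x * M x = 1\<^sub>m n" by metis
  define S where "S x = kron (M x) (transpose_mat (I x))" for x
  have Sc: "S x \<in> carrier_mat ?N ?N" if "x \<in> E" for x using that M_carrier I(1) by (simp add: S_def)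
  \<comment> \<open>Rescaling a lift is cancelled by the opposite rescaling of its inverse, so
    \<open>S\<close> does not depend on lifts and becomes multiplicative.\<close>
  have Ssc: "S x = kron A (transpose_mat B)" if x: "x \<in> E" and A: "A \<in> carrier_mat n n" "cl n A = x"
    and B: "B \<in> carrier_mat n n" "A * B = 1\<^sub>m n" for x A B
  proof -
    obtain u where u: "u \<noteq> 0" "A = u \<cdot>\<^sub>m M x"
      using cl_eq_iff[OF A(1) M_carrier[OF x]] A M(2)[OF E_carrier[OF x]] by auto
    have "M x * (u \<cdot>\<^sub>m B) = 1\<^sub>m n" using B u M_carrier[OF x] by (simp add: sm)
    then have "I x * (M x * (u \<cdot>\<^sub>m B)) = I x" using I(1)[OF x] by simp
    then have "u \<cdot>\<^sub>m B = I x" using I(1,3)[OF x] M_carrier[OF x] B(1) assoc_mult_mat[of "I x" n n "M x" n "u \<cdot>\<^sub>m B" n] by simp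
    then have "B = inverse u \<cdot>\<^sub>m I x" using u by (metis smult_smult_mat left_inverse one_smult_mat)
    then show ?thesis using u by (simp add: S_def transpose_smult kron_smult_left kron_smult_right smult_smult_mat)
  qed
  have Smult: "S x * S y = S (x \<otimes>\<^bsub>GU\<^esub> y)" if xy: "x \<in> E" "y \<in> E" for x y
  proof -
    note c = M_carrier[OF xy(1)] M_carrier[OF xy(2)] I(1)[OF xy(1)] I(1)[OF xy(2)]
    have "M x * M y * (I y * I x) = M x * (M y * I y) * I x" using c by (simp add: ac)
    then have inv: "M x * M y * (I y * I x) = 1\<^sub>m n" using I(2)[OF xy(1)] I(2)[OF xy(2)] c by simp
    have "S x * S y = kron (M x * M y) (transpose_mat (I x) * transpose_mat (I y))"
      unfolding S_def by (rule kron_mult[of _ n n _ n _ n n _ n]) (use c in auto)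
    also have "transpose_mat (I x) * transpose_mat (I y) = transpose_mat (I y * I x)"
      using transpose_mult[OF c(4,3)] by simp
    also have "kron (M x * M y) \<dots> = S (x \<otimes>\<^bsub>GU\<^esub> y)"
      by (rule Ssc[symmetric]) (use c xy E_mult cl_M_mult inv in auto)
    finally show ?thesis .
  qed
  have S1: "S \<one>\<^bsub>GU\<^esub> = 1\<^sub>m ?N"
    using Ssc[OF E_one, of "1\<^sub>m n" "1\<^sub>m n"] PGU_one by (simp add: kron_one)
  \<comment> \<open>The averaging projection onto the subspace on which each \<open>S t\<close> acts
    as the inverse of \<open>b t y\<close>.\<close>
  define Q where "Q y = msum ?N E (\<lambda>x. (b x y / ?e) \<cdot>\<^sub>m S x)" for y
  have Qc: "Q y \<in> carrier_mat ?N ?N" for y by (simp add: Q_def)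
  have smN: "A * (c \<cdot>\<^sub>m B) = c \<cdot>\<^sub>m (A * B)" "(c \<cdot>\<^sub>m A) * B = c \<cdot>\<^sub>m (A * B)"
    if "A \<in> carrier_mat ?N ?N" "B \<in> carrier_mat ?N ?N" for A B :: "'a mat" and c
    using that by (simp_all add: mult_smult_assoc_mat[of _ ?N ?N _ ?N] mult_smult_distrib[of _ ?N ?N _ ?N])
  have SQ: "S t * Q z = inverse (b t z) \<cdot>\<^sub>m Q z" if t: "t \<in> E" and z: "z \<in> E" for t z
  proof -
    have "S t * Q z = msum ?N E (\<lambda>x. S t * ((b x z / ?e) \<cdot>\<^sub>m S x))"
      unfolding Q_def by (rule mult_msum) (use Sc t in auto)
    also have "\<dots> = msum ?N E (\<lambda>x. inverse (b t z) \<cdot>\<^sub>m ((b (t \<otimes>\<^bsub>GU\<^esub> x) z / ?e) \<cdot>\<^sub>m S (t \<otimes>\<^bsub>GU\<^esub> x)))"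
      using Sc t z b(1)[OF t z] by (intro msum_cong) (simp add: smN Smult b_mult_left smult_smult_mat field_simps)
    also have "\<dots> = inverse (b t z) \<cdot>\<^sub>m msum ?N E (\<lambda>x. (b (t \<otimes>\<^bsub>GU\<^esub> x) z / ?e) \<cdot>\<^sub>m S (t \<otimes>\<^bsub>GU\<^esub> x))"
      using Sc t E_mult by (intro smult_msum[symmetric]) auto
    also have "msum ?N E (\<lambda>x. (b (t \<otimes>\<^bsub>GU\<^esub> x) z / ?e) \<cdot>\<^sub>m S (t \<otimes>\<^bsub>GU\<^esub> x)) = Q z"
      unfolding Q_def
    proof (rule msum_reindex[symmetric])
      show "bij_betw (\<lambda>x. t \<otimes>\<^bsub>GU\<^esub> x) E E"
        by (rule bij_betwI[where g = "\<lambda>x. inv\<^bsub>GU\<^esub> t \<otimes>\<^bsub>GU\<^esub> x"])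
          (use t E_mult E_inv E_carrier in \<open>auto simp: GU.m_assoc[symmetric]\<close>)
    qed
    finally show ?thesis .
  qed
  \<comment> \<open>This is where the trivial radical enters: for y other than the identity, t -> b
    t y is a nontrivial character.\<close>
  have csum: "(\<Sum>t\<in>E. b t y) = (if y = \<one>\<^bsub>GU\<^esub> then ?e else 0)" if y: "y \<in> E" for y
  proof (cases "y = \<one>\<^bsub>GU\<^esub>")
    case True
    then show ?thesis using b_one_left b_swap[OF E_one] by simp
  next
    case False
    then have "y \<notin> rad" using assms by auto
    then obtain t where t: "t \<in> E" "b y t \<noteq> 1" using y by (auto simp: rad_def)
    then have "b t y \<noteq> 1" using b_swap[OF y t(1)] by simp
    then have "(\<Sum>t\<in>carrier (GU\<lparr>carrier := E\<rparr>). b t y) = 0"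
      using t E_fin y by (intro character_sum_zero[OF EG.is_group]) (auto simp: b_mult_left)
    then show ?thesis using False by simp
  qed
  have QQ: "Q y * Q z = (if y = z then Q z else 0\<^sub>m ?N ?N)" if yz: "y \<in> E" "z \<in> E" for y z
  proof -
    have "Q y * Q z = msum ?N E (\<lambda>t. (b t y / ?e) \<cdot>\<^sub>m S t * Q z)"
      unfolding Q_def[of y] by (rule msum_mult) (use Sc Qc in auto)
    also have "\<dots> = msum ?N E (\<lambda>t. (b t (y \<otimes>\<^bsub>GU\<^esub> inv\<^bsub>GU\<^esub> z) / ?e) \<cdot>\<^sub>m Q z)"
      using Sc Qc yz by (intro msum_cong) (simp add: smN SQ smult_smult_mat b_mult_right b_inv_right E_inv)
    also have "\<dots> = (\<Sum>t\<in>E. b t (y \<otimes>\<^bsub>GU\<^esub> inv\<^bsub>GU\<^esub> z) / ?e) \<cdot>\<^sub>m Q z" by (rule msum_smult_const[OF Qc])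
    also have "(\<Sum>t\<in>E. b t (y \<otimes>\<^bsub>GU\<^esub> inv\<^bsub>GU\<^esub> z) / ?e) = (if y \<otimes>\<^bsub>GU\<^esub> inv\<^bsub>GU\<^esub> z = \<one>\<^bsub>GU\<^esub> then 1 else 0)"
      using csum[OF E_mult[OF yz(1) E_inv[OF yz(2)]]] e0 by (simp add: sum_divide_distrib[symmetric])
    also have "y \<otimes>\<^bsub>GU\<^esub> inv\<^bsub>GU\<^esub> z = \<one>\<^bsub>GU\<^esub> \<longleftrightarrow> y = z"
      using GU.inv_solve_right'[of "\<one>\<^bsub>GU\<^esub>" y z] E_carrier yz by auto
    finally show ?thesis using Qc by (simp add: zero_smult_mat)
  qed
  have Qsum: "msum ?N E Q = 1\<^sub>m ?N"
  proof -
    have "msum ?N E Q = msum ?N E (\<lambda>x. msum ?N E (\<lambda>y. (b x y / ?e) \<cdot>\<^sub>m S x))"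
      unfolding Q_def by (rule msum_swap)
    also have "\<dots> = msum ?N E (\<lambda>x. (\<Sum>y\<in>E. b x y / ?e) \<cdot>\<^sub>m S x)"
      using Sc by (intro msum_cong msum_smult_const) auto
    also have "\<dots> = (\<lambda>x. (\<Sum>y\<in>E. b x y / ?e) \<cdot>\<^sub>m S x) \<one>\<^bsub>GU\<^esub>"
    proof (rule msum_single[OF E_fin E_one])
      fix x assume x: "x \<in> E" "x \<noteq> \<one>\<^bsub>GU\<^esub>"
      have "(\<Sum>y\<in>E. b x y) = (\<Sum>y\<in>E. b (inv\<^bsub>GU\<^esub> y) x)"
      proof (rule sum.cong)
        fix y assume y: "y \<in> E"
        show "b x y = b (inv\<^bsub>GU\<^esub> y) x" using b_inv_left[OF y x(1)] b_swap[OF x(1) y] b(1)[OF x(1) y] by simp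
      qed simp
      also have "\<dots> = (\<Sum>y\<in>E. b y x)"
        by (rule sum.reindex_bij_witness[of _ "\<lambda>y. inv\<^bsub>GU\<^esub> y" "\<lambda>y. inv\<^bsub>GU\<^esub> y"]) (use E_inv E_carrier in auto)
      also have "\<dots> = 0" using csum[OF x(1)] x(2) by simp
      finally show "(\<Sum>y\<in>E. b x y / ?e) \<cdot>\<^sub>m S x = 0\<^sub>m ?N ?N"
        using Sc[OF x(1)] by (simp add: sum_divide_distrib[symmetric] zero_smult_mat)
    qed (use Sc E_one in auto)
    also have "\<dots> = 1\<^sub>m ?N" using e0 by (simp add: b_one_left S1)
    finally show ?thesis .
  qed
  \<comment> \<open>\<open>D y\<close> acts on the second tensor factor alone: conjugation by it
    multiplies each \<open>S x\<close> by \<open>b x y\<close>, and so turns the projection of the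
    trivial character into \<open>Q y\<close>.\<close>
  define D where "D y = kron (1\<^sub>m n) (transpose_mat (I y))" for y
  define D' where "D' y = kron (1\<^sub>m n) (transpose_mat (M y))" for y
  have Dc: "D y \<in> carrier_mat ?N ?N" "D' y \<in> carrier_mat ?N ?N" if "y \<in> E" for y
    using that I M_carrier by (auto simp: D_def D'_def)
  have DD: "D' y * D y = 1\<^sub>m ?N" if y: "y \<in> E" for y
  proof -
    have "D' y * D y = kron (1\<^sub>m n * 1\<^sub>m n) (transpose_mat (M y) * transpose_mat (I y))"
      unfolding D_def D'_def by (rule kron_mult[of _ n n _ n _ n n _ n]) (use I(1)[OF y] M_carrier[OF y] in auto)
    also have "transpose_mat (M y) * transpose_mat (I y) = 1\<^sub>m n"
      using transpose_mult[OF I(1)[OF y] M_carrier[OF y]] I(3)[OF y] by simp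
    finally show ?thesis by (simp add: kron_one)
  qed
  have DSD: "D y * S x * D' y = b x y \<cdot>\<^sub>m S x" if xy: "x \<in> E" "y \<in> E" for x y
  proof -
    note c = M_carrier[OF xy(1)] M_carrier[OF xy(2)] I(1)[OF xy(1)] I(1)[OF xy(2)]
    have "D y * S x = kron (1\<^sub>m n * M x) (transpose_mat (I y) * transpose_mat (I x))"
      unfolding D_def S_def by (rule kron_mult[of _ n n _ n _ n n _ n]) (use c in auto)
    also have "transpose_mat (I y) * transpose_mat (I x) = transpose_mat (I x * I y)"
      using transpose_mult[OF c(3,4)] by simp
    finally have "D y * S x * D' y = kron (M x) (transpose_mat (I x * I y)) * kron (1\<^sub>m n) (transpose_mat (M y))"
      using c by (simp add: D'_def)
    also have "\<dots> = kron (M x * 1\<^sub>m n) (transpose_mat (I x * I y) * transpose_mat (M y))"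
      by (rule kron_mult[of _ n n _ n _ n n _ n]) (use c in auto)
    also have "transpose_mat (I x * I y) * transpose_mat (M y) = transpose_mat (M y * (I x * I y))"
      using transpose_mult[of "M y" n n "I x * I y" n] c by (simp add: ac)
    also have "M y * (I x * I y) = b x y \<cdot>\<^sub>m I x"
    proof -
      have "M y * (I x * I y) = (I x * M x) * M y * (I x * I y)" using c I(3)[OF xy(1)] by (simp add: ac)
      also have "\<dots> = I x * (M x * M y) * (I x * I y)" using c by (simp add: ac)
      also have "\<dots> = b x y \<cdot>\<^sub>m (I x * (M y * (M x * I x)) * I y)"
        unfolding b(2)[OF xy] using c by (simp add: sm ac)
      also have "I x * (M y * (M x * I x)) * I y = I x * (M y * I y)" using c I(2)[OF xy(1)] by (simp add: ac)
      finally show ?thesis using c I(2)[OF xy(2)] by simp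
    qed
    finally show ?thesis using c by (simp add: S_def transpose_smult kron_smult_right)
  qed
  have DQD: "D y * Q \<one>\<^bsub>GU\<^esub> * D' y = Q y" if y: "y \<in> E" for y
  proof -
    have "D y * Q \<one>\<^bsub>GU\<^esub> = msum ?N E (\<lambda>x. D y * ((b x \<one>\<^bsub>GU\<^esub> / ?e) \<cdot>\<^sub>m S x))"
      unfolding Q_def by (rule mult_msum) (use Sc Dc y in auto)
    also have "\<dots> * D' y = msum ?N E (\<lambda>x. D y * ((b x \<one>\<^bsub>GU\<^esub> / ?e) \<cdot>\<^sub>m S x) * D' y)"
      by (rule msum_mult) (use Sc Dc y in \<open>auto simp: mult_carrier_mat[of _ ?N ?N _ ?N]\<close>)
    also have "\<dots> = Q y" unfolding Q_def
    proof (rule msum_cong)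
      fix x assume x: "x \<in> E"
      have "b x \<one>\<^bsub>GU\<^esub> = 1" using b_swap[OF E_one x] b_one_left[OF x] by simp
      then show "D y * ((b x \<one>\<^bsub>GU\<^esub> / ?e) \<cdot>\<^sub>m S x) * D' y = (b x y / ?e) \<cdot>\<^sub>m S x"
        using Sc[OF x] Dc[OF y] DSD[OF x y] by (simp add: smN mult_carrier_mat[of _ ?N ?N _ ?N] smult_smult_mat)
    qed
    finally show ?thesis .
  qed
  obtain f where f: "bij_betw f {..<card E} E" using ex_bij_betw_nat_finite[OF E_fin] by (auto simp: lessThan_atLeast0)
  have fE: "f i \<in> E" if "i < card E" for i using f that by (auto simp: bij_betw_def)
  show ?thesis
  proof (rule conjugate_idempotents_dvd[where Q = "Q \<one>\<^bsub>GU\<^esub>" and D = "\<lambda>i. D (f i)" and D' = "\<lambda>i. D' (f i)"])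
    show "Q \<one>\<^bsub>GU\<^esub> * Q \<one>\<^bsub>GU\<^esub> = Q \<one>\<^bsub>GU\<^esub>" using QQ[OF E_one E_one] by simp
    have "msum ?N {..<card E} (\<lambda>i. D (f i) * Q \<one>\<^bsub>GU\<^esub> * D' (f i)) = msum ?N {..<card E} (\<lambda>i. Q (f i))"
      by (rule msum_cong) (use DQD fE in auto)
    also have "\<dots> = msum ?N E Q" by (rule msum_reindex[OF f, symmetric])
    finally show "msum ?N {..<card E} (\<lambda>i. D (f i) * Q \<one>\<^bsub>GU\<^esub> * D' (f i)) = 1\<^sub>m ?N" using Qsum by simp
    fix i j assume ij: "i < card E" "j < card E" "i \<noteq> j"
    then have "f i \<noteq> f j" using f by (auto simp: bij_betw_def inj_on_def)
    then show "D (f i) * Q \<one>\<^bsub>GU\<^esub> * D' (f i) * (D (f j) * Q \<one>\<^bsub>GU\<^esub> * D' (f j)) = 0\<^sub>m ?N ?N"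
      using DQD QQ fE ij by simp
  qed (use Dc DD fE Qc in auto)
qed

end

section \<open>Necessity\<close>

text \<open>For a prime r dividing the order, Sylow's theorem in the additive group gives a subgroup
  of order r, hence a nonzero x with r x = 0. So r is the characteristic.\<close>

lemma finite_field_card_power:
  "\<exists>e. card (UNIV :: 'f::{finite,field} set) = CHAR('f) ^ e"
proof -
  let ?q = "card (UNIV :: 'f set)"
  let ?G = "\<lparr>carrier = UNIV, monoid.mult = (+), one = (0::'f)\<rparr>"
  have G: "group ?G" by (rule groupI) (auto simp: add.assoc intro: exI[of _ "- x" for x])
  have prime_char: "prime CHAR('f)"
    by (simp add: finite_imp_CHAR_pos prime_CHAR_semidom)
  have only: "r = CHAR('f)" if r: "prime r" "r dvd ?q" for r :: nat
  proof -
    obtain c where c: "?q = r ^ 1 * c" using r by (auto elim: dvdE)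
    have "\<exists>H. subgroup H ?G \<and> card H = r ^ 1"
      by (rule sylow_thm[OF r(1) G]) (use c in \<open>auto simp: Coset.order_def\<close>)
    then obtain H where H: "subgroup H ?G" "card H = r" by auto
    have "card H > 1" using H r prime_gt_1_nat by simp
    then have "\<not> H \<subseteq> {0}" using card_mono[of "{0}" H] by auto
    then obtain x where x: "x \<in> H" "x \<noteq> 0" by auto
    interpret H: group "?G\<lparr>carrier := H\<rparr>" using group.subgroup_imp_group[OF G H(1)] .
    have pw: "x [^]\<^bsub>?G\<lparr>carrier := H\<rparr>\<^esub> k = of_nat k * x" for k :: nat
      by (induction k) (auto simp: algebra_simps)
    have "x [^]\<^bsub>?G\<lparr>carrier := H\<rparr>\<^esub> Coset.order (?G\<lparr>carrier := H\<rparr>) = \<one>\<^bsub>?G\<lparr>carrier := H\<rparr>\<^esub>"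
      by (rule H.pow_order_eq_1) (use x in auto)
    then have "of_nat r * x = 0" unfolding pw by (simp add: Coset.order_def H)
    then have "CHAR('f) dvd r" using x by (simp add: of_nat_eq_0_iff_char_dvd)
    then show ?thesis using primes_dvd_imp_eq[OF prime_char r(1)] by simp
  qed
  have "?q \<noteq> 0" by simp
  then obtain c where c: "?q = CHAR('f) ^ multiplicity CHAR('f) ?q * c" "\<not> CHAR('f) dvd c"
    using prime_char multiplicity_decompose'[of ?q "CHAR('f)"] by (metis not_prime_unit)
  have "c = 1"
  proof (rule ccontr)
    assume "c \<noteq> 1"
    then obtain r where r: "prime r" "r dvd c" using prime_factor_nat by blast
    then have "r dvd ?q" using c(1) by (metis dvd_mult)
    then show False using only r c(2) by blast
  qed
  then show ?thesis using c(1) by auto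
qed

text \<open>The order of the finite field is a power of its characteristic, which the closure
  shares, so the binomial expansion collapses.\<close>

lemma frobenius_power_alg_closure:
  "frobenius_power TYPE('f alg_closure) (card (UNIV :: 'f::{finite,field} set))"
proof
  show "card (UNIV :: 'f set) > 0" by (simp add: finite_UNIV_card_ge_0)
  fix x y :: "'f alg_closure"
  obtain e where e: "card (UNIV :: 'f set) = CHAR('f) ^ e" using finite_field_card_power by blast
  have "prime CHAR('f alg_closure)"
    by (simp add: finite_imp_CHAR_pos prime_CHAR_semidom)
  then show "(x + y) ^ card (UNIV :: 'f set) = x ^ card (UNIV :: 'f set) + y ^ card (UNIV :: 'f set)"
    by (rule freshmans_dream') (simp add: e)
qed

lemma of_nat_prime_alg_closure_nonzero:
  assumes "prime p" "\<not> p dvd card (UNIV :: 'f::{finite,field} set)"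
  shows "of_nat p \<noteq> (0 :: 'f alg_closure)"
proof
  assume "of_nat p = (0 :: 'f alg_closure)"
  then have "CHAR('f) dvd p" by (simp add: of_nat_eq_0_iff_char_dvd)
  moreover have "prime CHAR('f)"
    by (simp add: finite_imp_CHAR_pos prime_CHAR_semidom)
  ultimately have "CHAR('f) = p" using assms(1) primes_dvd_imp_eq by blast
  then show False using CHAR_dvd_CARD[where ?'a = 'f] assms(2) by simp
qed

lemma power_eq_1_coprime:
  fixes z :: "'a::field"
  assumes "z ^ a = 1" "z ^ b = 1" "coprime a b"
  shows "z = 1"
proof (cases "b = 0")
  case True
  then show ?thesis using assms by simp
next
  case b: False
  obtain u where u: "[a * u = 1] (mod b)" using cong_solve_coprime_nat[OF assms(3)] by (metis One_nat_def)
  show ?thesis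
  proof (cases "b = 1")
    case False
    then have "(a * u) mod b = 1" using u b by (simp add: cong_def)
    then have "a * u = b * ((a * u) div b) + 1" by (metis mult_div_mod_eq)
    then have "z ^ (a * u) = (z ^ b) ^ ((a * u) div b) * z" by (metis power_add power_mult power_one_right)
    then show ?thesis using assms by (simp add: power_mult)
  qed (use assms in simp)
qed

theorem (in frobenius_power) good_subgroup_imp:
  fixes E :: "'a mat set set"
  assumes good: "good_subgroup q n p m E TYPE('g::{finite,field})"
    and prm: "prime p" "odd p" "of_nat p \<noteq> (0::'a)" "card (UNIV :: 'g set) = p" and n: "n \<ge> 1"
  shows "p ^ m dvd n \<and> [int q = -1] (mod int p)"
proof -
  interpret elem_abelian_PGU q ty n p "2 * m" E
    using good prm n by unfold_locales (auto simp: good_subgroup_def)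
  have "rad = {\<one>\<^bsub>GU\<^esub>} \<or> rad = E"
  proof (rule GU.sp_quotient_irreducible[OF ea prm(1,2,4) _ rad_subgroup])
    show "PGU q n\<lparr>carrier := normalizer (PGU q n) E\<rparr> Mod centralizer (PGU q n) E \<cong> (Sp m :: 'g mat monoid)"
      using good by (simp add: good_subgroup_def)
    show "rad \<subseteq> E" by (auto simp: rad_def)
  qed (rule rad_conj)
  moreover have nE: "rad \<noteq> E" using toral_if_rad good by (auto simp: good_subgroup_def)
  ultimately have "card E dvd n * n" using card_dvd_if_nondegenerate by blast
  then have "(p ^ m) ^ 2 dvd n ^ 2" 
    using E_card by (simp add: power_mult[symmetric] mult.commute[of m] power2_eq_square[of n])
  then have 1: "p ^ m dvd n" by simp
  \<comment> \<open>A pairing value other than 1 is both a p-th and a (q+1)-th root of unity, so p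
    and q + 1 cannot be coprime.\<close>
  obtain x y where xy: "x \<in> E" "y \<in> E" "b x y \<noteq> 1" using nE by (auto simp: rad_def)
  have "p dvd q + 1"
  proof (rule ccontr)
    assume "\<not> p dvd q + 1"
    then have "coprime p (q + 1)" using p(1) by (simp add: prime_imp_coprime)
    then show False using power_eq_1_coprime b_pow_p b_frobenius xy by blast
  qed
  then have "int p dvd int q - (-1)" by (metis diff_minus_eq_add int_dvd_int_iff of_nat_1 of_nat_add)
  then show ?thesis using 1 by (simp add: cong_iff_dvd_diff)
qed

section \<open>Additive characters and the symplectic form\<close>

lemma prime_field_of_nat:
  assumes "prime p" "card (UNIV :: 'g::{finite,field} set) = p"
  shows "CHAR('g) = p" "\<exists>k<p. (c::'g) = of_nat k"
proof -
  have "CHAR('g) dvd p" using CHAR_dvd_CARD[where ?'a = 'g] assms by simp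
  moreover have "CHAR('g) \<noteq> 1" by simp
  ultimately show C: "CHAR('g) = p" using assms(1) by (metis prime_nat_iff)
  have "inj_on (of_nat :: nat \<Rightarrow> 'g) {..<p}"
    by (rule inj_onI) (auto simp: of_nat_eq_iff_cong_CHAR C cong_def)
  then have "of_nat ` {..<p} = (UNIV :: 'g set)"
    using assms by (intro card_subset_eq) (auto simp: card_image)
  then have "c \<in> of_nat ` {..<p}" by simp
  then show "\<exists>k<p. (c::'g) = of_nat k" by auto
qed

text \<open>\<chi> c is the k-th power of a primitive p-th root of unity, for any k representing c
  in the prime field. Since p divides q + 1, its values satisfy z * z^q = 1, which will make the
  Weyl operators unitary; they exhaust the p-th roots of unity because X^p - 1 has at most p
  roots.\<close>

lemma additive_character_exists:
  fixes ty :: "'a::alg_closed_field itself" and ty' :: "'g::{finite,field} itself"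
  assumes p: "prime p" "card (UNIV :: 'g set) = p" "of_nat p \<noteq> (0::'a)" and q: "p dvd q + 1"
  obtains \<chi> :: "'g \<Rightarrow> 'a" where "\<And>c d. \<chi> (c + d) = \<chi> c * \<chi> d" "\<And>c. \<chi> c = 1 \<longleftrightarrow> c = 0"
    "\<And>c. \<chi> c * \<chi> c ^ q = 1" "\<And>z. z ^ p = 1 \<Longrightarrow> \<exists>c. z = \<chi> c"
proof -
  obtain \<omega> :: 'a where w: "\<omega> ^ p = 1" "\<And>j. 0 < j \<Longrightarrow> j < p \<Longrightarrow> \<omega> ^ j \<noteq> 1"
    using primitive_root_exists[OF p(1,3)] by blast
  have p0: "p > 0" using p(1) prime_gt_0_nat by blast
  have w0: "\<omega> \<noteq> 0" using w(1) p0 by (auto simp: power_0_left)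
  have wmod: "\<omega> ^ k = \<omega> ^ (k mod p)" for k
  proof -
    have "\<omega> ^ k = \<omega> ^ (p * (k div p) + k mod p)" by simp
    also have "\<dots> = \<omega> ^ (k mod p)" by (simp only: power_add power_mult w) simp
    finally show ?thesis .
  qed
  note C = prime_field_of_nat[OF p(1,2)]
  define \<kappa> :: "'g \<Rightarrow> nat" where "\<kappa> c = (SOME k. c = of_nat k)" for c
  have kap: "c = of_nat (\<kappa> c)" for c
  proof -
    have "\<exists>k. c = of_nat k" using C(2)[of c] by auto
    from someI_ex[OF this] show ?thesis unfolding \<kappa>_def .
  qed
  define \<chi> where "\<chi> c = \<omega> ^ \<kappa> c" for c
  have chi: "\<chi> (of_nat k) = \<omega> ^ k" for k
  proof -
    have "of_nat (\<kappa> (of_nat k :: 'g)) = (of_nat k :: 'g)" using kap[of "of_nat k"] by simp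
    then have "\<kappa> (of_nat k :: 'g) mod p = k mod p" by (simp only: of_nat_eq_iff_cong_CHAR C(1) cong_def)
    then show ?thesis unfolding \<chi>_def using wmod by metis
  qed
  show ?thesis
  proof (rule that)
    show "\<chi> (c + d) = \<chi> c * \<chi> d" for c d
      using chi[of "\<kappa> c + \<kappa> d"] by (simp add: kap[symmetric] \<chi>_def power_add)
    show "\<chi> c = 1 \<longleftrightarrow> c = 0" for c
    proof
      assume "\<chi> c = 1"
      obtain k where k: "k < p" "c = of_nat k" using C(2) by blast
      then have "\<omega> ^ k = 1" using chi \<open>\<chi> c = 1\<close> by simp
      then have "k = 0" using w(2)[of k] k by auto
      then show "c = 0" using k by simp
    next
      assume "c = 0"
      then show "\<chi> c = 1" using chi[of 0] by simp
    qed
    show "\<chi> c * \<chi> c ^ q = 1" for c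
    proof -
      obtain l where "q + 1 = p * l" using q by (auto elim: dvdE)
      have "\<chi> c * \<chi> c ^ q = (\<omega> ^ \<kappa> c) ^ (q + 1)" by (simp add: \<chi>_def)
      also have "\<dots> = (\<omega> ^ p) ^ (l * \<kappa> c)" unfolding \<open>q + 1 = p * l\<close> by (simp flip: power_mult add: mult_ac)
      finally show ?thesis using w(1) by simp
    qed
    fix z :: 'a assume z: "z ^ p = 1"
    let ?f = "monom 1 p - 1 :: 'a poly"
    have deg: "degree ?f = p" 
    proof -
      have "degree (monom 1 p + (- 1) :: 'a poly) = degree (monom 1 p :: 'a poly)"
        using p0 by (intro degree_add_eq_left) (auto simp: degree_monom_eq)
      then show ?thesis by (simp add: degree_monom_eq)
    qed
    have f0: "?f \<noteq> 0" using deg p0 by auto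
    have inj: "inj_on (\<lambda>k. \<omega> ^ k) {..<p}"
    proof (rule linorder_inj_onI)
      fix i j assume ij: "i < j" "i \<in> {..<p}" "j \<in> {..<p}"
      show "\<omega> ^ i \<noteq> \<omega> ^ j"
      proof
        assume "\<omega> ^ i = \<omega> ^ j"
        also have "\<omega> ^ j = \<omega> ^ i * \<omega> ^ (j - i)" using ij by (simp flip: power_add)
        finally have "\<omega> ^ (j - i) = 1" using w0 by simp
        moreover have "0 < j - i" "j - i < p" using ij by auto
        ultimately show False using w(2) by blast
      qed
    qed auto
    have "(\<lambda>k. \<omega> ^ k) ` {..<p} = {x. poly ?f x = 0}"
    proof (rule card_seteq)
      show "finite {x. poly ?f x = 0}" using f0 by (rule poly_roots_finite)
      show "(\<lambda>k. \<omega> ^ k) ` {..<p} \<subseteq> {x. poly ?f x = 0}"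
      proof clarsimp
        fix k
        have "(\<omega> ^ k) ^ p = (\<omega> ^ p) ^ k" by (simp flip: power_mult add: mult.commute)
        then show "poly (monom 1 p) (\<omega> ^ k) = 1" using w(1) by (simp add: poly_monom)
      qed
      show "card {x. poly ?f x = 0} \<le> card ((\<lambda>k. \<omega> ^ k) ` {..<p})"
        using card_poly_roots_bound[OF f0] deg inj by (simp add: card_image)
    qed
    moreover have "z \<in> {x. poly ?f x = 0}" using z by (simp add: poly_monom)
    ultimately obtain k where "z = \<omega> ^ k" by blast
    then show "\<exists>c. z = \<chi> c" using chi by metis
  qed
qed

text \<open>Numbers the vectors of the m-dimensional space over the prime field; they will index the
  basis of the Weyl representation.\<close>

lemma enumerate_functions:
  fixes ty :: "'g::finite itself"
  assumes "card (UNIV :: 'g set) = p"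
  obtains f :: "nat \<Rightarrow> nat \<Rightarrow> 'g" where "\<And>g. \<exists>i<p ^ m. \<forall>t<m. f i t = g t"
    "\<And>i j. i < p ^ m \<Longrightarrow> j < p ^ m \<Longrightarrow> (\<And>t. t < m \<Longrightarrow> f i t = f j t) \<Longrightarrow> i = j"
proof -
  let ?D = "{..<m} \<rightarrow>\<^sub>E (UNIV :: 'g set)"
  have "finite ?D" "card ?D = p ^ m" using assms by (auto simp: card_PiE intro!: finite_PiE)
  then obtain f where f: "bij_betw f {..<p ^ m} ?D" using ex_bij_betw_nat_finite[of ?D] by (auto simp: lessThan_atLeast0)
  show ?thesis
  proof (rule that[of f])
    fix g
    have "restrict g {..<m} \<in> f ` {..<p ^ m}" using f by (auto simp: bij_betw_def)
    then show "\<exists>i<p ^ m. \<forall>t<m. f i t = g t" by (auto simp: fun_eq_iff restrict_def) metis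
  next
    fix i j assume ij: "i < p ^ m" "j < p ^ m" "\<And>t. t < m \<Longrightarrow> f i t = f j t"
    then have "f i \<in> ?D" "f j \<in> ?D" using f by (auto simp: bij_betw_def)
    then have "f i = f j" using ij(3) by (intro PiE_ext[of "f i" "{..<m}" _ "f j"]) auto
    then show "i = j" using f ij by (auto simp: bij_betw_def inj_on_def)
  qed
qed

text \<open>Over a prime field every scalar is a sum of ones, so additivity already gives linearity.
  The vector is built up one coordinate at a time.\<close>

lemma additive_imp_linear:
  fixes g :: "'g::{finite,field} vec \<Rightarrow> 'g"
  assumes p: "prime p" "card (UNIV :: 'g set) = p"
    and add: "\<And>u v. u \<in> carrier_vec d \<Longrightarrow> v \<in> carrier_vec d \<Longrightarrow> g (u + v) = g u + g v"
    and u: "u \<in> carrier_vec d"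
  shows "g u = (\<Sum>i<d. u $ i * g (unit_vec d i))"
proof -
  have "g (0\<^sub>v d + 0\<^sub>v d) = g (0\<^sub>v d) + g (0\<^sub>v d)" by (rule add) auto
  then have g0: "g (0\<^sub>v d) = 0" using add_cancel_right_right[of "g (0\<^sub>v d)" "g (0\<^sub>v d)"] by (metis left_zero_vec zero_carrier_vec)
  have smul: "g (of_nat k \<cdot>\<^sub>v v) = of_nat k * g v" if v: "v \<in> carrier_vec d" for k v
  proof (induction k)
    case 0
    have "0 \<cdot>\<^sub>v v = 0\<^sub>v d" using v by (intro eq_vecI) auto
    then show ?case using g0 by simp
  next
    case (Suc k)
    have "of_nat (Suc k) \<cdot>\<^sub>v v = v + of_nat k \<cdot>\<^sub>v v" using v by (intro eq_vecI) (auto simp: algebra_simps)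
    then show ?case using add[of v "of_nat k \<cdot>\<^sub>v v"] v Suc by (simp add: algebra_simps)
  qed
  have "g (vec d (\<lambda>i. if i < j then u $ i else 0)) = (\<Sum>i<j. u $ i * g (unit_vec d i))" if "j \<le> d" for j
    using that
  proof (induction j)
    case 0
    have "vec d (\<lambda>i. if i < 0 then u $ i else 0) = 0\<^sub>v d" by (intro eq_vecI) auto
    then show ?case using g0 by simp
  next
    case (Suc j)
    have eq: "vec d (\<lambda>i. if i < Suc j then u $ i else 0) = vec d (\<lambda>i. if i < j then u $ i else 0) + u $ j \<cdot>\<^sub>v unit_vec d j"
      using Suc by (intro eq_vecI) (auto simp: less_Suc_eq)
    obtain k where "u $ j = of_nat k" using prime_field_of_nat(2)[OF p] by blast
    then have "g (u $ j \<cdot>\<^sub>v unit_vec d j) = u $ j * g (unit_vec d j)" using smul by simp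
    then show ?case unfolding eq using Suc by (subst add) auto
  qed
  from this[of d] have "g (vec d (\<lambda>i. if i < d then u $ i else 0)) = (\<Sum>i<d. u $ i * g (unit_vec d i))" by simp
  moreover have "vec d (\<lambda>i. if i < d then u $ i else 0) = u" using u by (intro eq_vecI) auto
  ultimately show ?thesis by simp
qed

text \<open>One half of the symplectic form, pairing the first half of u with the second half of v.
  It is kept separate because its diagonal enters the phase of the Weyl operators.\<close>

definition qf :: "nat \<Rightarrow> 'g::field vec \<Rightarrow> 'g vec \<Rightarrow> 'g" where
  "qf m u v = (\<Sum>i<m. u $ i * v $ (m + i))"

definition sp :: "nat \<Rightarrow> 'g::field vec \<Rightarrow> 'g vec \<Rightarrow> 'g" where
  "sp m u v = qf m u v - qf m v u"

lemma sp_add: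
  assumes "u \<in> carrier_vec (2 * m)" "v \<in> carrier_vec (2 * m)"
  shows "sp m (u + v) w = sp m u w + sp m v w" "sp m w (u + v) = sp m w u + sp m w v"
  using assms by (simp_all add: sp_def qf_def sum.distrib algebra_simps)

lemma sp_swap: "sp m v u = - sp m u v"
  by (simp add: sp_def)

lemma sp_uminus:
  assumes "u \<in> carrier_vec (2 * m)"
  shows "sp m (- u) w = - sp m u w"
  using assms by (simp add: sp_def qf_def sum_negf)

lemma sp_unit_right:
  assumes "i < m" "w \<in> carrier_vec (2 * m)"
  shows "sp m w (unit_vec (2 * m) i) = - w $ (m + i)" "sp m w (unit_vec (2 * m) (m + i)) = w $ i"
proof -
  have 1: "(\<Sum>t<m. w $ t * unit_vec (2 * m) i $ (m + t)) = 0"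
    using assms by (intro sum.neutral) auto
  have 2: "(\<Sum>t<m. unit_vec (2 * m) i $ t * w $ (m + t)) = (\<Sum>t<m. if t = i then w $ (m + t) else 0)"
    using assms by (intro sum.cong) auto
  show "sp m w (unit_vec (2 * m) i) = - w $ (m + i)" unfolding sp_def qf_def 1 2 using assms by simp
  have 3: "(\<Sum>t<m. unit_vec (2 * m) (m + i) $ t * w $ (m + t)) = 0"
    using assms by (intro sum.neutral) auto
  have 4: "(\<Sum>t<m. w $ t * unit_vec (2 * m) (m + i) $ (m + t)) = (\<Sum>t<m. if t = i then w $ t else 0)"
    using assms by (intro sum.cong) auto
  show "sp m w (unit_vec (2 * m) (m + i)) = w $ i" unfolding sp_def qf_def 3 4 using assms by simp
qed

lemma index_2m_cases:
  assumes "i < 2 * (m::nat)"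
  obtains "i < m" | j where "j < m" "i = m + j"
  using assms by (metis add_less_cancel_left le_add_diff_inverse mult_2 not_le)

lemma sp_nondegenerate:
  assumes u: "u \<in> carrier_vec (2 * m)" and "\<And>w. w \<in> carrier_vec (2 * m) \<Longrightarrow> sp m u w = 0"
  shows "u = 0\<^sub>v (2 * m)"
proof (rule eq_vecI)
  fix i assume "i < dim_vec (0\<^sub>v (2 * m))"
  then have "i < 2 * m" by simp
  then show "u $ i = 0\<^sub>v (2 * m) $ i"
  proof (cases rule: index_2m_cases)
    case 1
    then show ?thesis using sp_unit_right(2)[OF 1 u] assms(2) by simp
  next
    case (2 j)
    then show ?thesis using sp_unit_right(1)[OF 2(1) u] assms(2) by simp
  qed
qed (use u in auto)

text \<open>The form identifies the space with its dual: the coordinates of w are the values of g at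
  the unit vectors, with the two halves exchanged and one sign changed. This turns a character into
  a vector.\<close>

lemma sp_dual:
  fixes g :: "'g::{finite,field} vec \<Rightarrow> 'g"
  assumes p: "prime p" "card (UNIV :: 'g set) = p"
    and add: "\<And>u v. u \<in> carrier_vec (2 * m) \<Longrightarrow> v \<in> carrier_vec (2 * m) \<Longrightarrow> g (u + v) = g u + g v"
  obtains w where "w \<in> carrier_vec (2 * m)" "\<And>u. u \<in> carrier_vec (2 * m) \<Longrightarrow> g u = sp m w u"
proof
  define w where "w = vec (2 * m) (\<lambda>i. if i < m then g (unit_vec (2 * m) (m + i)) else - g (unit_vec (2 * m) (i - m)))"
  show w: "w \<in> carrier_vec (2 * m)" by (simp add: w_def)
  fix u :: "'g vec" assume u: "u \<in> carrier_vec (2 * m)"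
  have unit: "g (unit_vec (2 * m) i) = sp m w (unit_vec (2 * m) i)" if "i < 2 * m" for i
    using that
  proof (cases rule: index_2m_cases)
    case 1
    then show ?thesis using sp_unit_right(1)[OF 1 w] by (simp add: w_def)
  next
    case (2 j)
    then show ?thesis using sp_unit_right(2)[OF 2(1) w] by (simp add: w_def)
  qed
  have "g u = (\<Sum>i<2 * m. u $ i * g (unit_vec (2 * m) i))" by (rule additive_imp_linear[OF p add u])
  also have "\<dots> = (\<Sum>i<2 * m. u $ i * sp m w (unit_vec (2 * m) i))" using unit by simp
  also have "\<dots> = sp m w u"
    by (rule additive_imp_linear[OF p sp_add(2) u, symmetric])
  finally show "g u = sp m w u" .
qed

lemma sympl_J_carrier [simp]: "sympl_J m \<in> carrier_mat (2 * m) (2 * m)"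
  by (simp add: sympl_J_dblk)

lemma sympl_J_dim [simp]: "dim_row (sympl_J m) = 2 * m" "dim_col (sympl_J m) = 2 * m"
  using sympl_J_carrier[of m] by blast+

lemma sp_sympl_J:
  fixes u v :: "'g::field vec"
  assumes u: "u \<in> carrier_vec (2 * m)" and v: "v \<in> carrier_vec (2 * m)"
  shows "u \<bullet> (sympl_J m *\<^sub>v v) = sp m u v"
proof -
  have J: "(sympl_J m *\<^sub>v v) $ i = (if i < m then v $ (m + i) else - v $ (i - m))" if "i < 2 * m" for i
  proof -
    have "(sympl_J m *\<^sub>v v) $ i = row (sympl_J m) i \<bullet> v" using that by (intro index_mult_mat_vec) simp
    also have "\<dots> = (\<Sum>j<2 * m. (sympl_J m :: 'g mat) $$ (i, j) * v $ j)"
      using that v sympl_J_carrier[of m, where ?'a = 'g]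
      by (auto simp: scalar_prod_def lessThan_atLeast0 simp del: sympl_J_carrier intro!: sum.cong)
    also have "\<dots> = (\<Sum>j<2 * m. if j = (if i < m then m + i else i - m) then (if i < m then v $ (m + i) else - v $ (i - m)) else 0)"
      using that by (intro sum.cong) (auto simp: sympl_J_dblk dblk_def dg_def)
    also have "\<dots> = (if i < m then v $ (m + i) else - v $ (i - m))" using that by (subst sum.delta) auto
    finally show ?thesis .
  qed
  have "u \<bullet> (sympl_J m *\<^sub>v v) = (\<Sum>i<2 * m. u $ i * (sympl_J m *\<^sub>v v) $ i)"
    by (simp add: scalar_prod_def lessThan_atLeast0 del: index_mult_mat_vec)
  also have "\<dots> = (\<Sum>i<2 * m. u $ i * (if i < m then v $ (m + i) else - v $ (i - m)))" using J by simp
  also have "\<dots> = (\<Sum>t<2. \<Sum>i<m. u $ (t * m + i) * (if t * m + i < m then v $ (m + (t * m + i)) else - v $ (t * m + i - m)))"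
    by (rule sum_lessThan_mult)
  also have "\<dots> = (\<Sum>i<m. u $ i * v $ (m + i)) + (\<Sum>i<m. u $ (m + i) * - v $ i)"
    by (simp add: numeral_2_eq_2)
  also have "\<dots> = sp m u v" by (simp add: sp_def qf_def sum_negf mult.commute)
  finally show ?thesis .
qed

lemma mat_entry_bilinear:
  fixes A :: "'g::field mat"
  assumes "A \<in> carrier_mat d d" "i < d" "j < d"
  shows "A $$ (i, j) = unit_vec d i \<bullet> (A *\<^sub>v unit_vec d j)"
proof -
  have "A *\<^sub>v unit_vec d j \<in> carrier_vec d" using assms by auto
  then have "unit_vec d i \<bullet> (A *\<^sub>v unit_vec d j) = (A *\<^sub>v unit_vec d j) $ i" using assms by simp
  also have "\<dots> = A $$ (i, j)" using assms by simp
  finally show ?thesis by simp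
qed

lemma Sp_iff_sp:
  fixes s :: "'g::field mat"
  assumes s: "s \<in> carrier_mat (2 * m) (2 * m)"
  shows "s \<in> carrier (Sp m) \<longleftrightarrow> (\<forall>u\<in>carrier_vec (2 * m). \<forall>v\<in>carrier_vec (2 * m). sp m (s *\<^sub>v u) (s *\<^sub>v v) = sp m u v)"
proof -
  let ?d = "2 * m" and ?J = "sympl_J m :: 'g mat"
  let ?B = "transpose_mat s * ?J * s"
  have B: "?B \<in> carrier_mat ?d ?d" using s by (auto simp: mult_carrier_mat[of _ ?d ?d _ ?d])
  have sv: "s *\<^sub>v u \<in> carrier_vec ?d" if "u \<in> carrier_vec ?d" for u using s that by auto
  have form: "u \<bullet> (?B *\<^sub>v v) = sp m (s *\<^sub>v u) (s *\<^sub>v v)" if u: "u \<in> carrier_vec ?d" and v: "v \<in> carrier_vec ?d" for u v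
  proof -
    have "?B *\<^sub>v v = transpose_mat s *\<^sub>v (?J *\<^sub>v (s *\<^sub>v v))"
      using s v sv[OF v] by (simp add: assoc_mult_mat_vec[of _ ?d ?d _ ?d] mult_carrier_mat[of _ ?d ?d _ ?d])
    moreover have "u \<bullet> (transpose_mat s *\<^sub>v w) = (s *\<^sub>v u) \<bullet> w" if w: "w \<in> carrier_vec ?d" for w
    proof -
      have "(transpose_mat s *\<^sub>v w) \<bullet> u = w \<bullet> (s *\<^sub>v u)" by (rule transpose_vec_mult_scalar[OF s u w])
      then show ?thesis using comm_scalar_prod[of u ?d "transpose_mat s *\<^sub>v w"] comm_scalar_prod[of w ?d "s *\<^sub>v u"] s u w by auto
    qed
    moreover have "?J *\<^sub>v (s *\<^sub>v v) \<in> carrier_vec ?d" using sv[OF v] by (rule mult_mat_vec_carrier[OF sympl_J_carrier])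
    ultimately show ?thesis using sp_sympl_J[OF sv[OF u] sv[OF v]] by simp
  qed
  show ?thesis
  proof
    assume "s \<in> carrier (Sp m)"
    then show "\<forall>u\<in>carrier_vec ?d. \<forall>v\<in>carrier_vec ?d. sp m (s *\<^sub>v u) (s *\<^sub>v v) = sp m u v"
    proof (intro ballI)
      fix u v :: "'g vec" assume uv: "u \<in> carrier_vec ?d" "v \<in> carrier_vec ?d"
      have "?B = ?J" using \<open>s \<in> carrier (Sp m)\<close> by simp
      then show "sp m (s *\<^sub>v u) (s *\<^sub>v v) = sp m u v" using form[OF uv] sp_sympl_J[OF uv] by simp
    qed
  next
    assume h: "\<forall>u\<in>carrier_vec ?d. \<forall>v\<in>carrier_vec ?d. sp m (s *\<^sub>v u) (s *\<^sub>v v) = sp m u v"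
    have "?B = ?J"
    proof (rule eq_matI)
      fix i j assume "i < dim_row ?J" "j < dim_col ?J"
      then have ij: "i < ?d" "j < ?d" by auto
      show "?B $$ (i, j) = ?J $$ (i, j)"
        unfolding mat_entry_bilinear[OF B ij] mat_entry_bilinear[OF sympl_J_carrier ij]
        using form[of "unit_vec ?d i" "unit_vec ?d j"] sp_sympl_J[of "unit_vec ?d i :: 'g vec" m "unit_vec ?d j"] h by simp
    qed (use B in auto)
    then show "s \<in> carrier (Sp m)" using s by simp
  qed
qed

section \<open>Weyl operators\<close>

text \<open>\<chi> is an injective unitary additive character, and f numbers the vectors that index
  the basis in dimension p^m. Surjectivity of \<chi> onto the p-th roots of unity turns commutation
  scalars back into field elements.\<close>

locale weyl = frobenius_power q ty for q and ty :: "'a::alg_closed_field itself" +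
  fixes p m :: nat and \<chi> :: "'g::{finite,field} \<Rightarrow> 'a" and f :: "nat \<Rightarrow> nat \<Rightarrow> 'g"
  assumes p: "prime p" "odd p" "card (UNIV :: 'g set) = p" "of_nat p \<noteq> (0::'a)" and m: "m \<ge> 1"
    and chi_add: "\<And>c d. \<chi> (c + d) = \<chi> c * \<chi> d"
    and chi_1: "\<And>c. \<chi> c = 1 \<longleftrightarrow> c = 0"
    and chi_q: "\<And>c. \<chi> c * \<chi> c ^ q = 1"
    and chi_surj: "\<And>z. z ^ p = 1 \<Longrightarrow> \<exists>c. z = \<chi> c"
    and f_surj: "\<And>g. \<exists>i<p ^ m. \<forall>t<m. f i t = g t"
    and f_inj: "\<And>i j. i < p ^ m \<Longrightarrow> j < p ^ m \<Longrightarrow> (\<And>t. t < m \<Longrightarrow> f i t = f j t) \<Longrightarrow> i = j"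
begin

abbreviation "N0 \<equiv> p ^ m"
abbreviation "VV \<equiv> carrier_vec (2 * m) :: 'g vec set"

lemma chi_0: "\<chi> 0 = 1" using chi_1 by simp

lemma chi_nz: "\<chi> c \<noteq> 0" using chi_q[of c] by auto

lemma chi_eq_iff: "\<chi> c = \<chi> d \<longleftrightarrow> c = d"
proof -
  have "\<chi> c = \<chi> d \<longleftrightarrow> \<chi> (c - d) = 1"
    using chi_add[of "c - d" d] chi_nz[of d] by auto
  then show ?thesis using chi_1 by simp
qed

lemma two_nz: "(2::'g) \<noteq> 0"
proof
  assume "(2::'g) = 0"
  then have "of_nat 2 = (0::'g)" by simp
  then have "p dvd 2" using prime_field_of_nat(1)[OF p(1,3)] of_nat_eq_0_iff_char_dvd[where ?'a = 'g] by metis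
  then show False using p(1,2) by (metis primes_dvd_imp_eq two_is_prime_nat)
qed

lemma N0_pos: "N0 > 0" using p(1) prime_gt_0_nat by simp

lemma N0_nz: "of_nat N0 \<noteq> (0::'a)" using p(4) by simp

text \<open>Translation by the vector a, transported to the numbering f.\<close>

definition sh :: "(nat \<Rightarrow> 'g) \<Rightarrow> nat \<Rightarrow> nat" where
  "sh a j = (SOME i. i < N0 \<and> (\<forall>t<m. f i t = f j t + a t))"

lemma sh: "sh a j < N0" "t < m \<Longrightarrow> f (sh a j) t = f j t + a t"
proof -
  have "\<exists>i. i < N0 \<and> (\<forall>t<m. f i t = f j t + a t)" using f_surj[of "\<lambda>t. f j t + a t"] by auto
  from someI_ex[OF this] show "sh a j < N0" "t < m \<Longrightarrow> f (sh a j) t = f j t + a t" by (auto simp: sh_def)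
qed

lemma sh_eqI: "i < N0 \<Longrightarrow> (\<And>t. t < m \<Longrightarrow> f i t = f j t + a t) \<Longrightarrow> sh a j = i"
  using sh by (intro f_inj) auto

lemma sh_sh: "sh a (sh b j) = sh (\<lambda>t. b t + a t) j"
  by (rule sh_eqI[symmetric]) (auto simp: sh add.assoc)

lemma sh_zero: "j < N0 \<Longrightarrow> (\<And>t. t < m \<Longrightarrow> a t = 0) \<Longrightarrow> sh a j = j"
  by (rule sh_eqI) auto

lemma sh_cong: "(\<And>t. t < m \<Longrightarrow> a t = b t) \<Longrightarrow> sh a j = sh b j"
  by (rule sh_eqI) (auto simp: sh)

lemma sh_inj: "i < N0 \<Longrightarrow> j < N0 \<Longrightarrow> sh a i = sh a j \<longleftrightarrow> i = j"
proof
  assume ij: "i < N0" "j < N0" "sh a i = sh a j"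
  show "i = j"
  proof (rule f_inj[OF ij(1,2)])
    fix t assume "t < m"
    then show "f i t = f j t" using sh(2)[of t a i] sh(2)[of t a j] ij(3) by simp
  qed
qed simp

lemma sh_bij: "bij_betw (sh a) {..<N0} {..<N0}"
proof -
  have "inj_on (sh a) {..<N0}" using sh_inj by (auto simp: inj_on_def)
  moreover have "sh a ` {..<N0} \<subseteq> {..<N0}" using sh(1) by auto
  ultimately show ?thesis using endo_inj_surj[of "{..<N0}" "sh a"] by (simp add: bij_betw_def)
qed

definition shu :: "'g vec \<Rightarrow> nat \<Rightarrow> nat" where "shu u j = sh (\<lambda>t. u $ t) j"

text \<open>The phase is chosen so that the operators \<open>W u\<close> have the cocycle \<open>\<chi> (sp u v)\<close>.\<close>

definition cf :: "'g vec \<Rightarrow> nat \<Rightarrow> 'a" where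
  "cf u j = \<chi> (- qf m u u - 2 * (\<Sum>t<m. u $ (m + t) * f j t))"

text \<open>The Schroedinger model of the Heisenberg group: the first half of u translates the basis
  vectors, the second half multiplies them by a character.\<close>

definition W :: "'g vec \<Rightarrow> 'a mat" where
  "W u = mat N0 N0 (\<lambda>(i, j). if i = shu u j then cf u j else 0)"

lemma W_carrier [simp]: "W u \<in> carrier_mat N0 N0" by (simp add: W_def)

lemma W_dim [simp]: "dim_row (W u) = N0" "dim_col (W u) = N0" by (simp_all add: W_def)

lemma shu_less: "shu u j < N0" by (simp add: shu_def sh)

lemma mult_W_index:
  assumes A: "A \<in> carrier_mat r N0" and "i < r" "j < N0"
  shows "(A * W u) $$ (i, j) = A $$ (i, shu u j) * cf u j"
proof -
  have "(A * W u) $$ (i, j) = (\<Sum>t<N0. A $$ (i, t) * W u $$ (t, j))"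
    using assms by (intro index_mult_mat_sum[OF A]) auto
  also have "\<dots> = (\<Sum>t<N0. if t = shu u j then A $$ (i, t) * cf u j else 0)"
    using assms by (intro sum.cong) (auto simp: W_def)
  also have "\<dots> = A $$ (i, shu u j) * cf u j" using shu_less by simp
  finally show ?thesis .
qed

lemma shu_add:
  assumes "u \<in> VV" "v \<in> VV"
  shows "shu u (shu v j) = shu (u + v) j"
  unfolding shu_def sh_sh using assms by (intro sh_cong) (auto simp: add.commute)

text \<open>Applying v first shifts j and contributes -2 qf v u, while expanding qf (u + v) (u + v)
  gives back qf u v + qf v u; what remains is qf u v - qf v u, the symplectic form. This accounts
  for the diagonal term and for the factor 2 in \<open>cf\<close>.\<close>

lemma cf_add:
  assumes "u \<in> VV" "v \<in> VV"
  shows "cf u (shu v j) * cf v j = \<chi> (sp m u v) * cf (u + v) j"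
proof -
  let ?F = "\<lambda>(u::'g vec) j. \<Sum>t<m. u $ (m + t) * f j t"
  have 1: "?F u (shu v j) = ?F u j + qf m v u"
    using assms by (simp add: shu_def sh qf_def sum.distrib algebra_simps)
  have 2: "?F (u + v) j = ?F u j + ?F v j" using assms by (simp add: sum.distrib algebra_simps)
  have 3: "qf m (u + v) (u + v) = qf m u u + qf m u v + qf m v u + qf m v v"
    using assms by (simp add: qf_def sum.distrib algebra_simps)
  have "(- qf m u u - 2 * ?F u (shu v j)) + (- qf m v v - 2 * ?F v j)
      = sp m u v + (- qf m (u + v) (u + v) - 2 * ?F (u + v) j)"
    unfolding 1 2 3 sp_def by (simp add: algebra_simps)
  then show ?thesis unfolding cf_def chi_add[symmetric] by simp
qed

lemma W_mult:
  assumes "u \<in> VV" "v \<in> VV"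
  shows "W u * W v = \<chi> (sp m u v) \<cdot>\<^sub>m W (u + v)"
proof (rule eq_matI)
  fix i j assume "i < dim_row (\<chi> (sp m u v) \<cdot>\<^sub>m W (u + v))" "j < dim_col (\<chi> (sp m u v) \<cdot>\<^sub>m W (u + v))"
  then have ij: "i < N0" "j < N0" by auto
  have "(W u * W v) $$ (i, j) = W u $$ (i, shu v j) * cf v j" by (rule mult_W_index) (use ij in auto)
  also have "\<dots> = (if i = shu (u + v) j then \<chi> (sp m u v) * cf (u + v) j else 0)"
    using ij shu_less[of v j] by (simp add: W_def shu_add[OF assms] cf_add[OF assms])
  also have "\<dots> = (\<chi> (sp m u v) \<cdot>\<^sub>m W (u + v)) $$ (i, j)" using ij by (simp add: W_def)
  finally show "(W u * W v) $$ (i, j) = (\<chi> (sp m u v) \<cdot>\<^sub>m W (u + v)) $$ (i, j)" .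
qed auto

lemma W_zero: "W (0\<^sub>v (2 * m)) = 1\<^sub>m N0"
proof (rule eq_matI)
  fix i j assume "i < dim_row (1\<^sub>m N0 :: 'a mat)" "j < dim_col (1\<^sub>m N0 :: 'a mat)"
  then have ij: "i < N0" "j < N0" by auto
  have "shu (0\<^sub>v (2 * m)) j = j" unfolding shu_def using ij by (intro sh_zero) auto
  moreover have "cf (0\<^sub>v (2 * m)) j = 1" by (simp add: cf_def qf_def chi_0)
  ultimately show "W (0\<^sub>v (2 * m)) $$ (i, j) = 1\<^sub>m N0 $$ (i, j)" using ij by (simp add: W_def)
qed auto

lemma W_inverse:
  assumes "u \<in> VV" shows "W u * W (- u) = 1\<^sub>m N0" "W (- u) * W u = 1\<^sub>m N0"
proof -
  have u: "- u \<in> VV" using assms by simp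
  have "sp m u (- u) = 0" using sp_uminus[OF assms, of u] sp_swap[of m "- u" u] by (simp add: sp_def)
  moreover have "u + - u = 0\<^sub>v (2 * m)" using assms by (intro eq_vecI) auto
  ultimately show 1: "W u * W (- u) = 1\<^sub>m N0" using W_mult[OF assms u] W_zero chi_0 by simp
  show "W (- u) * W u = 1\<^sub>m N0" by (rule mat_mult_left_right_inverse[OF _ _ 1]) auto
qed

text \<open>\<open>W u\<close> is monomial with entries z satisfying z * z^q = 1.\<close>

lemma W_unitary: "transpose_mat (W u) * frob_mat q (W u) = 1\<^sub>m N0"
proof (rule eq_matI)
  fix i j assume "i < dim_row (1\<^sub>m N0 :: 'a mat)" "j < dim_col (1\<^sub>m N0 :: 'a mat)"
  then have ij: "i < N0" "j < N0" by auto
  have "(transpose_mat (W u) * frob_mat q (W u)) $$ (i, j) =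
     (\<Sum>t<N0. transpose_mat (W u) $$ (i, t) * frob_mat q (W u) $$ (t, j))"
    using ij by (intro index_mult_mat_sum[of _ N0 N0 _ N0]) auto
  also have "\<dots> = (\<Sum>t<N0. if t = shu u i then (if i = j then 1 else 0) else 0)"
  proof (intro sum.cong refl)
    fix t assume "t \<in> {..<N0}"
    then show "transpose_mat (W u) $$ (i, t) * frob_mat q (W u) $$ (t, j) = (if t = shu u i then (if i = j then 1 else 0) else 0)"
      using ij q_pos chi_q sh_inj[of i j "\<lambda>t. u $ t"] by (auto simp: W_def cf_def shu_def power_0_left)
  qed
  also have "\<dots> = 1\<^sub>m N0 $$ (i, j)" using ij shu_less by simp
  finally show "(transpose_mat (W u) * frob_mat q (W u)) $$ (i, j) = 1\<^sub>m N0 $$ (i, j)" .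
qed auto

lemma W_similitude: "similitude q N0 (W u)"
  using W_unitary[of u] by (auto simp: similitude_def intro!: exI[of _ 1])

section \<open>Weyl operators tensored with an identity matrix of size k\<close>

definition T :: "nat \<Rightarrow> 'g vec \<Rightarrow> 'a mat" where "T k u = kron (W u) (1\<^sub>m k)"

lemma T_carrier [simp]: "T k u \<in> carrier_mat (N0 * k) (N0 * k)"
  unfolding T_def by (rule kron_carrier) auto

lemma T_mult:
  assumes "u \<in> VV" "v \<in> VV"
  shows "T k u * T k v = \<chi> (sp m u v) \<cdot>\<^sub>m T k (u + v)"
proof -
  have "T k u * T k v = kron (W u * W v) (1\<^sub>m k * 1\<^sub>m k)"
    unfolding T_def by (rule kron_mult[of _ N0 N0 _ N0 _ k k _ k]) auto
  then show ?thesis by (simp add: W_mult[OF assms] kron_smult_left T_def)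
qed

lemma T_zero: "T k (0\<^sub>v (2 * m)) = 1\<^sub>m (N0 * k)"
  by (simp add: T_def W_zero kron_one)

lemma T_commute:
  assumes "u \<in> VV" "v \<in> VV"
  shows "T k u * T k v = \<chi> (2 * sp m u v) \<cdot>\<^sub>m (T k v * T k u)"
proof -
  have "v + u = u + v" using assms by (intro eq_vecI) auto
  then have "T k v * T k u = \<chi> (- sp m u v) \<cdot>\<^sub>m T k (u + v)"
    using T_mult[OF assms(2,1), of k] sp_swap[of m v u] by simp
  then show ?thesis using T_mult[OF assms, of k]
    by (simp add: smult_smult_mat chi_add[symmetric])
qed

lemma T_inverse:
  assumes "u \<in> VV" shows "T k u * T k (- u) = 1\<^sub>m (N0 * k)" "T k (- u) * T k u = 1\<^sub>m (N0 * k)"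
proof -
  have "T k u * T k (- u) = kron (W u * W (- u)) (1\<^sub>m k * 1\<^sub>m k)" "T k (- u) * T k u = kron (W (- u) * W u) (1\<^sub>m k * 1\<^sub>m k)"
    unfolding T_def by (rule kron_mult[of _ N0 N0 _ N0 _ k k _ k]; auto)+
  then show "T k u * T k (- u) = 1\<^sub>m (N0 * k)" "T k (- u) * T k u = 1\<^sub>m (N0 * k)"
    using W_inverse[OF assms] by (simp_all add: kron_one)
qed

lemma mult_T_index:
  assumes A: "A \<in> carrier_mat (N0 * k) (N0 * k)" and ij: "i < N0" "j < N0" "s < k" "t < k"
  shows "(A * T k u) $$ (i * k + s, j * k + t) = A $$ (i * k + s, shu u j * k + t) * cf u j"
    "(T k u * A) $$ (shu u i * k + s, j * k + t) = cf u i * A $$ (i * k + s, j * k + t)"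
proof -
  have Ti: "T k u $$ (l * k + r, j * k + t) = (if l = shu u j \<and> r = t then cf u j else 0)"
    if "l < N0" "r < k" "j < N0" "t < k" for l r j t
    unfolding T_def using that by (subst kron_index[of _ N0 N0 _ k k]) (auto simp: W_def)
  have "(A * T k u) $$ (i * k + s, j * k + t) = (\<Sum>l<N0. \<Sum>r<k. A $$ (i * k + s, l * k + r) * T k u $$ (l * k + r, j * k + t))"
    using ij by (subst index_mult_mat_sum[OF A T_carrier]) (auto simp: pair_index_less sum_lessThan_mult)
  also have "\<dots> = (\<Sum>l<N0. \<Sum>r<k. if r = t then (if l = shu u j then A $$ (i * k + s, l * k + t) * cf u j else 0) else 0)"
    using ij by (intro sum.cong refl) (simp add: Ti)
  also have "\<dots> = (\<Sum>l<N0. if l = shu u j then A $$ (i * k + s, l * k + t) * cf u j else 0)" using ij by simp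
  also have "\<dots> = A $$ (i * k + s, shu u j * k + t) * cf u j" using shu_less by simp
  finally show "(A * T k u) $$ (i * k + s, j * k + t) = A $$ (i * k + s, shu u j * k + t) * cf u j" .
  have "(T k u * A) $$ (shu u i * k + s, j * k + t) = (\<Sum>l<N0. \<Sum>r<k. T k u $$ (shu u i * k + s, l * k + r) * A $$ (l * k + r, j * k + t))"
    using ij shu_less by (subst index_mult_mat_sum[OF T_carrier A]) (auto simp: pair_index_less sum_lessThan_mult)
  also have "\<dots> = (\<Sum>l<N0. \<Sum>r<k. if r = s then (if l = i then cf u l * A $$ (l * k + s, j * k + t) else 0) else 0)"
  proof (intro sum.cong refl)
    fix l r assume "l \<in> {..<N0}" "r \<in> {..<k}"
    then show "T k u $$ (shu u i * k + s, l * k + r) * A $$ (l * k + r, j * k + t) =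
      (if r = s then (if l = i then cf u l * A $$ (l * k + s, j * k + t) else 0) else 0)"
      using Ti[of "shu u i" s l r] ij shu_less sh_inj[of i l "\<lambda>t. u $ t"] by (auto simp: shu_def)
  qed
  also have "\<dots> = (\<Sum>l<N0. if l = i then cf u l * A $$ (l * k + s, j * k + t) else 0)" using ij by simp
  also have "\<dots> = cf u i * A $$ (i * k + s, j * k + t)" using ij by simp
  finally show "(T k u * A) $$ (shu u i * k + s, j * k + t) = cf u i * A $$ (i * k + s, j * k + t)" .
qed

text \<open>View A as an array of k by k blocks. Translations carry block (0, 0) to every diagonal
  block, so these are all equal; the diagonal operators have different phases at two different
  indices, so off-diagonal blocks vanish.\<close>

lemma commutant:
  assumes A: "A \<in> carrier_mat (N0 * k) (N0 * k)" and comm: "\<And>u. u \<in> VV \<Longrightarrow> A * T k u = T k u * A"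
  shows "\<exists>B \<in> carrier_mat k k. A = kron (1\<^sub>m N0) B"
proof
  have key: "A $$ (shu u i * k + s, shu u j * k + t) * cf u j = cf u i * A $$ (i * k + s, j * k + t)"
    if "u \<in> VV" "i < N0" "j < N0" "s < k" "t < k" for u i j s t
    using mult_T_index[OF A, of "shu u i" j s t u] mult_T_index[OF A, of i j s t u] comm[OF that(1)] that shu_less by simp
  define B where "B = mat k k (\<lambda>(s, t). A $$ (s, t))"
  show Bc: "B \<in> carrier_mat k k" by (simp add: B_def)
  show "A = kron (1\<^sub>m N0) B"
  proof (rule eq_mat_pairI[OF A])
    show "kron (1\<^sub>m N0) B \<in> carrier_mat (N0 * k) (N0 * k)" using Bc by simp
    fix i j s t assume ij: "i < N0" "j < N0" "s < k" "t < k"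
    have K: "kron (1\<^sub>m N0) B $$ (i * k + s, j * k + t) = (if i = j then B $$ (s, t) else 0)"
      using ij Bc by (subst kron_index[of _ N0 N0 _ k k]) auto
    show "A $$ (i * k + s, j * k + t) = kron (1\<^sub>m N0) B $$ (i * k + s, j * k + t)"
    proof (cases "i = j")
      case True
      \<comment> \<open>Chosen so that translation by u takes index 0 to index i; its second half is
        zero, so the phase is constant.\<close>
      define u where "u = vec (2 * m) (\<lambda>r. if r < m then f i r - f 0 r else 0)"
      have u: "u \<in> VV" by (simp add: u_def)
      have "shu u 0 = i" unfolding shu_def by (rule sh_eqI) (use ij in \<open>auto simp: u_def\<close>)
      moreover have "cf u j = cf u 0"
      proof -
        have "(\<Sum>t<m. u $ (m + t) * f j t) = 0" "(\<Sum>t<m. u $ (m + t) * f 0 t) = 0"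
          by (auto simp: u_def intro!: sum.neutral)
        then show ?thesis unfolding cf_def by metis
      qed
      moreover have "A $$ (shu u 0 * k + s, shu u 0 * k + t) * cf u 0 = cf u 0 * A $$ (0 * k + s, 0 * k + t)"
        using key[OF u N0_pos N0_pos ij(3,4)] .
      ultimately have "A $$ (i * k + s, i * k + t) = A $$ (s, t)" using chi_nz by (simp add: cf_def)
      then show ?thesis using K True ij by (simp add: B_def)
    next
      case False
      then obtain r where r: "r < m" "f i r \<noteq> f j r" using f_inj[OF ij(1,2)] by blast
      \<comment> \<open>The operator of this u is diagonal, with phase at l equal to \<chi>(- 2 * f
        l r) up to a common factor; r is a coordinate where i and j differ.\<close>
      define u :: "'g vec" where "u = unit_vec (2 * m) (m + r)"
      have u: "u \<in> VV" by (simp add: u_def)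
      have id: "shu u l = l" if "l < N0" for l
        unfolding shu_def using that r by (intro sh_zero) (auto simp: u_def)
      have F: "(\<Sum>t<m. u $ (m + t) * f l t) = f l r" for l
      proof -
        have "(\<Sum>t<m. u $ (m + t) * f l t) = (\<Sum>t<m. if t = r then f l t else 0)"
          using r by (intro sum.cong) (auto simp: u_def)
        then show ?thesis using r by simp
      qed
      have "cf u i \<noteq> cf u j"
        unfolding cf_def F chi_eq_iff using r two_nz by simp
      moreover have "A $$ (i * k + s, j * k + t) * cf u j = cf u i * A $$ (i * k + s, j * k + t)"
        using key[OF u ij] id ij by simp
      ultimately have "A $$ (i * k + s, j * k + t) = 0" by (simp add: mult.commute)
      then show ?thesis using K False by simp
    qed
  qed
qed

lemma W_schur:
  assumes A: "A \<in> carrier_mat N0 N0" and comm: "\<And>u. u \<in> VV \<Longrightarrow> A * W u = W u * A"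
  shows "\<exists>c. A = c \<cdot>\<^sub>m 1\<^sub>m N0"
proof -
  have T1: "T 1 u = W u" for u
    unfolding T_def kron_def by (intro eq_matI) auto
  obtain B where B: "B \<in> carrier_mat 1 1" "A = kron (1\<^sub>m N0) B" using commutant[of A 1] A comm T1 by auto
  have "kron (1\<^sub>m N0) B = B $$ (0, 0) \<cdot>\<^sub>m 1\<^sub>m N0"
    using B(1) unfolding kron_def by (intro eq_matI) auto
  then show ?thesis using B by blast
qed

section \<open>Uniqueness of the Weyl relations in dimension p^m\<close>

definition jn :: "(nat \<Rightarrow> 'g) \<Rightarrow> (nat \<Rightarrow> 'g) \<Rightarrow> 'g vec" where
  "jn a b = vec (2 * m) (\<lambda>i. if i < m then a i else b (i - m))"

lemma jn_carrier [simp]: "jn a b \<in> VV" by (simp add: jn_def)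

lemma jn_index: "i < m \<Longrightarrow> jn a b $ i = a i" "i < m \<Longrightarrow> jn a b $ (m + i) = b i"
  by (auto simp: jn_def)

lemma jn_add: "jn a b + jn a' b' = jn (\<lambda>i. a i + a' i) (\<lambda>i. b i + b' i)"
  by (intro eq_vecI) (auto simp: jn_def)

lemma jn_cong: "(\<And>i. i < m \<Longrightarrow> a i = a' i) \<Longrightarrow> (\<And>i. i < m \<Longrightarrow> b i = b' i) \<Longrightarrow> jn a b = jn a' b'"
  by (intro eq_vecI) (auto simp: jn_def)

lemma jn_split: "u \<in> VV \<Longrightarrow> u = jn (\<lambda>t. u $ t) (\<lambda>t. u $ (m + t))"
  by (intro eq_vecI) (auto simp: jn_def)

lemma jn_zero: "jn (\<lambda>_. 0) (\<lambda>_. 0) = 0\<^sub>v (2 * m)"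
  by (intro eq_vecI) (auto simp: jn_def)

lemma sp_jn: "sp m (jn a b) (jn a' b') = (\<Sum>i<m. a i * b' i) - (\<Sum>i<m. a' i * b i)"
  by (simp add: sp_def qf_def jn_index)

text \<open>A single vector fixed by the operators \<open>W' (0, b)\<close> generates the whole representation; its
  translates under the \<open>W' (a, 0)\<close> are the columns of the intertwiner.\<close>

lemma intertwiner:
  assumes W'c: "\<And>u. u \<in> VV \<Longrightarrow> W' u \<in> carrier_mat N0 N0"
    and W'm: "\<And>u v. u \<in> VV \<Longrightarrow> v \<in> VV \<Longrightarrow> W' u * W' v = \<chi> (sp m u v) \<cdot>\<^sub>m W' (u + v)"
    and W'0: "W' (0\<^sub>v (2 * m)) = 1\<^sub>m N0"
  shows "\<exists>G \<in> carrier (GL N0). \<forall>u\<in>VV. W' u * G = G * W u"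
proof -
  \<comment> \<open>\<open>x\<close> and \<open>z\<close> are the translation part and the character
    part: every \<open>W' u\<close> is a scalar multiple of some \<open>x a * z b\<close>.\<close>
  define x where "x a = W' (jn a (\<lambda>_. 0))" for a
  define z where "z b = W' (jn (\<lambda>_. 0) b)" for b
  have xc [simp]: "x a \<in> carrier_mat N0 N0" and zc [simp]: "z b \<in> carrier_mat N0 N0" for a b
    using W'c by (auto simp: x_def z_def)
  note ac = assoc_mult_mat[of _ N0 N0 _ N0 _ N0] mult_carrier_mat[of _ N0 N0 _ N0]
  note sm = mult_smult_assoc_mat[of _ N0 N0 _ N0] mult_smult_distrib[of _ N0 N0 _ N0] smult_smult_mat
  have zz: "z b * z b' = z (\<lambda>i. b i + b' i)" for b b'
    unfolding z_def by (subst W'm) (auto simp: sp_jn jn_add chi_0)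
  have xx: "x a * x a' = x (\<lambda>i. a i + a' i)" for a a'
    unfolding x_def by (subst W'm) (auto simp: sp_jn jn_add chi_0)
  have x0: "x a = 1\<^sub>m N0" if "\<And>i. i < m \<Longrightarrow> a i = 0" for a
  proof -
    have "jn a (\<lambda>_. 0) = 0\<^sub>v (2 * m)" unfolding jn_zero[symmetric] using that by (intro jn_cong) auto
    then show ?thesis by (simp add: x_def W'0)
  qed
  have z0: "z a = 1\<^sub>m N0" if "\<And>i. i < m \<Longrightarrow> a i = 0" for a
  proof -
    have "jn (\<lambda>_. 0) a = 0\<^sub>v (2 * m)" unfolding jn_zero[symmetric] using that by (intro jn_cong) auto
    then show ?thesis by (simp add: z_def W'0)
  qed
  have xz: "x a * z b = \<chi> (\<Sum>i<m. a i * b i) \<cdot>\<^sub>m W' (jn a b)" for a b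
    unfolding x_def z_def by (subst W'm) (auto simp: sp_jn jn_add)
  have zx: "z b * x a = \<chi> (- 2 * (\<Sum>i<m. a i * b i)) \<cdot>\<^sub>m (x a * z b)" for a b
  proof -
    have "z b * x a = \<chi> (- (\<Sum>i<m. a i * b i)) \<cdot>\<^sub>m W' (jn a b)"
      unfolding x_def z_def by (subst W'm) (auto simp: sp_jn jn_add)
    then show ?thesis unfolding xz by (simp add: smult_smult_mat chi_add[symmetric])
  qed
  \<comment> \<open>The average of all \<open>z b\<close>, that is, the projection onto the vectors
    fixed by every one of them.\<close>
  define P where "P = msum N0 {..<N0} (\<lambda>j. inverse (of_nat N0) \<cdot>\<^sub>m z (f j))"
  have Pc [simp]: "P \<in> carrier_mat N0 N0" by (simp add: P_def)
  have zsh: "z b * z (f j) = z (f (sh b j))" for b j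
    unfolding zz unfolding z_def by (rule arg_cong[where f = W'], rule jn_cong) (auto simp: sh add.commute)
  have zP: "z b * P = P" for b
  proof -
    have "z b * P = msum N0 {..<N0} (\<lambda>j. z b * (inverse (of_nat N0) \<cdot>\<^sub>m z (f j)))"
      unfolding P_def by (rule mult_msum) auto
    also have "\<dots> = msum N0 {..<N0} (\<lambda>j. inverse (of_nat N0) \<cdot>\<^sub>m z (f (sh b j)))"
      by (rule msum_cong) (simp add: sm zsh)
    also have "\<dots> = P" unfolding P_def by (rule msum_reindex[OF sh_bij, symmetric])
    finally show ?thesis .
  qed
  have Pz: "P * z b = P" for b
  proof -
    have "z (f j) * z b = z b * z (f j)" for j unfolding zz by (simp add: add.commute)
    then have "z b * P = P * z b" unfolding P_def by (intro msum_commute) (auto simp: sm)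
    then show ?thesis using zP by simp
  qed
  have PP: "P * P = P"
  proof -
    have "P * P = msum N0 {..<N0} (\<lambda>j. inverse (of_nat N0) \<cdot>\<^sub>m z (f j) * P)"
      by (subst (1) P_def, rule msum_mult) auto
    also have "\<dots> = msum N0 {..<N0} (\<lambda>j. inverse (of_nat N0) \<cdot>\<^sub>m P)"
      by (rule msum_cong) (simp add: sm zP)
    also have "\<dots> = (\<Sum>j<N0. inverse (of_nat N0)) \<cdot>\<^sub>m P" by (rule msum_smult_const) simp
    also have "(\<Sum>j<N0. inverse (of_nat N0)) = (1::'a)" using N0_nz by simp
    finally show ?thesis by simp
  qed
  \<comment> \<open>With b the i-th unit vector, \<open>x a\<close> carries fixed vectors to vectors
    on which \<open>z b\<close> acts by \<chi>(- 2 * a i). This is not 1, so they have no component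
    in the image of P.\<close>
  have PxP: "P * x a * P = 0\<^sub>m N0 N0" if "i < m" "a i \<noteq> 0" for a i
  proof -
    define b where "b t = (if t = i then 1 else 0 :: 'g)" for t
    have ab: "(\<Sum>t<m. a t * b t) = a i" using that by (simp add: b_def if_distrib cong: if_cong)
    define c where "c = \<chi> (- 2 * a i)"
    have c1: "c \<noteq> 1" unfolding c_def chi_1 using that two_nz by simp
    have "P * x a * P = P * (z b * x a) * P" using Pz[of b] by (simp add: ac flip: assoc_mult_mat[of P N0 N0 "z b" N0 "x a * P" N0])
    also have "\<dots> = c \<cdot>\<^sub>m (P * (x a * z b) * P)" unfolding zx ab c_def by (simp add: sm ac)
    also have "P * (x a * z b) * P = P * x a * P" by (simp add: ac zP)
    finally have eq: "P * x a * P = c \<cdot>\<^sub>m (P * x a * P)" .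
    show ?thesis
    proof (rule eq_matI)
      fix r s assume "r < dim_row (0\<^sub>m N0 N0 :: 'a mat)" "s < dim_col (0\<^sub>m N0 N0 :: 'a mat)"
      then have rs: "r < N0" "s < N0" by auto
      have carr: "P * x a * P \<in> carrier_mat N0 N0" by (simp add: ac)
      have "(P * x a * P) $$ (r, s) = c * (P * x a * P) $$ (r, s)"
        using rs carr by (subst (1) eq) (simp del: index_mult_mat)
      then have "(P * x a * P) $$ (r, s) = 0" using c1 by (metis mult_cancel_right1)
      then show "(P * x a * P) $$ (r, s) = 0\<^sub>m N0 N0 $$ (r, s)" using rs by simp
    qed (auto simp: P_def)
  qed
  \<comment> \<open>The conjugates of P by the \<open>x (f i)\<close> are the projections onto all
    joint eigenspaces of the \<open>z b\<close> and add up to 1, so P cannot vanish.\<close>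
  have P0: "P \<noteq> 0\<^sub>m N0 N0"
  proof
    assume P0: "P = 0\<^sub>m N0 N0"
    have conj: "x (f i) * z b * x (\<lambda>t. - f i t) = \<chi> (2 * (\<Sum>t<m. f i t * b t)) \<cdot>\<^sub>m z b" for i b
    proof -
      have "x (f i) * z b * x (\<lambda>t. - f i t) = x (f i) * (z b * x (\<lambda>t. - f i t))" by (simp add: ac)
      also have "\<dots> = \<chi> (2 * (\<Sum>t<m. f i t * b t)) \<cdot>\<^sub>m ((x (f i) * x (\<lambda>t. - f i t)) * z b)"
        unfolding zx by (simp add: sm ac sum_negf)
      also have "x (f i) * x (\<lambda>t. - f i t) = 1\<^sub>m N0" unfolding xx by (rule x0) simp
      finally show ?thesis by (simp add: left_mult_one_mat[of _ N0 N0])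
    qed
    have "msum N0 {..<N0} (\<lambda>i. x (f i) * P * x (\<lambda>t. - f i t)) = 0\<^sub>m N0 N0"
      unfolding P0 by (intro eq_matI) (auto simp: msum_index left_mult_zero_mat[of _ N0 N0] right_mult_zero_mat[of _ N0 N0] intro!: sum.neutral)
    moreover have "msum N0 {..<N0} (\<lambda>i. x (f i) * P * x (\<lambda>t. - f i t)) = 1\<^sub>m N0"
    proof -
      have "x (f i) * P * x (\<lambda>t. - f i t) =
        msum N0 {..<N0} (\<lambda>j. (inverse (of_nat N0) * \<chi> (2 * (\<Sum>t<m. f i t * f j t))) \<cdot>\<^sub>m z (f j))" for i
      proof -
        have "x (f i) * P = msum N0 {..<N0} (\<lambda>j. x (f i) * (inverse (of_nat N0) \<cdot>\<^sub>m z (f j)))"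
          unfolding P_def by (rule mult_msum) auto
        also have "\<dots> * x (\<lambda>t. - f i t) = msum N0 {..<N0} (\<lambda>j. x (f i) * (inverse (of_nat N0) \<cdot>\<^sub>m z (f j)) * x (\<lambda>t. - f i t))"
          by (rule msum_mult) (auto simp: ac)
        also have "\<dots> = msum N0 {..<N0} (\<lambda>j. (inverse (of_nat N0) * \<chi> (2 * (\<Sum>t<m. f i t * f j t))) \<cdot>\<^sub>m z (f j))"
        proof (rule msum_cong)
          fix j
          have "x (f i) * (inverse (of_nat N0) \<cdot>\<^sub>m z (f j)) * x (\<lambda>t. - f i t) =
            inverse (of_nat N0) \<cdot>\<^sub>m (x (f i) * z (f j) * x (\<lambda>t. - f i t))"
            using mult_smult_distrib[OF xc zc, of "f i" "inverse (of_nat N0)" "f j"]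
              mult_smult_assoc_mat[OF mult_carrier_mat[OF xc zc] xc, of "inverse (of_nat N0)" "f i" "f j"] by simp
          then show "x (f i) * (inverse (of_nat N0) \<cdot>\<^sub>m z (f j)) * x (\<lambda>t. - f i t) =
            (inverse (of_nat N0) * \<chi> (2 * (\<Sum>t<m. f i t * f j t))) \<cdot>\<^sub>m z (f j)"
            unfolding conj smult_smult_mat .
        qed
        finally show ?thesis .
      qed
      then have "msum N0 {..<N0} (\<lambda>i. x (f i) * P * x (\<lambda>t. - f i t)) =
        msum N0 {..<N0} (\<lambda>i. msum N0 {..<N0} (\<lambda>j. (inverse (of_nat N0) * \<chi> (2 * (\<Sum>t<m. f i t * f j t))) \<cdot>\<^sub>m z (f j)))"
        by (simp only:)
      also have "\<dots> = msum N0 {..<N0} (\<lambda>j. msum N0 {..<N0} (\<lambda>i. (inverse (of_nat N0) * \<chi> (2 * (\<Sum>t<m. f i t * f j t))) \<cdot>\<^sub>m z (f j)))"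
        by (rule msum_swap)
      also have "\<dots> = msum N0 {..<N0} (\<lambda>j. (\<Sum>i<N0. inverse (of_nat N0) * \<chi> (2 * (\<Sum>t<m. f i t * f j t))) \<cdot>\<^sub>m z (f j))"
        by (intro msum_cong msum_smult_const) auto
      also have "\<dots> = 1\<^sub>m N0"
      proof -
        \<comment> \<open>The coefficient at j is the sum over i of a character of f i, which is
          trivial only when f j is the zero vector, so only its index \<open>j0\<close>
          survives.\<close>
        obtain j0 where j0: "j0 < N0" "\<forall>t<m. f j0 t = 0" using f_surj[of "\<lambda>_. 0"] by auto
        have "(\<Sum>i<N0. inverse (of_nat N0) * \<chi> (2 * (\<Sum>t<m. f i t * f j t))) \<cdot>\<^sub>m z (f j) = 0\<^sub>m N0 N0"
          if j: "j < N0" "j \<noteq> j0" for j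
        proof -
          obtain r where r: "r < m" "f j r \<noteq> 0" using f_inj[OF j(1) j0(1)] j(2) j0(2) by metis
          define a where "a t = (if t = r then 1 else 0 :: 'g)" for t
          have "(\<Sum>t<m. a t * f j t) = (\<Sum>t<m. if t = r then f j t else 0)"
            by (intro sum.cong) (auto simp: a_def)
          then have aj: "(\<Sum>t<m. a t * f j t) = f j r" using r by simp
          let ?s = "\<lambda>i. \<chi> (2 * (\<Sum>t<m. f i t * f j t))"
          have "(\<Sum>i<N0. ?s i) = (\<Sum>i<N0. ?s (sh a i))" by (rule sum.reindex_bij_betw[OF sh_bij, symmetric])
          also have "\<dots> = (\<Sum>i<N0. \<chi> (2 * f j r) * ?s i)"
          proof (intro sum.cong refl)
            fix i
            have "(\<Sum>t<m. f (sh a i) t * f j t) = (\<Sum>t<m. f i t * f j t) + (\<Sum>t<m. a t * f j t)"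
              by (simp add: sh sum.distrib algebra_simps)
            then show "?s (sh a i) = \<chi> (2 * f j r) * ?s i" unfolding chi_add[symmetric] aj by (simp add: algebra_simps)
          qed
          also have "\<dots> = \<chi> (2 * f j r) * (\<Sum>i<N0. ?s i)" by (rule sum_distrib_left[symmetric])
          finally have "(\<Sum>i<N0. ?s i) = \<chi> (2 * f j r) * (\<Sum>i<N0. ?s i)" .
          moreover have "\<chi> (2 * f j r) \<noteq> 1" unfolding chi_1 using r two_nz by simp
          ultimately have "(\<Sum>i<N0. ?s i) = 0" by (simp only: mult_cancel_right1) blast
          then have "(\<Sum>i<N0. inverse (of_nat N0) * ?s i) = 0" by (simp add: sum_distrib_left[symmetric])
          then show ?thesis by (simp add: zero_smult_mat)
        qed
        then have "msum N0 {..<N0} (\<lambda>j. (\<Sum>i<N0. inverse (of_nat N0) * \<chi> (2 * (\<Sum>t<m. f i t * f j t))) \<cdot>\<^sub>m z (f j)) =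
          (\<lambda>j. (\<Sum>i<N0. inverse (of_nat N0) * \<chi> (2 * (\<Sum>t<m. f i t * f j t))) \<cdot>\<^sub>m z (f j)) j0"
          using j0 by (intro msum_single) auto
        also have "\<dots> = 1\<^sub>m N0" using j0(2) z0[of "f j0"] N0_nz by (simp add: chi_0)
        finally show ?thesis .
      qed
      finally show ?thesis .
    qed
    ultimately have "0\<^sub>m N0 N0 = (1\<^sub>m N0 :: 'a mat)" by simp
    then have "0\<^sub>m N0 N0 $$ (0, 0) = (1\<^sub>m N0 :: 'a mat) $$ (0, 0)" by simp
    then show False using N0_pos by simp
  qed
  then obtain r s where rs: "r < N0" "s < N0" "P $$ (r, s) \<noteq> 0"
    using Pc by (metis carrier_matD eq_matI index_zero_mat)
  \<comment> \<open>Column s of P is a nonzero fixed vector, and the columns of \<open>G\<close> are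
    its translates. \<open>H\<close> is built from row r and divided by the entry at (r, s), so that
    \<open>PxP\<close> and \<open>P * P = P\<close> make it a left inverse.\<close>
  define G where "G = mat N0 N0 (\<lambda>(i, j). (x (f j) * P) $$ (i, s))"
  define H where "H = mat N0 N0 (\<lambda>(i, j). (P * x (\<lambda>t. - f i t)) $$ (r, j) / P $$ (r, s))"
  have Gc: "G \<in> carrier_mat N0 N0" and Hc: "H \<in> carrier_mat N0 N0" by (auto simp: G_def H_def)
  have "H * G = 1\<^sub>m N0"
  proof (rule eq_matI)
    fix i j assume "i < dim_row (1\<^sub>m N0 :: 'a mat)" "j < dim_col (1\<^sub>m N0 :: 'a mat)"
    then have ij: "i < N0" "j < N0" by auto
    have "(H * G) $$ (i, j) = (\<Sum>t<N0. H $$ (i, t) * G $$ (t, j))" by (rule index_mult_mat_sum[OF Hc Gc ij])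
    also have "\<dots> = (\<Sum>t<N0. (P * x (\<lambda>t. - f i t)) $$ (r, t) * (x (f j) * P) $$ (t, s)) / P $$ (r, s)"
      using ij unfolding sum_divide_distrib by (intro sum.cong refl) (simp add: G_def H_def del: index_mult_mat)
    also have "(\<Sum>t<N0. (P * x (\<lambda>t. - f i t)) $$ (r, t) * (x (f j) * P) $$ (t, s)) =
      ((P * x (\<lambda>t. - f i t)) * (x (f j) * P)) $$ (r, s)"
      by (rule index_mult_mat_sum[symmetric]) (use rs in \<open>auto simp: ac\<close>)
    also have "(P * x (\<lambda>t. - f i t)) * (x (f j) * P) = P * (x (\<lambda>t. - f i t) * x (f j)) * P" by (simp add: ac)
    also have "x (\<lambda>t. - f i t) * x (f j) = x (\<lambda>t. - f i t + f j t)" by (rule xx)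
    also have "(P * x (\<lambda>t. - f i t + f j t) * P) $$ (r, s) / P $$ (r, s) = 1\<^sub>m N0 $$ (i, j)"
    proof (cases "i = j")
      case True
      then have "x (\<lambda>t. - f i t + f j t) = 1\<^sub>m N0" by (intro x0) simp
      then show ?thesis using True ij rs PP by (simp add: right_mult_one_mat[of _ N0 N0])
    next
      case False
      then obtain l where "l < m" "f i l \<noteq> f j l" using f_inj[OF ij] by blast
      then have "P * x (\<lambda>t. - f i t + f j t) * P = 0\<^sub>m N0 N0" by (intro PxP[of l]) auto
      then show ?thesis using False ij rs by simp
    qed
    finally show "(H * G) $$ (i, j) = 1\<^sub>m N0 $$ (i, j)" .
  qed (use Gc Hc in auto)
  then have GG: "G \<in> carrier (GL N0)" using GL_I[OF Hc Gc] by simp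
  moreover have "W' u * G = G * W u" if u: "u \<in> VV" for u
  proof (rule eq_matI)
    fix i j assume "i < dim_row (G * W u)" "j < dim_col (G * W u)"
    then have ij: "i < N0" "j < N0" using Gc by auto
    define a where "a t = u $ t" for t
    define b where "b t = u $ (m + t)" for t
    have ujn: "u = jn a b" unfolding a_def b_def by (rule jn_split[OF u])
    have "(W' u * G) $$ (i, j) = (\<Sum>t<N0. W' u $$ (i, t) * G $$ (t, j))" by (rule index_mult_mat_sum[OF W'c[OF u] Gc ij])
    also have "\<dots> = (\<Sum>t<N0. W' u $$ (i, t) * (x (f j) * P) $$ (t, s))"
      using ij by (intro sum.cong refl) (simp add: G_def del: index_mult_mat)
    also have "\<dots> = (W' u * (x (f j) * P)) $$ (i, s)"
      by (rule index_mult_mat_sum[symmetric]) (use ij rs W'c[OF u] in \<open>auto simp: ac\<close>)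
    \<comment> \<open>The accumulated phase is exactly \<open>cf u j\<close>: \<open>W' u\<close>
      permutes and scales the columns of \<open>G\<close> as \<open>W u\<close> does the basis
      vectors.\<close>
    also have "W' u * (x (f j) * P) = cf u j \<cdot>\<^sub>m (x (f (shu u j)) * P)"
    proof -
      let ?c = "\<lambda>i. a i + f j i"
      have xsh: "x (f (shu u j)) = x ?c" unfolding x_def
        by (rule arg_cong[where f = W'], rule jn_cong) (auto simp: shu_def sh a_def add.commute)
      have "W' u * x (f j) = \<chi> (- (\<Sum>i<m. f j i * b i)) \<cdot>\<^sub>m W' (jn ?c b)"
        unfolding x_def ujn by (subst W'm) (auto simp: sp_jn jn_add)
      moreover have "W' (jn ?c b) = \<chi> (- (\<Sum>i<m. ?c i * b i)) \<cdot>\<^sub>m (x ?c * z b)"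
        unfolding xz by (simp add: smult_smult_mat chi_add[symmetric] chi_0)
      ultimately have "W' u * x (f j) = \<chi> (- (\<Sum>i<m. f j i * b i) - (\<Sum>i<m. ?c i * b i)) \<cdot>\<^sub>m (x ?c * z b)"
        by (simp add: smult_smult_mat chi_add[symmetric])
      moreover have "- (\<Sum>i<m. f j i * b i) - (\<Sum>i<m. ?c i * b i) = - qf m u u - 2 * (\<Sum>t<m. u $ (m + t) * f j t)"
        by (simp add: qf_def a_def b_def sum.distrib algebra_simps)
      ultimately have "W' u * x (f j) = cf u j \<cdot>\<^sub>m (x ?c * z b)" by (simp add: cf_def)
      moreover have "W' u * (x (f j) * P) = W' u * x (f j) * P" using W'c[OF u] by (simp add: ac)
      ultimately show ?thesis unfolding xsh by (simp add: sm ac zP)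
    qed
    also have "(cf u j \<cdot>\<^sub>m (x (f (shu u j)) * P)) $$ (i, s) = cf u j * (x (f (shu u j)) * P) $$ (i, s)"
    proof -
      have "x (f (shu u j)) * P \<in> carrier_mat N0 N0" by (simp add: ac)
      then show ?thesis using ij rs by (simp del: index_mult_mat)
    qed
    also have "\<dots> = (G * W u) $$ (i, j)"
      using mult_W_index[OF Gc ij] ij shu_less[of u j] by (simp add: G_def mult.commute del: index_mult_mat)
    finally show "(W' u * G) $$ (i, j) = (G * W u) $$ (i, j)" .
  qed (use Gc W'c[OF u] in auto)
  ultimately show ?thesis by blast
qed

lemma Sp_intertwiner:
  assumes s: "s \<in> carrier (Sp m :: 'g mat monoid)"
  shows "\<exists>G. similitude q N0 G \<and> (\<forall>u\<in>VV. W (s *\<^sub>v u) * G = G * W u)"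
proof -
  have sc: "s \<in> carrier_mat (2 * m) (2 * m)" using s by simp
  have sV: "s *\<^sub>v u \<in> VV" if "u \<in> VV" for u using sc that by auto
  have spp: "sp m (s *\<^sub>v u) (s *\<^sub>v v) = sp m u v" if "u \<in> VV" "v \<in> VV" for u v
    using Sp_iff_sp[OF sc] s that by blast
  have "\<exists>G \<in> carrier (GL N0). \<forall>u\<in>VV. W (s *\<^sub>v u) * G = G * W u"
  proof (rule intertwiner)
    show "W (s *\<^sub>v u) * W (s *\<^sub>v v) = \<chi> (sp m u v) \<cdot>\<^sub>m W (s *\<^sub>v (u + v))" if "u \<in> VV" "v \<in> VV" for u v
      using W_mult[OF sV[OF that(1)] sV[OF that(2)]] spp[OF that] mult_add_distrib_mat_vec[OF sc that] by simp
    have "s *\<^sub>v 0\<^sub>v (2 * m) = 0\<^sub>v (2 * m)" using sc by (intro eq_vecI) auto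
    then show "W (s *\<^sub>v 0\<^sub>v (2 * m)) = 1\<^sub>m N0" by (simp add: W_zero)
  qed auto
  then obtain G where G: "G \<in> carrier (GL N0)" and int: "\<And>u. u \<in> VV \<Longrightarrow> W (s *\<^sub>v u) * G = G * W u" by blast
  have Gc: "G \<in> carrier_mat N0 N0" using G by simp
  note ac = assoc_mult_mat[of _ N0 N0 _ N0 _ N0] mult_carrier_mat[of _ N0 N0 _ N0]
  let ?F = "\<lambda>u. frob_mat q (W u)" and ?tr = transpose_mat
  have Fc: "?F u \<in> carrier_mat N0 N0" for u by simp
  have FW: "?F u * ?tr (W u) = 1\<^sub>m N0" for u by (rule mat_mult_left_right_inverse[OF _ _ W_unitary]) auto
  \<comment> \<open>\<open>h\<close> measures how far G is from being unitary. Unitarity of both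
    families \<open>W u\<close> and \<open>W (s u)\<close> makes it commute with the Frobenius
    twists of the \<open>W u\<close>.\<close>
  define h where "h = ?tr G * frob_mat q G"
  have hc: "h \<in> carrier_mat N0 N0" using Gc by (simp add: h_def ac)
  have hF: "?F u * h = h * ?F u" if u: "u \<in> VV" for u
  proof -
    let ?v = "s *\<^sub>v u"
    have 1: "?F ?v * frob_mat q G = frob_mat q G * ?F u"
      using arg_cong[OF int[OF u], of "frob_mat q"] frob_mat_mult[OF W_carrier Gc] frob_mat_mult[OF Gc W_carrier] by simp
    have 2: "?tr G * ?tr (W ?v) = ?tr (W u) * ?tr G"
      using arg_cong[OF int[OF u], of ?tr] transpose_mult[OF W_carrier Gc] transpose_mult[OF Gc W_carrier] by simp
    have "?F u * ?tr G = ?F u * ?tr G * (?tr (W ?v) * ?F ?v)" using Gc by (simp add: W_unitary ac)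
    also have "\<dots> = ?F u * (?tr G * ?tr (W ?v)) * ?F ?v" using Gc by (simp add: ac)
    also have "\<dots> = (?F u * ?tr (W u)) * (?tr G * ?F ?v)" unfolding 2 using Gc by (simp add: ac)
    also have "\<dots> = ?tr G * ?F ?v" unfolding FW using Gc by (simp add: ac)
    finally have 3: "?F u * ?tr G = ?tr G * ?F ?v" .
    have "?F u * h = (?F u * ?tr G) * frob_mat q G" unfolding h_def using Gc by (simp add: ac)
    also have "\<dots> = ?tr G * (?F ?v * frob_mat q G)" unfolding 3 using Gc by (simp add: ac)
    also have "\<dots> = h * ?F u" unfolding 1 h_def using Gc by (simp add: ac)
    finally show ?thesis .
  qed
  \<comment> \<open>By unitarity the twist of \<open>W (- u)\<close> is the transpose of
    \<open>W u\<close>. Transposing the commutation with h therefore gives one with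
    \<open>W u\<close> itself, as \<open>W_schur\<close> requires.\<close>
  have Ftr: "?F (- u) = ?tr (W u)" if u: "u \<in> VV" for u
  proof -
    have "?tr (W (- u)) * ?tr (W u) = 1\<^sub>m N0"
      using transpose_mult[OF W_carrier W_carrier, of u "- u"] W_inverse(1)[OF u] by simp
    then have "?F (- u) * (?tr (W (- u)) * ?tr (W u)) = ?F (- u)" by (simp add: right_mult_one_mat[of _ N0 N0])
    moreover have "?F (- u) * (?tr (W (- u)) * ?tr (W u)) = ?F (- u) * ?tr (W (- u)) * ?tr (W u)" by (simp add: ac)
    ultimately show ?thesis unfolding FW by (simp add: left_mult_one_mat[of _ N0 N0])
  qed
  have "?tr h * W u = W u * ?tr h" if u: "u \<in> VV" for u
  proof -
    have "?tr (W u) * h = h * ?tr (W u)" using hF[of "- u"] Ftr[OF u] u by simp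
    then have "?tr (?tr (W u) * h) = ?tr (h * ?tr (W u))" by simp
    then show ?thesis using transpose_mult[of "?tr (W u)" N0 N0 h N0] transpose_mult[of h N0 N0 "?tr (W u)" N0] hc by simp
  qed
  then obtain c where c: "?tr h = c \<cdot>\<^sub>m 1\<^sub>m N0" using W_schur[of "?tr h"] hc by auto
  then have h: "h = c \<cdot>\<^sub>m 1\<^sub>m N0" by (metis transpose_transpose transpose_smult transpose_one)
  have "det h \<noteq> 0" unfolding h_def using G frob_mat_GL[OF G] by (simp add: det_mult[of _ N0] det_transpose[OF Gc])
  then have "c \<noteq> 0" using h N0_pos by (auto simp: det_smult)
  then have "similitude q N0 G" using Gc h unfolding similitude_def h_def by blast
  then show ?thesis using int by blast
qed

end

section \<open>Sufficiency\<close>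

lemma card_carrier_vec: "card (carrier_vec d :: 'g::finite vec set) = card (UNIV :: 'g set) ^ d"
proof -
  have "bij_betw (\<lambda>g. vec d g) ({..<d} \<rightarrow>\<^sub>E UNIV) (carrier_vec d :: 'g vec set)"
  proof (rule bij_betwI[where g = "\<lambda>v::'g vec. restrict (\<lambda>i. v $ i) {..<d}"])
    fix g :: "nat \<Rightarrow> 'g" assume g: "g \<in> {..<d} \<rightarrow>\<^sub>E UNIV"
    show "restrict (\<lambda>i. vec d g $ i) {..<d} = g"
      by (rule PiE_ext[of _ "{..<d}" "\<lambda>_. UNIV"]) (use g in auto)
  next
    fix v :: "'g vec" assume "v \<in> carrier_vec d"
    then show "vec d (restrict (\<lambda>i. v $ i) {..<d}) = v" by (intro eq_vecI) auto
  qed auto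
  from bij_betw_same_card[OF this] show ?thesis by (simp add: card_PiE)
qed

lemma mat_eq_by_vec:
  fixes A B :: "'g::field mat"
  assumes "A \<in> carrier_mat d d" "B \<in> carrier_mat d d" "\<And>u. u \<in> carrier_vec d \<Longrightarrow> A *\<^sub>v u = B *\<^sub>v u"
  shows "A = B"
proof (rule eq_matI)
  fix i j assume "i < dim_row B" "j < dim_col B"
  then have "i < d" "j < d" using assms by auto
  then show "A $$ (i, j) = B $$ (i, j)"
    using mat_entry_bilinear[OF assms(1)] mat_entry_bilinear[OF assms(2)] assms(3)[of "unit_vec d j"] by simp
qed (use assms in auto)

lemma diagonal_mat_commute:
  fixes A B :: "'a::field mat"
  assumes A: "A \<in> carrier_mat n n" "diagonal_mat A" and B: "B \<in> carrier_mat n n" "diagonal_mat B"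
  shows "A * B = B * A"
proof -
  have *: "(C * D) $$ (i, j) = (if i = j then C $$ (i, i) * D $$ (i, i) else 0)"
    if C: "C \<in> carrier_mat n n" "diagonal_mat C" and D: "D \<in> carrier_mat n n" "diagonal_mat D"
      and ij: "i < n" "j < n" for C D :: "'a mat" and i j
  proof -
    have "(C * D) $$ (i, j) = (\<Sum>t<n. C $$ (i, t) * D $$ (t, j))" by (rule index_mult_mat_sum[OF C(1) D(1) ij])
    also have "\<dots> = (\<Sum>t<n. if t = i then (if i = j then C $$ (i, i) * D $$ (i, i) else 0) else 0)"
      using C D ij by (intro sum.cong) (auto simp: diagonal_mat_def)
    finally show ?thesis using ij by simp
  qed
  show ?thesis
  proof (rule eq_matI)
    fix i j assume "i < dim_row (B * A)" "j < dim_col (B * A)"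
    then have "i < n" "j < n" using A B by auto
    then show "(A * B) $$ (i, j) = (B * A) $$ (i, j)" using *[OF A B] *[OF B A] by simp
  qed (use A B in auto)
qed

lemma group_Sp: "group (Sp m :: 'g::field mat monoid)"
proof (rule groupI)
  let ?J = "sympl_J m :: 'g mat" and ?d = "2 * m"
  note ac = assoc_mult_mat[of _ ?d ?d _ ?d _ ?d] mult_carrier_mat[of _ ?d ?d _ ?d]
  show "A \<otimes>\<^bsub>Sp m\<^esub> B \<in> carrier (Sp m)" if A: "A \<in> carrier (Sp m :: 'g mat monoid)" and B: "B \<in> carrier (Sp m)" for A B
  proof -
    have c: "A \<in> carrier_mat ?d ?d" "B \<in> carrier_mat ?d ?d" "A * B \<in> carrier_mat ?d ?d" using A B by (auto simp: ac)
    have "A * B \<in> carrier (Sp m)"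
      unfolding Sp_iff_sp[OF c(3)]
    proof (intro ballI)
      fix u v :: "'g vec" assume uv: "u \<in> carrier_vec ?d" "v \<in> carrier_vec ?d"
      have Bv: "B *\<^sub>v u \<in> carrier_vec ?d" "B *\<^sub>v v \<in> carrier_vec ?d" using c uv by auto
      show "sp m (A * B *\<^sub>v u) (A * B *\<^sub>v v) = sp m u v"
        using A B Sp_iff_sp[OF c(1)] Sp_iff_sp[OF c(2)] uv Bv c by (simp add: assoc_mult_mat_vec[of _ ?d ?d _ ?d] del: Sp_simps)
    qed
    then show ?thesis by simp
  qed
  have one: "1\<^sub>m ?d \<in> carrier (Sp m :: 'g mat monoid)" unfolding dblk_one[symmetric] by (rule dblk_Sp) simp
  then show "\<one>\<^bsub>Sp m\<^esub> \<in> carrier (Sp m :: 'g mat monoid)" by (metis Sp_simps(3))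
  show "\<exists>B\<in>carrier (Sp m). B \<otimes>\<^bsub>Sp m\<^esub> A = \<one>\<^bsub>Sp m\<^esub>" if A: "A \<in> carrier (Sp m :: 'g mat monoid)" for A
  proof -
    have Ac: "A \<in> carrier_mat ?d ?d" using A by simp
    have JJ: "?J * ?J = - 1 \<cdot>\<^sub>m 1\<^sub>m ?d"
    proof -
      have "?J * ?J = dblk m (\<lambda>_. - 1) (\<lambda>_. 0) (\<lambda>_. 0) (\<lambda>_. - 1)" unfolding sympl_J_dblk dblk_mult by simp
      also have "\<dots> = - 1 \<cdot>\<^sub>m 1\<^sub>m ?d"
        by (intro eq_matI) (auto simp: dblk_def dg_def)
      finally show ?thesis .
    qed
    \<comment> \<open>The inverse read off from the defining equation of Sp together with J * J =
      -1.\<close>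
    define L where "L = - 1 \<cdot>\<^sub>m (?J * transpose_mat A * ?J)"
    have Lc: "L \<in> carrier_mat ?d ?d" using Ac by (simp add: L_def ac)
    have "L * A = - 1 \<cdot>\<^sub>m (?J * (transpose_mat A * ?J * A))"
      unfolding L_def using Ac by (simp add: mult_smult_assoc_mat[of _ ?d ?d _ ?d] ac)
    also have "\<dots> = - 1 \<cdot>\<^sub>m (?J * ?J)" using A by simp
    also have "\<dots> = 1\<^sub>m ?d" unfolding JJ by (simp add: smult_smult_mat)
    finally have LA: "L * A = 1\<^sub>m ?d" .
    then have AL: "A * L = 1\<^sub>m ?d" by (rule mat_mult_left_right_inverse[OF Lc Ac])
    have "L \<in> carrier (Sp m)"
      unfolding Sp_iff_sp[OF Lc]
    proof (intro ballI)
      fix u v :: "'g vec" assume uv: "u \<in> carrier_vec ?d" "v \<in> carrier_vec ?d"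
      have Lv: "L *\<^sub>v u \<in> carrier_vec ?d" "L *\<^sub>v v \<in> carrier_vec ?d" using Lc uv by auto
      have "A *\<^sub>v (L *\<^sub>v w) = w" if "w \<in> carrier_vec ?d" for w
        using assoc_mult_mat_vec[OF Ac Lc that] AL that by simp
      then show "sp m (L *\<^sub>v u) (L *\<^sub>v v) = sp m u v"
        using A Sp_iff_sp[OF Ac] Lv uv by metis
    qed
    then show ?thesis using LA by (metis Sp_simps(2,3))
  qed
qed (auto simp: assoc_mult_mat[of _ "2 * m" "2 * m" _ "2 * m" _ "2 * m"])

lemma kron_similitude:
  fixes A B :: "'a::field mat"
  assumes "similitude q a A" "similitude q c B"
  shows "similitude q (a * c) (kron A B)"
proof -
  obtain d where A: "A \<in> carrier_mat a a" and d: "d \<noteq> 0" "transpose_mat A * frob_mat q A = d \<cdot>\<^sub>m 1\<^sub>m a"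
    using assms by (auto simp: similitude_def)
  obtain e where B: "B \<in> carrier_mat c c" and e: "e \<noteq> 0" "transpose_mat B * frob_mat q B = e \<cdot>\<^sub>m 1\<^sub>m c"
    using assms by (auto simp: similitude_def)
  have "transpose_mat (kron A B) * frob_mat q (kron A B) =
     kron (transpose_mat A * frob_mat q A) (transpose_mat B * frob_mat q B)"
    unfolding kron_transpose frob_mat_kron by (rule kron_mult[of _ a a _ a _ c c _ c]) (use A B in auto)
  also have "\<dots> = (d * e) \<cdot>\<^sub>m 1\<^sub>m (a * c)"
    unfolding d e by (simp add: kron_smult_left kron_smult_right smult_smult_mat kron_one mult.commute[of d e])
  finally show ?thesis using A B d e unfolding similitude_def by (intro conjI exI[of _ "d * e"]) auto
qed

locale weyl_PGU = weyl q ty p m \<chi> f for q and ty :: "'a::alg_closed_field itself" and p m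
    and \<chi> :: "'g::{finite,field} \<Rightarrow> 'a" and f +
  fixes k :: nat
  assumes k: "k \<ge> 1"
begin

abbreviation "n \<equiv> N0 * k"
abbreviation "GU \<equiv> PGU q n :: 'a mat set monoid"

sublocale GU: group GU by (rule group_PGU)

lemma n_pos: "n \<ge> 1" using k N0_pos by (simp add: Suc_leI)

lemmas ac = assoc_mult_mat[of _ n n _ n _ n] mult_carrier_mat[of _ n n _ n]
lemmas sm = mult_smult_assoc_mat[of _ n n _ n] mult_smult_distrib[of _ n n _ n] smult_smult_mat

text \<open>The shape of a general lift of an element centralising E: a Weyl operator on the first
  tensor factor and a similitude on the second.\<close>

definition K :: "'g vec \<Rightarrow> 'a mat \<Rightarrow> 'a mat" where "K w B = kron (W w) B"

lemma T_K: "T k w = K w (1\<^sub>m k)" by (simp add: T_def K_def)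

lemma K_carrier [simp]: "B \<in> carrier_mat k k \<Longrightarrow> K w B \<in> carrier_mat n n"
  unfolding K_def by (rule kron_carrier) auto

lemma K_mult:
  assumes "u \<in> VV" "v \<in> VV" "A \<in> carrier_mat k k" "B \<in> carrier_mat k k"
  shows "K u A * K v B = \<chi> (sp m u v) \<cdot>\<^sub>m K (u + v) (A * B)"
proof -
  have "K u A * K v B = kron (W u * W v) (A * B)"
    unfolding K_def by (rule kron_mult[of _ N0 N0 _ N0 _ k k _ k]) (use assms in auto)
  then show ?thesis using assms by (simp add: W_mult kron_smult_left K_def)
qed

lemma kron_one_inject:
  fixes B C :: "'a mat"
  assumes "B \<in> carrier_mat k k" "C \<in> carrier_mat k k" "kron (1\<^sub>m N0) B = kron (1\<^sub>m N0) C"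
  shows "B = C"
proof (rule eq_matI)
  fix s t assume "s < dim_row C" "t < dim_col C"
  then have st: "s < k" "t < k" using assms by auto
  have "kron (1\<^sub>m N0) D $$ (0 * k + s, 0 * k + t) = D $$ (s, t)" if "D \<in> carrier_mat k k" for D :: "'a mat"
    using kron_index[OF one_carrier_mat that N0_pos N0_pos st] N0_pos by simp
  then show "B $$ (s, t) = C $$ (s, t)" using assms by metis
qed (use assms in auto)

lemma kron_one_similitude:
  fixes B :: "'a mat"
  assumes B: "B \<in> carrier_mat k k" and s: "similitude q n (kron (1\<^sub>m N0) B)"
  shows "similitude q k B"
proof -
  obtain d where d: "d \<noteq> 0" "transpose_mat (kron (1\<^sub>m N0) B) * frob_mat q (kron (1\<^sub>m N0) B) = d \<cdot>\<^sub>m 1\<^sub>m n"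
    using s by (auto simp: similitude_def)
  have "transpose_mat (kron (1\<^sub>m N0) B) * frob_mat q (kron (1\<^sub>m N0) B) =
     kron (1\<^sub>m N0 * 1\<^sub>m N0) (transpose_mat B * frob_mat q B)"
    unfolding kron_transpose frob_mat_kron frob_mat_one transpose_one
    by (rule kron_mult[of _ N0 N0 _ N0 _ k k _ k]) (use B in auto)
  moreover have "d \<cdot>\<^sub>m 1\<^sub>m n = kron (1\<^sub>m N0) (d \<cdot>\<^sub>m (1\<^sub>m k :: 'a mat))" by (simp add: kron_smult_right kron_one)
  ultimately have "kron (1\<^sub>m N0) (transpose_mat B * frob_mat q B) = kron (1\<^sub>m N0) (d \<cdot>\<^sub>m 1\<^sub>m k)" using d by simp
  moreover have "transpose_mat B * frob_mat q B \<in> carrier_mat k k" "d \<cdot>\<^sub>m 1\<^sub>m k \<in> carrier_mat k k"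
    using B by (auto simp: mult_carrier_mat[of _ k k _ k])
  ultimately have "transpose_mat B * frob_mat q B = d \<cdot>\<^sub>m 1\<^sub>m k" using kron_one_inject by blast
  then show ?thesis using B d by (auto simp: similitude_def)
qed

lemma K_similitude: "similitude q k B \<Longrightarrow> similitude q n (K w B)"
  unfolding K_def by (rule kron_similitude[OF W_similitude])

lemma T_similitude: "similitude q n (T k u)"
  unfolding T_K by (rule K_similitude[OF similitude_one])

definition \<tau> :: "'g vec \<Rightarrow> 'a mat set" where "\<tau> u = cl n (T k u)"

definition E :: "'a mat set set" where "E = \<tau> ` VV"

lemma cl_smult: "A \<in> carrier_mat n n \<Longrightarrow> c \<noteq> 0 \<Longrightarrow> cl n (c \<cdot>\<^sub>m A) = cl n A"
  by (subst cl_eq_iff) auto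

lemma K_cl_mult:
  assumes "u \<in> VV" "v \<in> VV" "similitude q k A" "similitude q k B"
  shows "cl n (K u A) \<otimes>\<^bsub>GU\<^esub> cl n (K v B) = cl n (K (u + v) (A * B))"
proof -
  note c = similitude_carrier[OF assms(3)] similitude_carrier[OF assms(4)]
  have "cl n (K u A) \<otimes>\<^bsub>GU\<^esub> cl n (K v B) = cl n (K u A * K v B)"
    by (rule PGU_mult[OF K_similitude[OF assms(3)] K_similitude[OF assms(4)]])
  also have "\<dots> = cl n (K (u + v) (A * B))"
    using c K_mult[OF assms(1,2) c] chi_nz by (simp add: cl_smult mult_carrier_mat[of _ k k _ k])
  finally show ?thesis .
qed

lemma tau_carrier: "\<tau> u \<in> carrier GU"
  using T_similitude by (auto simp: \<tau>_def carrier_PGU)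

lemma tau_add: "u \<in> VV \<Longrightarrow> v \<in> VV \<Longrightarrow> \<tau> u \<otimes>\<^bsub>GU\<^esub> \<tau> v = \<tau> (u + v)"
  using K_cl_mult[OF _ _ similitude_one similitude_one] by (simp add: \<tau>_def T_K)

lemma tau_zero: "\<tau> (0\<^sub>v (2 * m)) = \<one>\<^bsub>GU\<^esub>"
  by (simp add: \<tau>_def T_zero PGU_one)

lemma K_T_commute:
  assumes "w \<in> VV" "u \<in> VV" "B \<in> carrier_mat k k"
  shows "K w B * T k u = \<chi> (2 * sp m w u) \<cdot>\<^sub>m (T k u * K w B)"
proof -
  have "u + w = w + u" using assms by (intro eq_vecI) auto
  moreover have "\<chi> (2 * sp m w u) * \<chi> (sp m u w) = \<chi> (sp m w u)"
    unfolding chi_add[symmetric] using sp_swap[of m u w] by simp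
  ultimately show ?thesis unfolding T_K using assms
    by (simp add: K_mult smult_smult_mat left_mult_one_mat[of _ k k] right_mult_one_mat[of _ k k])
qed

lemma T_GL: "T k u \<in> carrier (GL n)" using similitude_GL[OF T_similitude] .

lemma GL_mult: "A \<in> carrier (GL n) \<Longrightarrow> B \<in> carrier (GL n) \<Longrightarrow> A * B \<in> carrier (GL n :: 'a mat monoid)"
  by (auto simp: det_mult[of _ n])

text \<open>The commutation scalars of \<open>K w A\<close> with the operators \<open>T k u\<close>
  are \<chi>(2 * sp m w u) and survive rescaling, so nondegeneracy of the form recovers w.
  Multiplying by \<open>T k (- w)\<close> then leaves A alone on the second factor.\<close>

lemma K_cl_inject:
  assumes w: "w \<in> VV" "v \<in> VV" and A: "similitude q k A" and B: "similitude q k B" and eq: "cl n (K w A) = cl n (K v B)"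
  shows "w = v" "cl k A = cl k B"
proof -
  note c = similitude_carrier[OF A] similitude_carrier[OF B]
  obtain d where d: "d \<noteq> 0" "K w A = d \<cdot>\<^sub>m K v B" using eq c by (subst (asm) cl_eq_iff) auto
  have "sp m (w + - v) u = 0" if u: "u \<in> VV" for u
  proof -
    have "\<chi> (2 * sp m w u) \<cdot>\<^sub>m (T k u * K w A) = K w A * T k u" using K_T_commute[OF w(1) u c(1)] by simp
    also have "\<dots> = d \<cdot>\<^sub>m (K v B * T k u)" unfolding d using c by (simp add: sm)
    also have "\<dots> = \<chi> (2 * sp m v u) \<cdot>\<^sub>m (T k u * (d \<cdot>\<^sub>m K v B))"
      unfolding K_T_commute[OF w(2) u c(2)] using c by (simp add: sm mult.commute[of _ "_ :: 'a"])
    also have "\<dots> = \<chi> (2 * sp m v u) \<cdot>\<^sub>m (T k u * K w A)" by (simp add: d)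
    finally have "\<chi> (2 * sp m w u) = \<chi> (2 * sp m v u)"
      by (rule smult_GL_inject[OF GL_mult[OF T_GL similitude_GL[OF K_similitude[OF A]]] n_pos])
    then have "sp m w u = sp m v u" using chi_eq_iff two_nz by simp
    then show ?thesis using sp_add(1)[of w m "- v" u] sp_uminus[OF w(2)] w by simp
  qed
  then have "w + - v = 0\<^sub>v (2 * m)" using w by (intro sp_nondegenerate) auto
  then have z: "(w + - v) $ i = 0" if "i < 2 * m" for i using that by simp
  show wv: "w = v"
  proof (rule eq_vecI)
    fix i assume "i < dim_vec v"
    then show "w $ i = v $ i" using z[of i] w by simp
  qed (use w in auto)
  have KT: "T k (- v) * K v D = kron (1\<^sub>m N0) D" if D: "D \<in> carrier_mat k k" for D
  proof -
    have "T k (- v) * K v D = kron (W (- v) * W v) (1\<^sub>m k * D)"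
      unfolding T_def K_def by (rule kron_mult[of _ N0 N0 _ N0 _ k k _ k]) (use D in auto)
    then show ?thesis using W_inverse(2)[OF w(2)] D by simp
  qed
  have "kron (1\<^sub>m N0) A = d \<cdot>\<^sub>m kron (1\<^sub>m N0) B"
    using KT[OF c(1)] KT[OF c(2)] d(2) wv c by (simp add: sm)
  then have "kron (1\<^sub>m N0) A = kron (1\<^sub>m N0) (d \<cdot>\<^sub>m B)" by (simp add: kron_smult_right)
  moreover have "d \<cdot>\<^sub>m B \<in> carrier_mat k k" using c by simp
  ultimately have "A = d \<cdot>\<^sub>m B" using c(1) kron_one_inject by blast
  then show "cl k A = cl k B" using c d(1) by (subst cl_eq_iff) auto
qed

lemma tau_inject: "u \<in> VV \<Longrightarrow> v \<in> VV \<Longrightarrow> \<tau> u = \<tau> v \<Longrightarrow> u = v"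
  using K_cl_inject(1)[OF _ _ similitude_one similitude_one] by (simp add: \<tau>_def T_K)

lemma tau_inv: "u \<in> VV \<Longrightarrow> inv\<^bsub>GU\<^esub> (\<tau> u) = \<tau> (- u)"
proof -
  assume u: "u \<in> VV"
  have "- u + u = 0\<^sub>v (2 * m)" using u by (intro eq_vecI) auto
  then have "\<tau> (- u) \<otimes>\<^bsub>GU\<^esub> \<tau> u = \<one>\<^bsub>GU\<^esub>" using tau_add[of "- u" u] u tau_zero by simp
  then show ?thesis using tau_carrier by (intro GU.inv_equality) auto
qed

lemma elem_abelian_E: "elem_abelian_subgroup GU E p (2 * m)"
  unfolding elem_abelian_subgroup_def
proof (intro conjI ballI)
  show "subgroup E GU"
  proof (rule GU.subgroupI)
    show "E \<subseteq> carrier GU" using tau_carrier by (auto simp: E_def)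
    have "\<tau> (0\<^sub>v (2 * m)) \<in> E" by (simp add: E_def)
    then show "E \<noteq> {}" by auto
    show "inv\<^bsub>GU\<^esub> x \<in> E" if "x \<in> E" for x using that by (auto simp: E_def tau_inv)
    show "x \<otimes>\<^bsub>GU\<^esub> y \<in> E" if "x \<in> E" "y \<in> E" for x y using that by (auto simp: E_def tau_add)
  qed
  fix x assume "x \<in> E"
  then obtain u where u: "u \<in> VV" "x = \<tau> u" by (auto simp: E_def)
  have "x [^]\<^bsub>GU\<^esub> j = \<tau> (of_nat j \<cdot>\<^sub>v u)" for j :: nat
  proof (induction j)
    case 0
    have "0 \<cdot>\<^sub>v u = 0\<^sub>v (2 * m)" using u by (intro eq_vecI) auto
    then show ?case using tau_zero by simp
  next
    case (Suc j)
    have "of_nat j \<cdot>\<^sub>v u + u = of_nat (Suc j) \<cdot>\<^sub>v u" using u by (intro eq_vecI) (auto simp: algebra_simps)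
    then show ?case using Suc u tau_add[of "of_nat j \<cdot>\<^sub>v u" u] by simp
  qed
  moreover have "of_nat p = (0::'g)" using prime_field_of_nat(1)[OF p(1,3)] of_nat_CHAR[where ?'a = 'g] by simp
  moreover have "0 \<cdot>\<^sub>v u = 0\<^sub>v (2 * m)" using u by (intro eq_vecI) auto
  ultimately show "x [^]\<^bsub>GU\<^esub> p = \<one>\<^bsub>GU\<^esub>" using tau_zero by simp
  fix y assume "y \<in> E"
  then obtain v where v: "v \<in> VV" "y = \<tau> v" by (auto simp: E_def)
  have "u + v = v + u" using u v by (intro eq_vecI) auto
  then show "x \<otimes>\<^bsub>GU\<^esub> y = y \<otimes>\<^bsub>GU\<^esub> x" using u v tau_add by simp
next
  have "inj_on \<tau> VV" using tau_inject by (auto simp: inj_on_def)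
  then show c: "card E = p ^ (2 * m)" using card_carrier_vec[of "2 * m", where ?'g = 'g] p(3) by (simp add: E_def card_image)
  then show "finite E" using p(1) prime_gt_0_nat by (intro card_ge_0_finite) simp
qed

lemma E_sub: "E \<subseteq> carrier GU" using tau_carrier by (auto simp: E_def)

text \<open>Lifts of elements of a torus are multiples of simultaneously diagonalised matrices and
  commute, whereas a hyperbolic pair u, v with form value 1 has commutator scalar \<chi>(2), which
  is not 1 as p is odd.\<close>

lemma E_nontoral: "\<not> (\<exists>S. maximal_torus_PGL n S \<and> E \<subseteq> S)"
proof
  assume "\<exists>S. maximal_torus_PGL n S \<and> E \<subseteq> S"
  then obtain g where g: "g \<in> carrier (GL n)"
    and ES: "E \<subseteq> (\<lambda>D. cl n (g * D * inv\<^bsub>GL n\<^esub> g)) ` {D \<in> carrier (GL n). diagonal_mat D}"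
    unfolding maximal_torus_PGL_def by blast
  obtain h where h: "h \<in> carrier (GL n)" "g * h = 1\<^sub>m n" "h * g = 1\<^sub>m n" using GL_obtain_inverse[OF g] .
  have gh: "g \<in> carrier_mat n n" "h \<in> carrier_mat n n" using g h by auto
  have inv: "inv\<^bsub>GL n\<^esub> g = h" using GL_inv_eq[OF gh h(2)] by simp
  have rep: "\<exists>c D. T k u = c \<cdot>\<^sub>m (g * D * h) \<and> D \<in> carrier_mat n n \<and> diagonal_mat D" if u: "u \<in> VV" for u
  proof -
    have "\<tau> u \<in> (\<lambda>D. cl n (g * D * inv\<^bsub>GL n\<^esub> g)) ` {D \<in> carrier (GL n). diagonal_mat D}"
      using ES u by (auto simp: E_def)
    then obtain D where D: "D \<in> carrier_mat n n" "diagonal_mat D" "cl n (T k u) = cl n (g * D * h)"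
      unfolding inv by (auto simp: \<tau>_def)
    have "\<exists>c. c \<noteq> 0 \<and> T k u = c \<cdot>\<^sub>m (g * D * h)"
      using D(3) gh D(1) cl_eq_iff[of "T k u" n "g * D * h"] by (simp add: ac)
    then show ?thesis using D by blast
  qed
  define u :: "'g vec" where "u = unit_vec (2 * m) 0"
  define v :: "'g vec" where "v = unit_vec (2 * m) (m + 0)"
  have uv: "u \<in> VV" "v \<in> VV" by (auto simp: u_def v_def)
  have sp1: "sp m u v = 1" unfolding v_def using sp_unit_right(2)[of 0 m u] m uv by (simp add: u_def)
  obtain c D where D: "T k u = c \<cdot>\<^sub>m (g * D * h)" "D \<in> carrier_mat n n" "diagonal_mat D" using rep[OF uv(1)] by blast
  obtain c' D' where D': "T k v = c' \<cdot>\<^sub>m (g * D' * h)" "D' \<in> carrier_mat n n" "diagonal_mat D'" using rep[OF uv(2)] by blast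
  have pr: "(g * A * h) * (g * B * h) = g * (A * B) * h" if "A \<in> carrier_mat n n" "B \<in> carrier_mat n n" for A B
  proof -
    have "(g * A * h) * (g * B * h) = g * A * (h * g) * B * h" using gh that by (simp add: ac)
    then show ?thesis unfolding h(3) using gh that by (simp add: ac left_mult_one_mat[of _ n n])
  qed
  have "T k u * T k v = (c * c') \<cdot>\<^sub>m (g * (D * D') * h)"
    unfolding D(1) D'(1) using gh D(2) D'(2) pr[OF D(2) D'(2)] by (simp add: sm ac mult.commute[of _ "_ :: 'a"])
  also have "D * D' = D' * D" by (rule diagonal_mat_commute[OF D(2,3) D'(2,3)])
  also have "(c * c') \<cdot>\<^sub>m (g * (D' * D) * h) = T k v * T k u"
    unfolding D(1) D'(1) using gh D(2) D'(2) pr[OF D'(2) D(2)] by (simp add: sm ac mult.commute[of _ "_ :: 'a"])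
  finally have "\<chi> (2 * sp m u v) \<cdot>\<^sub>m (T k v * T k u) = 1 \<cdot>\<^sub>m (T k v * T k u)"
    using T_commute[OF uv, of k] by simp
  then have "\<chi> (2 * sp m u v) = 1" using smult_GL_inject[OF GL_mult[OF T_GL T_GL] n_pos] by blast
  then show False using chi_1 sp1 two_nz by simp
qed

text \<open>The scalars by which A commutes with the \<open>T k u\<close> form a character with
  values in the p-th roots of unity, hence are \<chi>(2 * sp m w u) for some w. Then
  \<open>T k (- w) * A\<close> commutes with all \<open>T k u\<close> exactly, and
  \<open>commutant\<close> applies.\<close>

lemma centralizer_rep:
  assumes A: "similitude q n A" and C: "cl n A \<in> centralizer GU E"
  obtains w B where "w \<in> VV" "similitude q k B" "cl n A = cl n (K w B)"
proof -
  have Ac: "A \<in> carrier_mat n n" by (rule similitude_carrier[OF A])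
  have "\<exists>c. c \<noteq> 0 \<and> A * T k u = c \<cdot>\<^sub>m (T k u * A)" if u: "u \<in> VV" for u
  proof -
    have "cl n A \<otimes>\<^bsub>GU\<^esub> \<tau> u = \<tau> u \<otimes>\<^bsub>GU\<^esub> cl n A" using C u by (auto simp: centralizer_def E_def)
    then have "cl n (A * T k u) = cl n (T k u * A)"
      unfolding \<tau>_def PGU_mult[OF A T_similitude] PGU_mult[OF T_similitude A] .
    then show ?thesis using Ac cl_eq_iff[of "A * T k u" n "T k u * A"] by (simp add: ac)
  qed
  then obtain c where c: "\<And>u. u \<in> VV \<Longrightarrow> c u \<noteq> 0" "\<And>u. u \<in> VV \<Longrightarrow> A * T k u = c u \<cdot>\<^sub>m (T k u * A)" by metis
  have TAG: "T k u * A \<in> carrier (GL n)" for u using GL_mult[OF T_GL similitude_GL[OF A]] .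
  have cadd: "c (u + v) = c u * c v" if uv: "u \<in> VV" "v \<in> VV" for u v
  proof -
    have uvV: "u + v \<in> VV" using uv by simp
    have "A * (T k u * T k v) = (A * T k u) * T k v" using Ac by (simp add: ac)
    also have "\<dots> = (c u * c v) \<cdot>\<^sub>m (T k u * T k v * A)"
    proof -
      have "(A * T k u) * T k v = c u \<cdot>\<^sub>m (T k u * (A * T k v))" unfolding c(2)[OF uv(1)] using Ac by (simp add: sm ac)
      then show ?thesis unfolding c(2)[OF uv(2)] using Ac by (simp add: sm ac)
    qed
    finally have "\<chi> (sp m u v) \<cdot>\<^sub>m (c (u + v) \<cdot>\<^sub>m (T k (u + v) * A)) = \<chi> (sp m u v) \<cdot>\<^sub>m ((c u * c v) \<cdot>\<^sub>m (T k (u + v) * A))"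
      unfolding T_mult[OF uv] using Ac by (simp add: sm c(2)[OF uvV] mult_ac[where ?'a = 'a])
    then have "c (u + v) \<cdot>\<^sub>m (T k (u + v) * A) = (c u * c v) \<cdot>\<^sub>m (T k (u + v) * A)"
      using chi_nz by (rule smult_mat_cancel)
    then show ?thesis using smult_GL_inject[OF TAG n_pos] by blast
  qed
  have c0: "c (0\<^sub>v (2 * m)) = 1" using cadd[of "0\<^sub>v (2 * m)" "0\<^sub>v (2 * m)"] c(1)[of "0\<^sub>v (2 * m)"] by simp
  have cp: "c u ^ p = 1" if u: "u \<in> VV" for u
  proof -
    have z: "0 \<cdot>\<^sub>v u = 0\<^sub>v (2 * m)" using u by (intro eq_vecI) auto
    have "c (of_nat j \<cdot>\<^sub>v u) = c u ^ j" for j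
    proof (induction j)
      case 0
      then show ?case using z c0 by simp
    next
      case (Suc j)
      have "of_nat (Suc j) \<cdot>\<^sub>v u = u + of_nat j \<cdot>\<^sub>v u" using u by (intro eq_vecI) (auto simp: algebra_simps)
      then show ?case using Suc cadd[of u "of_nat j \<cdot>\<^sub>v u"] u by simp
    qed
    from this[of p] show ?thesis
      using prime_field_of_nat(1)[OF p(1,3)] of_nat_CHAR[where ?'a = 'g] z c0 by simp
  qed
  have "\<exists>a. c u = \<chi> a" if "u \<in> VV" for u using chi_surj cp that by blast
  then obtain \<gamma> where \<gamma>: "\<And>u. u \<in> VV \<Longrightarrow> c u = \<chi> (\<gamma> u)" by metis
  \<comment> \<open>Halving \<gamma> compensates the factor 2 in the commutator of Weyl
    operators.\<close>
  have \<gamma>_add: "\<gamma> (u + v) / 2 = \<gamma> u / 2 + \<gamma> v / 2" if "u \<in> VV" "v \<in> VV" for u v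
  proof -
    have "\<chi> (\<gamma> (u + v)) = \<chi> (\<gamma> u + \<gamma> v)" using cadd[OF that] \<gamma> that chi_add by simp
    then have "\<gamma> (u + v) = \<gamma> u + \<gamma> v" using chi_eq_iff by simp
    then show ?thesis by (simp add: add_divide_distrib)
  qed
  obtain w where w: "w \<in> VV" "\<And>u. u \<in> VV \<Longrightarrow> \<gamma> u / 2 = sp m w u" using sp_dual[OF p(1,3) \<gamma>_add] by blast
  have cw: "c u = \<chi> (2 * sp m w u)" if "u \<in> VV" for u
  proof -
    have "2 * sp m w u = \<gamma> u" using w(2)[OF that] two_nz by (simp add: field_simps)
    then show ?thesis using \<gamma>[OF that] by simp
  qed
  define A' where "A' = T k (- w) * A"
  have A'c: "A' \<in> carrier_mat n n" using Ac by (simp add: A'_def ac)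
  have "A' * T k u = T k u * A'" if u: "u \<in> VV" for u
  proof -
    have "A' * T k u = T k (- w) * (A * T k u)" unfolding A'_def using Ac by (simp add: ac)
    also have "\<dots> = \<chi> (2 * sp m w u) \<cdot>\<^sub>m ((T k (- w) * T k u) * A)"
      unfolding c(2)[OF u] cw[OF u] using Ac by (simp add: sm ac)
    also have "T k (- w) * T k u = \<chi> (2 * sp m (- w) u) \<cdot>\<^sub>m (T k u * T k (- w))"
      using T_commute[of "- w" u k] w u by simp
    also have "\<chi> (2 * sp m w u) \<cdot>\<^sub>m ((\<chi> (2 * sp m (- w) u) \<cdot>\<^sub>m (T k u * T k (- w))) * A) = T k u * A'"
      unfolding A'_def using Ac sp_uminus[OF w(1), of u] by (simp add: sm ac chi_add[symmetric] chi_0)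
    finally show ?thesis .
  qed
  then obtain B where B: "B \<in> carrier_mat k k" "A' = kron (1\<^sub>m N0) B" using commutant[OF A'c] by blast
  have "similitude q n A'" unfolding A'_def by (rule similitude_mult[OF T_similitude A])
  then have Bs: "similitude q k B" using kron_one_similitude B by simp
  have "A = (T k w * T k (- w)) * A" using T_inverse(1)[OF w(1)] Ac by simp
  also have "\<dots> = T k w * A'" unfolding A'_def using Ac by (simp add: ac)
  also have "\<dots> = kron (W w * 1\<^sub>m N0) (1\<^sub>m k * B)"
    unfolding B(2) T_def by (rule kron_mult[of _ N0 N0 _ N0 _ k k _ k]) (use B in auto)
  also have "\<dots> = K w B" unfolding K_def using B by (simp add: right_mult_one_mat[of _ N0 N0])
  finally show ?thesis using that w(1) Bs by blast
qed

lemma K_centralizes: "w \<in> VV \<Longrightarrow> similitude q k B \<Longrightarrow> cl n (K w B) \<in> centralizer GU E"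
proof -
  assume w: "w \<in> VV" and B: "similitude q k B"
  note Bc = similitude_carrier[OF B]
  have "cl n (K w B) \<otimes>\<^bsub>GU\<^esub> \<tau> u = \<tau> u \<otimes>\<^bsub>GU\<^esub> cl n (K w B)" if u: "u \<in> VV" for u
  proof -
    have "w + u = u + w" using w u by (intro eq_vecI) auto
    then show ?thesis
      unfolding \<tau>_def T_K K_cl_mult[OF w u B similitude_one] K_cl_mult[OF u w similitude_one B] using Bc by simp
  qed
  then show ?thesis using K_similitude[OF B] by (auto simp: centralizer_def carrier_PGU E_def)
qed

text \<open>A class y determines B only up to a scalar, so a representative is chosen; by
  \<open>iota\<close> the resulting class does not depend on it.\<close>

definition \<iota> :: "'a mat set \<Rightarrow> 'a mat set" where
  "\<iota> y = cl n (K (0\<^sub>v (2 * m)) (SOME B. similitude q k B \<and> cl k B = y))"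

lemma iota: assumes B: "similitude q k B" shows "\<iota> (cl k B) = cl n (K (0\<^sub>v (2 * m)) B)"
proof -
  define B' where "B' = (SOME B'. similitude q k B' \<and> cl k B' = cl k B)"
  have "\<exists>B'. similitude q k B' \<and> cl k B' = cl k B" using B by blast
  from someI_ex[OF this] have B': "similitude q k B'" "cl k B' = cl k B" by (auto simp: B'_def)
  note c = similitude_carrier[OF B] similitude_carrier[OF B'(1)]
  obtain d where d: "d \<noteq> 0" "B' = d \<cdot>\<^sub>m B" using cl_eq_iff[OF c(2,1)] B'(2) by auto
  have "K (0\<^sub>v (2 * m)) B' = d \<cdot>\<^sub>m K (0\<^sub>v (2 * m)) B" by (simp add: d(2) K_def kron_smult_right)
  then show ?thesis unfolding \<iota>_def B'_def[symmetric] using c d by (simp add: cl_smult)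
qed

text \<open>The classes of the \<open>K w B\<close> multiply componentwise, because the Weyl cocycle
  is a scalar. Injectivity is \<open>K_cl_inject\<close>, surjectivity is
  \<open>centralizer_rep\<close>.\<close>

lemma centralizer_iso:
  "GU\<lparr>carrier := centralizer GU E\<rparr> \<cong> DirProd (GU\<lparr>carrier := E\<rparr>) (PGU q k :: 'a mat set monoid)"
proof -
  let ?D = "DirProd (GU\<lparr>carrier := E\<rparr>) (PGU q k :: 'a mat set monoid)"
  let ?C = "GU\<lparr>carrier := centralizer GU E\<rparr>"
  define \<Phi> where "\<Phi> = (\<lambda>(x, y). x \<otimes>\<^bsub>GU\<^esub> \<iota> y)"
  have Phi: "\<Phi> (\<tau> w, cl k B) = cl n (K w B)" if "w \<in> VV" "similitude q k B" for w B
  proof -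
    have "w + 0\<^sub>v (2 * m) = w" using that by simp
    then show ?thesis unfolding \<Phi>_def using that K_cl_mult[OF that(1) zero_carrier_vec similitude_one that(2)]
        similitude_carrier[OF that(2)] by (simp add: iota \<tau>_def T_K)
  qed
  have D: "carrier ?D = {(\<tau> w, cl k B) | w B. w \<in> VV \<and> similitude q k B}"
    by (auto simp: E_def carrier_PGU)
  have "group ?D"
    using elem_abelian_E GU.subgroup_imp_group group_PGU by (intro DirProd_group) (auto simp: elem_abelian_subgroup_def)
  moreover have "\<Phi> \<in> iso ?D ?C"
  proof (rule isoI)
    show "\<Phi> \<in> hom ?D ?C"
    proof (rule homI)
      fix x assume "x \<in> carrier ?D"
      then show "\<Phi> x \<in> carrier ?C" unfolding D using Phi K_centralizes by auto
      fix y assume "y \<in> carrier ?D"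
      obtain w A where x: "w \<in> VV" "similitude q k A" "x = (\<tau> w, cl k A)" using \<open>x \<in> carrier ?D\<close> unfolding D by auto
      obtain v B where y: "v \<in> VV" "similitude q k B" "y = (\<tau> v, cl k B)" using \<open>y \<in> carrier ?D\<close> unfolding D by auto
      have "x \<otimes>\<^bsub>?D\<^esub> y = (\<tau> (w + v), cl k (A * B))"
        using x y by (simp add: tau_add PGU_mult)
      then show "\<Phi> (x \<otimes>\<^bsub>?D\<^esub> y) = \<Phi> x \<otimes>\<^bsub>?C\<^esub> \<Phi> y"
        using x y Phi similitude_mult[OF x(2) y(2)] K_cl_mult by simp
    qed
    have "inj_on \<Phi> (carrier ?D)"
    proof (rule inj_onI)
      fix x y assume xy: "x \<in> carrier ?D" "y \<in> carrier ?D" "\<Phi> x = \<Phi> y"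
      obtain w A where x: "w \<in> VV" "similitude q k A" "x = (\<tau> w, cl k A)" using xy(1) unfolding D by auto
      obtain v B where y: "v \<in> VV" "similitude q k B" "y = (\<tau> v, cl k B)" using xy(2) unfolding D by auto
      have "cl n (K w A) = cl n (K v B)" using xy(3) x y Phi by simp
      from K_cl_inject[OF x(1) y(1) x(2) y(2) this] show "x = y" using x y by simp
    qed
    moreover have "\<Phi> ` carrier ?D = carrier ?C"
    proof
      show "\<Phi> ` carrier ?D \<subseteq> carrier ?C" unfolding D using Phi K_centralizes by auto
      show "carrier ?C \<subseteq> \<Phi> ` carrier ?D"
      proof
        fix x assume "x \<in> carrier ?C"
        then have x: "x \<in> centralizer GU E" by simp
        then obtain A where A: "similitude q n A" "x = cl n A" by (auto simp: centralizer_def carrier_PGU)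
        obtain w B where wB: "w \<in> VV" "similitude q k B" "cl n A = cl n (K w B)"
          using centralizer_rep[OF A(1)] x A(2) by metis
        then have "x = \<Phi> (\<tau> w, cl k B)" using Phi A by simp
        moreover have "(\<tau> w, cl k B) \<in> carrier ?D" unfolding D using wB by blast
        ultimately show "x \<in> \<Phi> ` carrier ?D" by (rule image_eqI)
      qed
    qed
    ultimately show "bij_betw \<Phi> (carrier ?D) (carrier ?C)" by (simp add: bij_betw_def)
  qed
  ultimately show ?thesis using group.iso_sym is_isoI by blast
qed

section \<open>The normaliser acting on the symplectic space\<close>

abbreviation "NE \<equiv> normalizer GU E"

definition \<phi> :: "'a mat set \<Rightarrow> 'g vec \<Rightarrow> 'g vec" where
  "\<phi> g u = (SOME v. v \<in> VV \<and> g \<otimes>\<^bsub>GU\<^esub> \<tau> u \<otimes>\<^bsub>GU\<^esub> inv\<^bsub>GU\<^esub> g = \<tau> v)"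

lemma NE_carrier: "g \<in> NE \<Longrightarrow> g \<in> carrier GU"
  by (simp add: GU.normalizer_iff[OF E_sub])

lemma phi:
  assumes "g \<in> NE" "u \<in> VV"
  shows "\<phi> g u \<in> VV" "g \<otimes>\<^bsub>GU\<^esub> \<tau> u \<otimes>\<^bsub>GU\<^esub> inv\<^bsub>GU\<^esub> g = \<tau> (\<phi> g u)"
proof -
  have "g \<otimes>\<^bsub>GU\<^esub> \<tau> u \<otimes>\<^bsub>GU\<^esub> inv\<^bsub>GU\<^esub> g \<in> (\<lambda>x. g \<otimes>\<^bsub>GU\<^esub> x \<otimes>\<^bsub>GU\<^esub> inv\<^bsub>GU\<^esub> g) ` E"
    using assms(2) by (auto simp: E_def)
  also have "\<dots> = E" using assms(1) by (simp add: GU.normalizer_iff[OF E_sub])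
  finally have "\<exists>v. v \<in> VV \<and> g \<otimes>\<^bsub>GU\<^esub> \<tau> u \<otimes>\<^bsub>GU\<^esub> inv\<^bsub>GU\<^esub> g = \<tau> v" by (auto simp: E_def)
  from someI_ex[OF this] show "\<phi> g u \<in> VV" "g \<otimes>\<^bsub>GU\<^esub> \<tau> u \<otimes>\<^bsub>GU\<^esub> inv\<^bsub>GU\<^esub> g = \<tau> (\<phi> g u)"
    by (auto simp: \<phi>_def)
qed

lemma phi_eqI:
  assumes "g \<in> NE" "u \<in> VV" "v \<in> VV" "g \<otimes>\<^bsub>GU\<^esub> \<tau> u \<otimes>\<^bsub>GU\<^esub> inv\<^bsub>GU\<^esub> g = \<tau> v"
  shows "\<phi> g u = v"
  using phi[OF assms(1,2)] assms(3,4) tau_inject by metis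

lemma phi_add:
  assumes "g \<in> NE" "u \<in> VV" "v \<in> VV"
  shows "\<phi> g (u + v) = \<phi> g u + \<phi> g v"
proof (rule phi_eqI[OF assms(1)])
  show "u + v \<in> VV" "\<phi> g u + \<phi> g v \<in> VV" using assms phi(1) by auto
  show "g \<otimes>\<^bsub>GU\<^esub> \<tau> (u + v) \<otimes>\<^bsub>GU\<^esub> inv\<^bsub>GU\<^esub> g = \<tau> (\<phi> g u + \<phi> g v)"
    using GU.conj_mult[OF NE_carrier[OF assms(1)] tau_carrier tau_carrier, of u v] assms phi tau_add by simp
qed

text \<open>Conjugation by g preserves the commutator scalars of lifts, and these determine the form
  because \<chi> is injective and 2 is invertible.\<close>

lemma phi_sp:
  assumes g: "g \<in> NE" and u: "u \<in> VV" and v: "v \<in> VV"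
  shows "sp m (\<phi> g u) (\<phi> g v) = sp m u v"
proof -
  obtain A where A: "similitude q n A" "g = cl n A" using NE_carrier[OF g] by (auto simp: carrier_PGU)
  obtain A' where A': "similitude q n A'" "A * A' = 1\<^sub>m n" "A' * A = 1\<^sub>m n" using similitude_obtain_inverse[OF A(1)] .
  note c = similitude_carrier[OF A(1)] similitude_carrier[OF A'(1)]
  have rep: "\<exists>d. A * T k w * A' = d \<cdot>\<^sub>m T k (\<phi> g w)" if w: "w \<in> VV" for w
  proof -
    have "g \<otimes>\<^bsub>GU\<^esub> \<tau> w \<otimes>\<^bsub>GU\<^esub> inv\<^bsub>GU\<^esub> g = cl n (A * T k w * A')"
      unfolding A(2) \<tau>_def PGU_inv[OF A(1) A'(1,3)] PGU_mult[OF A(1) T_similitude]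
      by (rule PGU_mult[OF similitude_mult[OF A(1) T_similitude] A'(1)])
    then have "cl n (A * T k w * A') = cl n (T k (\<phi> g w))" using phi(2)[OF g w] by (simp add: \<tau>_def)
    then show ?thesis using cl_eq_iff[of "A * T k w * A'" n "T k (\<phi> g w)"] c by (auto simp: ac)
  qed
  obtain d e where d: "A * T k u * A' = d \<cdot>\<^sub>m T k (\<phi> g u)" and e: "A * T k v * A' = e \<cdot>\<^sub>m T k (\<phi> g v)"
    using rep[OF u] rep[OF v] by blast
  have pr: "(A * B * A') * (A * C * A') = A * (B * C) * A'" if "B \<in> carrier_mat n n" "C \<in> carrier_mat n n" for B C
  proof -
    have "(A * B * A') * (A * C * A') = A * B * (A' * A) * C * A'" using c that by (simp add: ac)
    then show ?thesis unfolding A'(3) using c that by (simp add: ac left_mult_one_mat[of _ n n])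
  qed
  let ?Y = "A * (T k v * T k u) * A'"
  have YG: "?Y \<in> carrier (GL n)"
    using similitude_GL[OF A(1)] similitude_GL[OF A'(1)] T_GL by (intro GL_mult)
  have "\<chi> (2 * sp m u v) \<cdot>\<^sub>m ?Y = A * (T k u * T k v) * A'" unfolding T_commute[OF u v] using c by (simp add: sm ac)
  also have "\<dots> = (d \<cdot>\<^sub>m T k (\<phi> g u)) * (e \<cdot>\<^sub>m T k (\<phi> g v))" using pr[of "T k u" "T k v"] d e by simp
  also have "\<dots> = (d * e) \<cdot>\<^sub>m (T k (\<phi> g u) * T k (\<phi> g v))" by (simp add: sm mult.commute[of _ "_ :: 'a"])
  also have "\<dots> = \<chi> (2 * sp m (\<phi> g u) (\<phi> g v)) \<cdot>\<^sub>m ((e \<cdot>\<^sub>m T k (\<phi> g v)) * (d \<cdot>\<^sub>m T k (\<phi> g u)))"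
    unfolding T_commute[OF phi(1)[OF g u] phi(1)[OF g v]] by (simp add: sm mult_ac[where ?'a = 'a])
  also have "(e \<cdot>\<^sub>m T k (\<phi> g v)) * (d \<cdot>\<^sub>m T k (\<phi> g u)) = ?Y" using pr[of "T k v" "T k u"] d e by simp
  finally have "\<chi> (2 * sp m u v) = \<chi> (2 * sp m (\<phi> g u) (\<phi> g v))" by (rule smult_GL_inject[OF YG n_pos])
  then show ?thesis using chi_eq_iff two_nz by simp
qed

definition hh :: "'a mat set \<Rightarrow> 'g mat" where
  "hh g = mat (2 * m) (2 * m) (\<lambda>(i, j). \<phi> g (unit_vec (2 * m) j) $ i)"

lemma hh_carrier: "hh g \<in> carrier_mat (2 * m) (2 * m)" by (simp add: hh_def)

lemma hh_vec:
  assumes g: "g \<in> NE" and u: "u \<in> VV"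
  shows "hh g *\<^sub>v u = \<phi> g u"
proof (rule eq_vecI)
  fix i assume "i < dim_vec (\<phi> g u)"
  then have i: "i < 2 * m" using phi(1)[OF g u] by simp
  have "\<phi> g u $ i = (\<Sum>j<2 * m. u $ j * \<phi> g (unit_vec (2 * m) j) $ i)"
  proof (rule additive_imp_linear[OF p(1,3) _ u])
    fix v w :: "'g vec" assume "v \<in> VV" "w \<in> VV"
    then show "\<phi> g (v + w) $ i = \<phi> g v $ i + \<phi> g w $ i"
      using phi_add[OF g] phi(1)[OF g, of v] phi(1)[OF g, of w] i by (simp add: index_add_vec)
  qed
  also have "\<dots> = (hh g *\<^sub>v u) $ i"
    using i u by (auto simp: hh_def scalar_prod_def lessThan_atLeast0 mult.commute[of _ "_ :: 'g"] intro!: sum.cong)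
  finally show "(hh g *\<^sub>v u) $ i = \<phi> g u $ i" by simp
qed (use phi(1)[OF g u] in \<open>simp add: hh_def\<close>)

lemma hh_Sp: "g \<in> NE \<Longrightarrow> hh g \<in> carrier (Sp m)"
  unfolding Sp_iff_sp[OF hh_carrier] using hh_vec phi_sp by simp

text \<open>The first isomorphism theorem for \<open>hh\<close>: its kernel is the centraliser
  because E consists of the \<open>\<tau> u\<close>, and s is attained at the class of
  \<open>kron G (1\<^sub>m k)\<close> with G from \<open>Sp_intertwiner\<close>.\<close>

lemma quotient_iso: "(GU\<lparr>carrier := NE\<rparr>) Mod (centralizer GU E) \<cong> (Sp m :: 'g mat monoid)"
proof -
  let ?N = "GU\<lparr>carrier := NE\<rparr>"
  have Ns: "subgroup NE GU" by (rule GU.normalizer_imp_subgroup[OF E_sub])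
  interpret N: group ?N by (rule GU.subgroup_imp_group[OF Ns])
  have hom: "hh \<in> hom ?N (Sp m)"
  proof (rule homI)
    fix g assume "g \<in> carrier ?N"
    then have g: "g \<in> NE" by simp
    then show "hh g \<in> carrier (Sp m)" by (rule hh_Sp)
    fix h assume "h \<in> carrier ?N"
    then have h: "h \<in> NE" by simp
    have gh: "g \<otimes>\<^bsub>GU\<^esub> h \<in> NE" using subgroup.m_closed[OF Ns g h] .
    have "hh (g \<otimes>\<^bsub>GU\<^esub> h) = hh g * hh h"
    proof (rule mat_eq_by_vec[OF hh_carrier mult_carrier_mat[OF hh_carrier hh_carrier]])
      fix u :: "'g vec" assume u: "u \<in> VV"
      have "\<phi> (g \<otimes>\<^bsub>GU\<^esub> h) u = \<phi> g (\<phi> h u)"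
      proof (rule phi_eqI[OF gh u])
        show "\<phi> g (\<phi> h u) \<in> VV" using phi(1) g h u by blast
        show "g \<otimes>\<^bsub>GU\<^esub> h \<otimes>\<^bsub>GU\<^esub> \<tau> u \<otimes>\<^bsub>GU\<^esub> inv\<^bsub>GU\<^esub> (g \<otimes>\<^bsub>GU\<^esub> h) = \<tau> (\<phi> g (\<phi> h u))"
          using GU.conj_conj[OF NE_carrier[OF g] NE_carrier[OF h] tau_carrier, of u] phi(2)[OF h u]
            phi(2)[OF g phi(1)[OF h u]] by simp
      qed
      then show "hh (g \<otimes>\<^bsub>GU\<^esub> h) *\<^sub>v u = hh g * hh h *\<^sub>v u"
        using hh_vec[OF gh u] hh_vec[OF h u] hh_vec[OF g phi(1)[OF h u]] assoc_mult_mat_vec[OF hh_carrier hh_carrier u] by simp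
    qed
    then show "hh (g \<otimes>\<^bsub>?N\<^esub> h) = hh g \<otimes>\<^bsub>Sp m\<^esub> hh h" by simp
  qed
  interpret gh: group_hom ?N "Sp m :: 'g mat monoid" hh
    by (rule group_hom.intro[OF N.is_group group_Sp]) (simp add: group_hom_axioms_def hom)
  have Csub: "g \<in> NE" if "g \<in> centralizer GU E" for g
  proof -
    have "g \<in> carrier GU" "\<forall>x\<in>E. g \<otimes>\<^bsub>GU\<^esub> x \<otimes>\<^bsub>GU\<^esub> inv\<^bsub>GU\<^esub> g = x"
      using that by (simp_all add: GU.centralizer_iff[OF E_sub])
    then show ?thesis by (simp add: GU.normalizer_iff[OF E_sub])
  qed
  have ker: "g \<in> centralizer GU E \<longleftrightarrow> hh g = 1\<^sub>m (2 * m)" if g: "g \<in> NE" for g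
  proof
    assume C: "g \<in> centralizer GU E"
    show "hh g = 1\<^sub>m (2 * m)"
    proof (rule mat_eq_by_vec[OF hh_carrier one_carrier_mat])
      fix u :: "'g vec" assume u: "u \<in> VV"
      have "g \<otimes>\<^bsub>GU\<^esub> \<tau> u \<otimes>\<^bsub>GU\<^esub> inv\<^bsub>GU\<^esub> g = \<tau> u"
        using C GU.centralizer_iff[OF E_sub, of g] u by (simp add: E_def)
      then have "\<phi> g u = u" by (rule phi_eqI[OF g u u])
      then show "hh g *\<^sub>v u = 1\<^sub>m (2 * m) *\<^sub>v u" using hh_vec[OF g u] u by simp
    qed
  next
    assume 1: "hh g = 1\<^sub>m (2 * m)"
    have "g \<otimes>\<^bsub>GU\<^esub> \<tau> u \<otimes>\<^bsub>GU\<^esub> inv\<^bsub>GU\<^esub> g = \<tau> u" if u: "u \<in> VV" for u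
      using phi(2)[OF g u] hh_vec[OF g u] 1 u by simp
    then have "\<forall>x\<in>E. g \<otimes>\<^bsub>GU\<^esub> x \<otimes>\<^bsub>GU\<^esub> inv\<^bsub>GU\<^esub> g = x" by (simp add: E_def)
    then show "g \<in> centralizer GU E" using NE_carrier[OF g] GU.centralizer_iff[OF E_sub] by blast
  qed
  have "kernel ?N (Sp m) hh = centralizer GU E"
    using ker Csub by (auto simp: kernel_def)
  moreover have "hh ` carrier ?N = carrier (Sp m)"
  proof
    show "hh ` carrier ?N \<subseteq> carrier (Sp m)" using gh.hom_closed by blast
    show "carrier (Sp m) \<subseteq> hh ` carrier ?N"
    proof
      fix s assume s: "s \<in> carrier (Sp m :: 'g mat monoid)"
      have sc: "s \<in> carrier_mat (2 * m) (2 * m)" using s by simp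
      obtain G where G: "similitude q N0 G" "\<And>u. u \<in> VV \<Longrightarrow> W (s *\<^sub>v u) * G = G * W u" using Sp_intertwiner[OF s] by blast
      note Gc = similitude_carrier[OF G(1)]
      define A where "A = kron G (1\<^sub>m k)"
      have A: "similitude q n A" unfolding A_def by (rule kron_similitude[OF G(1) similitude_one])
      define g where "g = cl n A"
      have gc: "g \<in> carrier GU" using A by (auto simp: g_def carrier_PGU)
      have AT: "A * T k u = T k (s *\<^sub>v u) * A" if u: "u \<in> VV" for u
      proof -
        have "A * T k u = kron (G * W u) (1\<^sub>m k * 1\<^sub>m k)" "T k (s *\<^sub>v u) * A = kron (W (s *\<^sub>v u) * G) (1\<^sub>m k * 1\<^sub>m k)"
          unfolding A_def T_def by (rule kron_mult[of _ N0 N0 _ N0 _ k k _ k]; use Gc in auto)+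
        then show ?thesis using G(2)[OF u] by simp
      qed
      have conj: "g \<otimes>\<^bsub>GU\<^esub> \<tau> u \<otimes>\<^bsub>GU\<^esub> inv\<^bsub>GU\<^esub> g = \<tau> (s *\<^sub>v u)" if u: "u \<in> VV" for u
      proof -
        have "g \<otimes>\<^bsub>GU\<^esub> \<tau> u = \<tau> (s *\<^sub>v u) \<otimes>\<^bsub>GU\<^esub> g"
          unfolding g_def \<tau>_def PGU_mult[OF A T_similitude] PGU_mult[OF T_similitude A] AT[OF u] ..
        then show ?thesis using GU.conj_eq_iff[OF gc tau_carrier tau_carrier] by blast
      qed
      have sV: "s *\<^sub>v u \<in> VV" if "u \<in> VV" for u using sc that by auto
      have "(\<lambda>x. g \<otimes>\<^bsub>GU\<^esub> x \<otimes>\<^bsub>GU\<^esub> inv\<^bsub>GU\<^esub> g) ` E = E"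
      proof (rule endo_inj_surj)
        show "finite E" using elem_abelian_E by (simp add: elem_abelian_subgroup_def)
        show "(\<lambda>x. g \<otimes>\<^bsub>GU\<^esub> x \<otimes>\<^bsub>GU\<^esub> inv\<^bsub>GU\<^esub> g) ` E \<subseteq> E" using conj sV by (auto simp: E_def)
        show "inj_on (\<lambda>x. g \<otimes>\<^bsub>GU\<^esub> x \<otimes>\<^bsub>GU\<^esub> inv\<^bsub>GU\<^esub> g) E"
          using GU.conj_inj[OF gc] E_sub by (auto simp: inj_on_def subset_iff)
      qed
      then have gN: "g \<in> NE" using gc by (simp add: GU.normalizer_iff[OF E_sub])
      have "hh g = s"
      proof (rule mat_eq_by_vec[OF hh_carrier sc])
        fix u :: "'g vec" assume u: "u \<in> VV"
        then show "hh g *\<^sub>v u = s *\<^sub>v u" using hh_vec[OF gN u] phi_eqI[OF gN u sV[OF u] conj[OF u]] by simp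
      qed
      then show "s \<in> hh ` carrier ?N" using gN by (intro image_eqI[of _ _ g]) auto
    qed
  qed
  ultimately show ?thesis using gh.FactGroup_iso by simp
qed

theorem good_E: "good_subgroup q n p m E TYPE('g)"
proof -
  \<comment> \<open>This gives the strict bound k < n; it rests on m being positive.\<close>
  have "p ^ m > 1" using m p(1) prime_gt_1_nat by (intro one_less_power) auto
  then have "k < n" using k by simp
  then show ?thesis
    unfolding good_subgroup_def
    using elem_abelian_E E_nontoral centralizer_iso quotient_iso k by blast
qed

end

theorem theorem4p33:
  fixes p m n q :: nat
    and TYPE_Fq :: "'f :: {finite, field} itself"
    and TYPE_Fp :: "'g :: {finite, field} itself"
  assumes "prime p" and "odd p" and "m \<ge> 1" and "n \<ge> 1"
    and "q = card (UNIV :: 'f set)"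
    and "card (UNIV :: 'g set) = p"
    and "\<not> p dvd q"
  shows "(\<forall>E :: 'f alg_closure mat set set.
            good_subgroup q n p m E TYPE('g) \<longrightarrow>
              p ^ m dvd n \<and> [int q = -1] (mod int p))
       \<and> (p ^ m dvd n \<and> [int q = -1] (mod int p) \<longrightarrow>
            (\<exists>E :: 'f alg_closure mat set set. good_subgroup q n p m E TYPE('g)))"
proof (intro conjI allI impI)
  interpret frobenius_power q "TYPE('f alg_closure)"
    unfolding assms(5) by (rule frobenius_power_alg_closure)
  have p0: "of_nat p \<noteq> (0 :: 'f alg_closure)"
    using of_nat_prime_alg_closure_nonzero assms by blast
  {
    fix E :: "'f alg_closure mat set set"
    assume "good_subgroup q n p m E TYPE('g)"
    from good_subgroup_imp[OF this assms(1,2) p0 assms(6,4)]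
    show "p ^ m dvd n" "[int q = -1] (mod int p)" by auto
  next
    assume h: "p ^ m dvd n \<and> [int q = -1] (mod int p)"
    then obtain k where nk: "n = p ^ m * k" by (auto elim: dvdE)
    have "int p dvd int q - (-1)" using h cong_iff_dvd_diff by blast
    then have pq: "p dvd q + 1" by (metis diff_minus_eq_add int_dvd_int_iff of_nat_1 of_nat_add)
    obtain \<chi> :: "'g \<Rightarrow> 'f alg_closure" where \<chi>: "\<And>c d. \<chi> (c + d) = \<chi> c * \<chi> d" "\<And>c. \<chi> c = 1 \<longleftrightarrow> c = 0"
      "\<And>c. \<chi> c * \<chi> c ^ q = 1" "\<And>z. z ^ p = 1 \<Longrightarrow> \<exists>c. z = \<chi> c"
      using additive_character_exists[OF assms(1,6) p0 pq] by blast
    obtain f :: "nat \<Rightarrow> nat \<Rightarrow> 'g" where f: "\<And>g. \<exists>i<p ^ m. \<forall>t<m. f i t = g t"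
      "\<And>i j. i < p ^ m \<Longrightarrow> j < p ^ m \<Longrightarrow> (\<And>t. t < m \<Longrightarrow> f i t = f j t) \<Longrightarrow> i = j"
      using enumerate_functions[OF assms(6), of m] by blast
    have "k \<ge> 1" using nk assms(4) by (cases k) auto
    then interpret weyl_PGU q "TYPE('f alg_closure)" p m \<chi> f k
      using assms p0 \<chi> f by unfold_locales blast+
    show "\<exists>E :: 'f alg_closure mat set set. good_subgroup q n p m E TYPE('g)"
      using good_E unfolding nk by blast
  }
qed

end
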